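(* Let $d\geq 2$ be an integer, let $T:\mathbb{Z}^d\curvearrowright (X,\mu)$ be a probability preserving action and let $f\in L^2(\mu)$. Then, with convergence in $L^2(\mu)$, $$\lim_{N\to\infty}\frac{1}{|Q_N^{\mathcal P}|}\sum_{v\in Q_N^{\mathcal P}} T_v f \;=\; P_{\mathcal I}f+\sum_{q\geq 2}\frac{\boldsymbol{\mu}(q)}{J_d(q)}\,P_q f ,$$ where $\boldsymbol{\mu}$ is the Möbius function, $J_d$ is the Jordan totient function, $P_{\mathcal I}$ is the orthogonal projection onto the $T$-invariant functions, and $P_q$ is the orthogonal projection onto the subspace of $L^2(\mu)$ generated by eigenfunctions of order $q$.
   Context: A probability preserving action $T:\mathbb{Z}^d\curvearrowright(X,\mu)$ is a measurable action $v\mapsto T_v$ of $\mathbb{Z}^d$ on a probability space $(X,\mu)$ by measure-preserving transformations; $L^2(\mu)$ (complex-valued functions) is assumed separable. For a function $f$, $T_vf$ denotes the induced Koopman action, $T_vf=f\circ T_v^{-1}$, so that $T_v\mathbf 1_A=\mathbf 1_{T_vA}$. $Q_N=[-N,N]^d\cap\mathbb{Z}^d$. A non-zero vector $v\in\mathbb{Z}^d$ is primitive if the greatest common divisor of its non-zero components is $1$; $\mathcal P\subset\mathbb{Z}^d$ is the set of primitive vectors and $Q_N^{\mathcal P}=Q_N\cap\mathcal P$. $\mathcal I=\{f\in L^2(\mu): T_vf=f \text{ for all } v\in\mathbb{Z}^d\}$. $\mathbb T^d=\mathbb{R}^d/\mathbb{Z}^d$ and $e(x)=\exp(2\pi i x)$.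 The order $\mathrm{ord}(\alpha)$ of $\alpha\in\mathbb T^d$ is the smallest positive integer $n$ with $n\alpha=0$ in $\mathbb T^d$ if one exists, and $\infty$ otherwise. For $\alpha\in\mathbb T^d$, an $\alpha$-eigenfunction is a non-zero $f\in L^2(\mu)$ with $T_vf=e(v\cdot\alpha)f$ for all $v\in\mathbb{Z}^d$; its order is $\mathrm{ord}(\alpha)$. $\mathrm{Eig}_T(\alpha)$ is the closed subspace spanned by the $\alpha$-eigenfunctions, and $P_q$ is the orthogonal projection onto $\mathcal K_q=\bigoplus_{\alpha\in\mathbb T^d,\ \mathrm{ord}(\alpha)=q}\mathrm{Eig}_T(\alpha)$. The Jordan totient function is $J_d(q)=|\{a=(a_1,\ldots,a_d)\in(\mathbb{Z}/q\mathbb{Z})^d:\gcd(a,q)=1\}|$, where $\gcd(a,q)=\gcd(a_1,\ldots,a_d,q)$. *)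

theory Defs
  imports "HOL-Probability.Probability" "HOL-Computational_Algebra.Squarefree"
    "HOL-Library.Extended_Nat"
begin

section \<open>The space of square integrable functions\<close>

text \<open>
  Elements of the Hilbert space are represented by functions rather than by classes of functions
  modulo almost everywhere equality. All subspaces below are closed under almost everywhere
  equality, and two functions represent the same element if and only if their distance
  in \<open>L2_norm\<close> is \<open>0\<close>.
\<close>

definition L2 :: "'a measure \<Rightarrow> ('a \<Rightarrow> complex) set" where
  "L2 M = {f \<in> borel_measurable M. integrable M (\<lambda>x. (cmod (f x))\<^sup>2)}"

definition L2_norm :: "'a measure \<Rightarrow> ('a \<Rightarrow> complex) \<Rightarrow> real" where
  "L2_norm M f = sqrt (LINT x|M. (cmod (f x))\<^sup>2)"

definition L2_inner :: "'a measure \<Rightarrow> ('a \<Rightarrow> complex) \<Rightarrow> ('a \<Rightarrow> complex) \<Rightarrow> complex" where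
  "L2_inner M f g = (LINT x|M. f x * cnj (g x))"

text \<open>
  Membership in \<open>L2\<close> is part of convergence because the Bochner integral of a non-integrable
  function is \<open>0\<close>.
\<close>

definition L2_tendsto :: "'a measure \<Rightarrow> (nat \<Rightarrow> 'a \<Rightarrow> complex) \<Rightarrow> ('a \<Rightarrow> complex) \<Rightarrow> bool" where
  "L2_tendsto M F g \<longleftrightarrow> (\<forall>n. F n \<in> L2 M) \<and> g \<in> L2 M \<and>
     (\<lambda>n. L2_norm M (\<lambda>x. F n x - g x)) \<longlonglongrightarrow> 0"

definition L2_separable :: "'a measure \<Rightarrow> bool" where
  "L2_separable M \<longleftrightarrow> (\<exists>D. countable D \<and> D \<subseteq> L2 M \<and>
     (\<forall>f\<in>L2 M. \<forall>\<epsilon>>0. \<exists>g\<in>D. L2_norm M (\<lambda>x. f x - g x) < \<epsilon>))"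

definition complex_span :: "('a \<Rightarrow> complex) set \<Rightarrow> ('a \<Rightarrow> complex) set" where
  "complex_span S = {\<lambda>x. \<Sum>h\<in>H. c h * h x | H c. finite H \<and> H \<subseteq> S}"

definition L2_closed_span :: "'a measure \<Rightarrow> ('a \<Rightarrow> complex) set \<Rightarrow> ('a \<Rightarrow> complex) set" where
  "L2_closed_span M S =
     {f \<in> L2 M. \<forall>\<epsilon>>0. \<exists>g\<in>complex_span S. L2_norm M (\<lambda>x. f x - g x) < \<epsilon>}"

text \<open>
  The orthogonal projection onto a closed subspace is unique only up to almost everywhere equality,
  hence the choice of a representative.
\<close>

definition is_L2_proj ::
  "'a measure \<Rightarrow> ('a \<Rightarrow> complex) set \<Rightarrow> ('a \<Rightarrow> complex) \<Rightarrow> ('a \<Rightarrow> complex) \<Rightarrow> bool" where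
  "is_L2_proj M K f g \<longleftrightarrow> g \<in> K \<and> (\<forall>h\<in>K. L2_inner M (\<lambda>x. f x - g x) h = 0)"

definition L2_proj ::
  "'a measure \<Rightarrow> ('a \<Rightarrow> complex) set \<Rightarrow> ('a \<Rightarrow> complex) \<Rightarrow> 'a \<Rightarrow> complex" where
  "L2_proj M K f = (SOME g. is_L2_proj M K f g)"

section \<open>Actions of the integer lattice\<close>

locale prob_preserving_action = prob_space M
  for M :: "'a measure" and T :: "int ^ 'd \<Rightarrow> 'a \<Rightarrow> 'a" +
  assumes action_measurable: "T v \<in> M \<rightarrow>\<^sub>M M"
    and action_preserving: "distr M M (T v) = M"
    and action_zero: "x \<in> space M \<Longrightarrow> T 0 x = x"
    and action_add: "x \<in> space M \<Longrightarrow> T (u + v) x = T u (T v x)"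

text \<open>On \<open>space M\<close> the inverse of \<open>T v\<close> is \<open>T (- v)\<close>.\<close>

definition koopman :: "(int ^ 'd \<Rightarrow> 'a \<Rightarrow> 'a) \<Rightarrow> int ^ 'd \<Rightarrow> ('a \<Rightarrow> complex) \<Rightarrow> 'a \<Rightarrow> complex" where
  "koopman T v f = (\<lambda>x. f (T (- v) x))"

definition invariant_functions ::
  "'a measure \<Rightarrow> (int ^ 'd \<Rightarrow> 'a \<Rightarrow> 'a) \<Rightarrow> ('a \<Rightarrow> complex) set" where
  "invariant_functions M T = {f \<in> L2 M. \<forall>v. AE x in M. koopman T v f x = f x}"

text \<open>
  Points of the torus are given by representatives in \<open>real ^ 'd\<close>; the notions below depend on
  \<open>\<alpha>\<close> only modulo the integer lattice.
\<close>

definition torus_ord :: "real ^ 'd \<Rightarrow> enat" where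
  "torus_ord \<alpha> =
     (if \<exists>n>0. \<forall>i. of_nat n * \<alpha> $ i \<in> \<int>
      then enat (LEAST n. n > 0 \<and> (\<forall>i. of_nat n * \<alpha> $ i \<in> \<int>)) else \<infinity>)"

definition lattice_character :: "real ^ 'd \<Rightarrow> int ^ 'd \<Rightarrow> complex" where
  "lattice_character \<alpha> v =
     exp (2 * of_real pi * \<i> * of_real (\<Sum>i\<in>UNIV. of_int (v $ i) * \<alpha> $ i))"

definition eigenfunctions ::
  "'a measure \<Rightarrow> (int ^ 'd \<Rightarrow> 'a \<Rightarrow> 'a) \<Rightarrow> real ^ 'd \<Rightarrow> ('a \<Rightarrow> complex) set" where
  "eigenfunctions M T \<alpha> =
     {f \<in> L2 M. \<not> (AE x in M. f x = 0) \<and>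
        (\<forall>v. AE x in M. koopman T v f x = lattice_character \<alpha> v * f x)}"

definition Eig ::
  "'a measure \<Rightarrow> (int ^ 'd \<Rightarrow> 'a \<Rightarrow> 'a) \<Rightarrow> real ^ 'd \<Rightarrow> ('a \<Rightarrow> complex) set" where
  "Eig M T \<alpha> = L2_closed_span M (eigenfunctions M T \<alpha>)"

text \<open>
  The Hilbert sum of the mutually orthogonal spaces \<open>Eig M T \<alpha>\<close> is the closed span of their union.
\<close>

definition Eig_order ::
  "'a measure \<Rightarrow> (int ^ 'd \<Rightarrow> 'a \<Rightarrow> 'a) \<Rightarrow> nat \<Rightarrow> ('a \<Rightarrow> complex) set" where
  "Eig_order M T q = L2_closed_span M (\<Union>\<alpha>\<in>{\<alpha>. torus_ord \<alpha> = enat q}. Eig M T \<alpha>)"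

section \<open>Primitive vectors and arithmetic functions\<close>

definition lattice_cube :: "nat \<Rightarrow> (int ^ 'd) set" where
  "lattice_cube N = {v. \<forall>i. v $ i \<in> {- int N..int N}}"

definition primitive_vectors :: "(int ^ 'd) set" where
  "primitive_vectors = {v. v \<noteq> 0 \<and> Gcd {v $ i | i. v $ i \<noteq> 0} = 1}"

definition primitive_cube :: "nat \<Rightarrow> (int ^ 'd) set" where
  "primitive_cube N = lattice_cube N \<inter> primitive_vectors"

definition moebius_mu :: "nat \<Rightarrow> int" where
  "moebius_mu n = (if squarefree n then (- 1) ^ card (prime_factors n) else 0)"

text \<open>Residue classes modulo \<open>q\<close> are represented by \<open>0, \<dots>, q - 1\<close>.\<close>

definition jordan_totient :: "nat \<Rightarrow> nat \<Rightarrow> nat" where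
  "jordan_totient d q =
     card {a \<in> {..<d} \<rightarrow>\<^sub>E {..<q}. Gcd (insert q (a ` {..<d})) = 1}"

end

theory Submission
  imports Defs "HOL-Real_Asymp.Real_Asymp"
begin

text \<open>
  Write \<open>U\<^sub>v\<close> for the Koopman operators, \<open>Q\<^sub>N\<close> for the cube of side \<open>2 N + 1\<close>, and \<open>P\<^sub>q\<close> for the
  projection onto the span of the eigenfunctions of order \<open>q\<close>. The order \<open>1\<close> part is the projection
  onto the invariant functions and its coefficient \<open>\<mu>(1) / J(1)\<close> is \<open>1\<close>, so the claim is that the
  primitive averages of \<open>f\<close> converge to the sum of \<open>\<mu>(q) / J(q) P\<^sub>q f\<close> over all \<open>q \<ge> 1\<close>.

  A vector is primitive if and only if it is non-zero and no prime divides all its coordinates. For a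
  finite set \<open>A\<close> of primes, the condition that no prime of \<open>A\<close> divides \<open>v\<close> is periodic in \<open>v\<close>.
  Inclusion and exclusion followed by the orthogonality of characters expands its indicator into
  finitely many characters with rational frequencies. The average over \<open>Q\<^sub>N\<close> of
  \<open>U\<^sub>v f\<close> times the conjugate of such a character converges to the projection of \<open>f\<close> onto the
  corresponding eigenspace. This is von Neumann's mean ergodic theorem \<open>mean_ergodic\<close> for the action
  twisted by the character. Collecting the frequencies by their order gives, in
  \<open>sieve_coefficients\<close> and \<open>sieved_average_tendsto\<close>, the limit \<open>D\<^sub>A\<close> times the sum of
  \<open>\<mu>(q) / J(q) P\<^sub>q f\<close> over the divisors \<open>q\<close> of the product of \<open>A\<close>, where \<open>D\<^sub>A\<close> is the density of the
  vectors that pass the sieve. After division by \<open>D\<^sub>A\<close> the coefficient of \<open>P\<^sub>q f\<close> no longer depends on \<open>A\<close>.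

  It remains to let \<open>A\<close> grow to the set of all primes. If \<open>A\<close> consists of the primes up to \<open>K\<close>, the
  vectors of \<open>Q\<^sub>N\<close> that pass the sieve without being primitive are multiples of some \<open>m\<close> with
  \<open>K < m \<le> N\<close>. In dimension at least \<open>2\<close> their proportion is \<open>O(1 / K)\<close> uniformly in \<open>N\<close>, by
  \<open>card_sieved_minus_primitive\<close>, while \<open>D\<^sub>A \<ge> 1 / 2\<close> by \<open>sieve_density_ge_half\<close>. On the side of the
  limit, the functions \<open>P\<^sub>q f\<close> are orthogonal and their coefficients are bounded by \<open>1\<close>, so Bessel's
  inequality controls the terms with \<open>q > K\<close>.
\<close>

section \<open>The seminormed space of square integrable functions\<close>

lemma L2_I: "f \<in> borel_measurable M \<Longrightarrow> integrable M (\<lambda>x. (cmod (f x))\<^sup>2) \<Longrightarrow> f \<in> L2 M"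
  by (simp add: L2_def)

lemma L2_measurable: "f \<in> L2 M \<Longrightarrow> f \<in> borel_measurable M"
  by (simp add: L2_def)

lemma L2_square_integrable: "f \<in> L2 M \<Longrightarrow> integrable M (\<lambda>x. (cmod (f x))\<^sup>2)"
  by (simp add: L2_def)

lemma L2_zero [simp]: "(\<lambda>x. 0) \<in> L2 M"
  by (simp add: L2_def)

lemma L2_cmult [intro]:
  assumes "f \<in> L2 M" shows "(\<lambda>x. c * f x) \<in> L2 M"
  using assms by (auto simp: L2_def norm_mult power_mult_distrib)

lemma L2_uminus:
  assumes "f \<in> L2 M" shows "(\<lambda>x. - f x) \<in> L2 M"
  using L2_cmult[OF assms, of "-1"] by simp

lemma L2_add [intro]:
  assumes f: "f \<in> L2 M" and g: "g \<in> L2 M"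
  shows "(\<lambda>x. f x + g x) \<in> L2 M"
proof (rule L2_I)
  note [measurable] = L2_measurable[OF f] L2_measurable[OF g]
  show "(\<lambda>x. f x + g x) \<in> borel_measurable M" by measurable
  have "(cmod (f x + g x))\<^sup>2 \<le> 2 * (cmod (f x))\<^sup>2 + 2 * (cmod (g x))\<^sup>2" for x
  proof -
    have "(cmod (f x + g x))\<^sup>2 \<le> (cmod (f x) + cmod (g x))\<^sup>2"
      by (intro power_mono norm_triangle_ineq) auto
    also have "\<dots> \<le> 2 * (cmod (f x))\<^sup>2 + 2 * (cmod (g x))\<^sup>2"
      using sum_squares_bound[of "cmod (f x)" "cmod (g x)"] by (simp add: power2_sum)
    finally show ?thesis .
  qed
  then show "integrable M (\<lambda>x. (cmod (f x + g x))\<^sup>2)"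
    using L2_square_integrable[OF f] L2_square_integrable[OF g]
    by - (rule Bochner_Integration.integrable_bound
          [of M "\<lambda>x. 2 * (cmod (f x))\<^sup>2 + 2 * (cmod (g x))\<^sup>2"], simp_all)
qed

lemma L2_diff [intro]:
  assumes "f \<in> L2 M" "g \<in> L2 M" shows "(\<lambda>x. f x - g x) \<in> L2 M"
  using L2_add[OF assms(1) L2_uminus[OF assms(2)]] by simp

lemma L2_sum [intro]:
  assumes "\<And>i. i \<in> I \<Longrightarrow> F i \<in> L2 M"
  shows "(\<lambda>x. \<Sum>i\<in>I. F i x) \<in> L2 M"
  using assms by (induction I rule: infinite_finite_induct) auto

lemma L2_lincomb:
  assumes "\<And>i. i \<in> I \<Longrightarrow> F i \<in> L2 M"
  shows "(\<lambda>x. \<Sum>i\<in>I. c i * F i x) \<in> L2 M"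
  by (intro L2_sum L2_cmult assms)

lemma L2_norm_nonneg [simp]: "L2_norm M f \<ge> 0"
  by (simp add: L2_norm_def)

lemma L2_norm_power2: "(L2_norm M f)\<^sup>2 = (LINT x|M. (cmod (f x))\<^sup>2)"
  by (simp add: L2_norm_def)

lemma L2_norm_cong:
  "(\<And>x. x \<in> space M \<Longrightarrow> f x = g x) \<Longrightarrow> L2_norm M f = L2_norm M g"
  unfolding L2_norm_def by (auto intro!: arg_cong[of _ _ sqrt] Bochner_Integration.integral_cong)

lemma L2_norm_cong_AE:
  assumes "f \<in> L2 M" "g \<in> L2 M" "AE x in M. f x = g x"
  shows "L2_norm M f = L2_norm M g"
  unfolding L2_norm_def
  using assms by (intro arg_cong[of _ _ sqrt] integral_cong_AE) (auto dest!: L2_measurable)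

lemma L2_norm_zero [simp]: "L2_norm M (\<lambda>x. 0) = 0"
  by (simp add: L2_norm_def)

lemma L2_norm_cmult: "L2_norm M (\<lambda>x. c * f x) = cmod c * L2_norm M f"
  by (simp add: L2_norm_def norm_mult power_mult_distrib real_sqrt_mult)

lemma L2_norm_minus_commute: "L2_norm M (\<lambda>x. f x - g x) = L2_norm M (\<lambda>x. g x - f x)"
  by (simp add: L2_norm_def norm_minus_commute)

lemma L2_norm_eq_0_iff:
  assumes "f \<in> L2 M" shows "L2_norm M f = 0 \<longleftrightarrow> (AE x in M. f x = 0)"
  using integral_nonneg_eq_0_iff_AE[OF L2_square_integrable[OF assms]] by (simp add: L2_norm_def)

lemma L2_prod_integrable:
  assumes f: "f \<in> L2 M" and g: "g \<in> L2 M"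
  shows "integrable M (\<lambda>x. cmod (f x) * cmod (g x))"
proof -
  note [measurable] = L2_measurable[OF f] L2_measurable[OF g]
  have "cmod (f x) * cmod (g x) \<le> (cmod (f x))\<^sup>2 + (cmod (g x))\<^sup>2" for x
    using sum_squares_bound[of "cmod (f x)" "cmod (g x)"]
      mult_nonneg_nonneg[OF norm_ge_zero[of "f x"] norm_ge_zero[of "g x"]] by linarith
  then show ?thesis
    using L2_square_integrable[OF f] L2_square_integrable[OF g]
    by - (rule Bochner_Integration.integrable_bound
          [of M "\<lambda>x. (cmod (f x))\<^sup>2 + (cmod (g x))\<^sup>2"], simp_all add: abs_mult)
qed

lemma L2_inner_integrable:
  assumes f: "f \<in> L2 M" and g: "g \<in> L2 M"
  shows "integrable M (\<lambda>x. f x * cnj (g x))"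
proof -
  note [measurable] = L2_measurable[OF f] L2_measurable[OF g]
  have [measurable]: "(\<lambda>x. cnj (g x)) \<in> borel_measurable M"
    by (rule measurable_compose[OF L2_measurable[OF g] borel_measurable_continuous_onI])
      (intro continuous_intros)
  show ?thesis
    by (rule Bochner_Integration.integrable_bound[OF L2_prod_integrable[OF f g]])
      (auto simp: norm_mult)
qed

lemma L2_inner_self: "L2_inner M f f = of_real ((L2_norm M f)\<^sup>2)"
proof -
  have "L2_inner M f f = (LINT x|M. complex_of_real ((cmod (f x))\<^sup>2))"
    unfolding L2_inner_def
    by (intro Bochner_Integration.integral_cong refl) (simp only: complex_norm_square)
  then show ?thesis by (simp only: L2_norm_power2 integral_complex_of_real)
qed

lemma L2_inner_commute: "L2_inner M f g = cnj (L2_inner M g f)"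
proof -
  have "cnj (L2_inner M g f) = (LINT x|M. cnj (g x * cnj (f x)))"
    unfolding L2_inner_def by (rule Bochner_Integration.integral_cnj[symmetric])
  then show ?thesis by (simp add: L2_inner_def mult.commute)
qed

lemma L2_inner_cong_AE:
  assumes "f \<in> L2 M" "f' \<in> L2 M" "g \<in> L2 M" "g' \<in> L2 M"
    and "AE x in M. f x = f' x" "AE x in M. g x = g' x"
  shows "L2_inner M f g = L2_inner M f' g'"
  unfolding L2_inner_def
proof (rule integral_cong_AE)
  show "(\<lambda>x. f x * cnj (g x)) \<in> borel_measurable M" "(\<lambda>x. f' x * cnj (g' x)) \<in> borel_measurable M"
    using assms by (auto intro!: borel_measurable_integrable[OF L2_inner_integrable])
  show "AE x in M. f x * cnj (g x) = f' x * cnj (g' x)"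
    using assms(5,6) by eventually_elim simp
qed

lemma L2_inner_add_left:
  assumes "f \<in> L2 M" "g \<in> L2 M" "h \<in> L2 M"
  shows "L2_inner M (\<lambda>x. f x + g x) h = L2_inner M f h + L2_inner M g h"
  unfolding L2_inner_def
  by (simp add: distrib_right L2_inner_integrable[OF assms(1,3)] L2_inner_integrable[OF assms(2,3)])

lemma L2_inner_cmult_left: "L2_inner M (\<lambda>x. c * f x) h = c * L2_inner M f h"
  unfolding L2_inner_def by (simp add: mult.assoc)

lemma L2_inner_diff_left:
  assumes "f \<in> L2 M" "g \<in> L2 M" "h \<in> L2 M"
  shows "L2_inner M (\<lambda>x. f x - g x) h = L2_inner M f h - L2_inner M g h"
  unfolding L2_inner_def
  by (simp add: left_diff_distrib L2_inner_integrable[OF assms(1,3)]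
      L2_inner_integrable[OF assms(2,3)])

lemma L2_inner_zero_left [simp]: "L2_inner M (\<lambda>x. 0) h = 0"
  by (simp add: L2_inner_def)

lemma L2_inner_sum_left:
  assumes "\<And>i. i \<in> I \<Longrightarrow> F i \<in> L2 M" "h \<in> L2 M"
  shows "L2_inner M (\<lambda>x. \<Sum>i\<in>I. F i x) h = (\<Sum>i\<in>I. L2_inner M (F i) h)"
  using assms(1)
proof (induction I rule: infinite_finite_induct)
  case (insert i I)
  then show ?case
    using L2_inner_add_left[of "F i" M "\<lambda>x. \<Sum>i\<in>I. F i x" h] assms(2) L2_sum[of I F M] by simp
qed auto

lemma L2_inner_add_right:
  assumes "f \<in> L2 M" "g \<in> L2 M" "h \<in> L2 M"
  shows "L2_inner M h (\<lambda>x. f x + g x) = L2_inner M h f + L2_inner M h g"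
  unfolding L2_inner_commute[of M h] by (simp add: L2_inner_add_left assms)

lemma L2_inner_diff_right:
  assumes "f \<in> L2 M" "g \<in> L2 M" "h \<in> L2 M"
  shows "L2_inner M h (\<lambda>x. f x - g x) = L2_inner M h f - L2_inner M h g"
  unfolding L2_inner_commute[of M h] by (simp add: L2_inner_diff_left assms)

lemma L2_inner_cmult_right: "L2_inner M h (\<lambda>x. c * f x) = cnj c * L2_inner M h f"
  unfolding L2_inner_commute[of M h] by (simp add: L2_inner_cmult_left)

lemma L2_inner_sum_right:
  assumes "\<And>i. i \<in> I \<Longrightarrow> F i \<in> L2 M" "h \<in> L2 M"
  shows "L2_inner M h (\<lambda>x. \<Sum>i\<in>I. F i x) = (\<Sum>i\<in>I. L2_inner M h (F i))"
  unfolding L2_inner_commute[of M h] by (simp add: L2_inner_sum_left assms)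

lemma L2_Cauchy_Schwarz_abs:
  assumes f: "f \<in> L2 M" and g: "g \<in> L2 M"
  shows "(LINT x|M. cmod (f x) * cmod (g x)) \<le> L2_norm M f * L2_norm M g"
proof -
  note [measurable] = L2_measurable[OF f] L2_measurable[OF g]
  have sq: "(\<integral>\<^sup>+x. (ennreal (cmod (h x)))\<^sup>2 \<partial>M) = ennreal ((L2_norm M h)\<^sup>2)" if "h \<in> L2 M" for h
    using nn_integral_eq_integral[OF L2_square_integrable[OF that]]
    by (simp add: L2_norm_power2 ennreal_power)
  have "ennreal ((LINT x|M. cmod (f x) * cmod (g x))\<^sup>2)
      = (\<integral>\<^sup>+x. ennreal (cmod (f x)) * ennreal (cmod (g x)) \<partial>M)\<^sup>2"
    using nn_integral_eq_integral[OF L2_prod_integrable[OF f g]]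
    by (simp add: ennreal_mult'' ennreal_power[symmetric] integral_nonneg)
  also have "\<dots> \<le> ennreal ((L2_norm M f)\<^sup>2) * ennreal ((L2_norm M g)\<^sup>2)"
    unfolding sq[OF f, symmetric] sq[OF g, symmetric] by (rule Cauchy_Schwarz_nn_integral) auto
  also have "\<dots> = ennreal ((L2_norm M f * L2_norm M g)\<^sup>2)"
    by (simp add: ennreal_mult'' power_mult_distrib)
  finally have "(LINT x|M. cmod (f x) * cmod (g x))\<^sup>2 \<le> (L2_norm M f * L2_norm M g)\<^sup>2"
    by (subst (asm) ennreal_le_iff) auto
  then show ?thesis by (rule power2_le_imp_le) simp
qed

lemma L2_Cauchy_Schwarz:
  assumes f: "f \<in> L2 M" and g: "g \<in> L2 M"
  shows "cmod (L2_inner M f g) \<le> L2_norm M f * L2_norm M g"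
proof -
  have "cmod (L2_inner M f g) \<le> (LINT x|M. cmod (f x * cnj (g x)))"
    unfolding L2_inner_def by (rule integral_norm_bound)
  also have "\<dots> \<le> L2_norm M f * L2_norm M g"
    using L2_Cauchy_Schwarz_abs[OF f g] by (simp add: norm_mult)
  finally show ?thesis .
qed

lemma L2_norm_add_power2:
  assumes f: "f \<in> L2 M" and g: "g \<in> L2 M"
  shows "(L2_norm M (\<lambda>x. f x + g x))\<^sup>2
    = (L2_norm M f)\<^sup>2 + (L2_norm M g)\<^sup>2 + 2 * Re (L2_inner M f g)"
proof -
  have "complex_of_real ((L2_norm M (\<lambda>x. f x + g x))\<^sup>2)
    = L2_inner M f f + L2_inner M g g + (L2_inner M f g + cnj (L2_inner M f g))"
    unfolding L2_inner_self[symmetric] L2_inner_commute[of M g f, symmetric]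
    using f g L2_add[OF f g] by (simp add: L2_inner_add_left L2_inner_add_right)
  also have "\<dots> = complex_of_real
      ((L2_norm M f)\<^sup>2 + (L2_norm M g)\<^sup>2 + 2 * Re (L2_inner M f g))"
    by (simp add: L2_inner_self complex_add_cnj)
  finally show ?thesis by (simp only: of_real_eq_iff)
qed

lemma L2_norm_triangle:
  assumes f: "f \<in> L2 M" and g: "g \<in> L2 M"
  shows "L2_norm M (\<lambda>x. f x + g x) \<le> L2_norm M f + L2_norm M g"
proof (rule power2_le_imp_le)
  show "(L2_norm M (\<lambda>x. f x + g x))\<^sup>2 \<le> (L2_norm M f + L2_norm M g)\<^sup>2"
    using L2_Cauchy_Schwarz[OF f g] complex_Re_le_cmod[of "L2_inner M f g"]
    by (simp add: L2_norm_add_power2[OF f g] power2_sum)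
qed simp

lemma L2_norm_triangle_diff:
  assumes "f \<in> L2 M" "g \<in> L2 M" "h \<in> L2 M"
  shows "L2_norm M (\<lambda>x. f x - h x) \<le> L2_norm M (\<lambda>x. f x - g x) + L2_norm M (\<lambda>x. g x - h x)"
  using L2_norm_triangle[OF L2_diff[OF assms(1,2)] L2_diff[OF assms(2,3)]] by simp

lemma L2_norm_le_diff:
  assumes "f \<in> L2 M" "g \<in> L2 M"
  shows "L2_norm M f \<le> L2_norm M g + L2_norm M (\<lambda>x. f x - g x)"
  using L2_norm_triangle[OF assms(2) L2_diff[OF assms]] by simp

lemma L2_norm_sum_le:
  assumes "\<And>i. i \<in> I \<Longrightarrow> F i \<in> L2 M"
  shows "L2_norm M (\<lambda>x. \<Sum>i\<in>I. F i x) \<le> (\<Sum>i\<in>I. L2_norm M (F i))"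
  using assms
proof (induction I rule: infinite_finite_induct)
  case (insert i I)
  then show ?case
    using L2_norm_triangle[of "F i" M "\<lambda>x. \<Sum>i\<in>I. F i x"] L2_sum[of I F M] by force
qed auto

lemma L2_parallelogram:
  assumes f: "f \<in> L2 M" and g: "g \<in> L2 M"
  shows "(L2_norm M (\<lambda>x. f x - g x))\<^sup>2 + (L2_norm M (\<lambda>x. f x + g x))\<^sup>2
    = 2 * (L2_norm M f)\<^sup>2 + 2 * (L2_norm M g)\<^sup>2"
proof -
  have "L2_norm M (\<lambda>x. - g x) = L2_norm M g"
    using L2_norm_cmult[of M "-1" g] by simp
  moreover have "L2_inner M f (\<lambda>x. - g x) = - L2_inner M f g"
    using L2_inner_cmult_right[of M f "-1" g] by simp
  ultimately show ?thesis
    using L2_norm_add_power2[OF f L2_uminus[OF g]] L2_norm_add_power2[OF f g] by simp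
qed

lemma L2_pythagoras:
  assumes "finite I" "\<And>i. i \<in> I \<Longrightarrow> F i \<in> L2 M"
    and "\<And>i j. i \<in> I \<Longrightarrow> j \<in> I \<Longrightarrow> i \<noteq> j \<Longrightarrow> L2_inner M (F i) (F j) = 0"
  shows "(L2_norm M (\<lambda>x. \<Sum>i\<in>I. F i x))\<^sup>2 = (\<Sum>i\<in>I. (L2_norm M (F i))\<^sup>2)"
  using assms
proof (induction I rule: finite_induct)
  case (insert i I)
  have "L2_inner M (F i) (\<lambda>x. \<Sum>i\<in>I. F i x) = (\<Sum>j\<in>I. L2_inner M (F i) (F j))"
    using insert by (intro L2_inner_sum_right) auto
  also have "\<dots> = 0" using insert by (intro sum.neutral) auto
  finally show ?case
    using insert L2_norm_add_power2[of "F i" M "\<lambda>x. \<Sum>i\<in>I. F i x"] L2_sum[of I F M] by simp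
qed simp

section \<open>Convergence and completeness\<close>

lemma L2_tendstoD:
  assumes "L2_tendsto M F g"
  shows "F n \<in> L2 M" "g \<in> L2 M" "(\<lambda>n. L2_norm M (\<lambda>x. F n x - g x)) \<longlonglongrightarrow> 0"
  using assms by (auto simp: L2_tendsto_def)

lemma L2_tendsto_norm:
  assumes "L2_tendsto M F g" shows "(\<lambda>n. L2_norm M (F n)) \<longlonglongrightarrow> L2_norm M g"
proof -
  note F = L2_tendstoD[OF assms]
  have "norm (L2_norm M (F n) - L2_norm M g) \<le> L2_norm M (\<lambda>x. F n x - g x)" for n
    using L2_norm_le_diff[OF F(1)[of n] F(2)] L2_norm_le_diff[OF F(2) F(1)[of n]]
      L2_norm_minus_commute[of M g "F n"] by auto
  then have "(\<lambda>n. L2_norm M (F n) - L2_norm M g) \<longlonglongrightarrow> 0"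
    by (intro Lim_null_comparison[OF _ F(3)]) auto
  then show ?thesis by (simp add: LIM_zero_iff)
qed

lemma L2_tendsto_inner:
  assumes "L2_tendsto M F g" "h \<in> L2 M"
  shows "(\<lambda>n. L2_inner M (F n) h) \<longlonglongrightarrow> L2_inner M g h"
proof -
  note F = L2_tendstoD[OF assms(1)]
  have "norm (L2_inner M (F n) h - L2_inner M g h)
      \<le> L2_norm M (\<lambda>x. F n x - g x) * L2_norm M h" for n
    using L2_Cauchy_Schwarz[OF L2_diff[OF F(1) F(2)] assms(2), of n]
    by (simp add: L2_inner_diff_left[OF F(1,2) assms(2)])
  then have "(\<lambda>n. L2_inner M (F n) h - L2_inner M g h) \<longlonglongrightarrow> 0"
    by (intro Lim_null_comparison[OF _ tendsto_mult_left_zero[OF F(3), of "L2_norm M h"]]) auto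
  then show ?thesis by (simp add: LIM_zero_iff)
qed

lemma L2_tendsto_cmult:
  assumes "L2_tendsto M F g"
  shows "L2_tendsto M (\<lambda>n x. c * F n x) (\<lambda>x. c * g x)"
proof -
  have "(\<lambda>x. c * F n x - c * g x) = (\<lambda>x. c * (F n x - g x))" for n
    by (simp add: algebra_simps)
  then show ?thesis
    using assms tendsto_mult_right_zero[OF L2_tendstoD(3)[OF assms], of "cmod c"]
    by (auto simp: L2_tendsto_def L2_norm_cmult)
qed

lemma L2_tendsto_zero: "L2_tendsto M (\<lambda>n x. 0) (\<lambda>x. 0)"
  by (simp add: L2_tendsto_def)

lemma L2_tendsto_add:
  assumes "L2_tendsto M F g" "L2_tendsto M F' g'"
  shows "L2_tendsto M (\<lambda>n x. F n x + F' n x) (\<lambda>x. g x + g' x)"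
proof -
  note F = L2_tendstoD[OF assms(1)] L2_tendstoD[OF assms(2)]
  have "L2_norm M (\<lambda>x. F n x + F' n x - (g x + g' x))
      \<le> L2_norm M (\<lambda>x. F n x - g x) + L2_norm M (\<lambda>x. F' n x - g' x)" for n
    using L2_norm_triangle[OF L2_diff[OF F(1) F(2)] L2_diff[OF F(4) F(5)], of n n]
    by (simp add: algebra_simps)
  then have "(\<lambda>n. L2_norm M (\<lambda>x. F n x + F' n x - (g x + g' x))) \<longlonglongrightarrow> 0"
    by (intro Lim_null_comparison[OF _ tendsto_add_zero[OF F(3) F(6)]]) auto
  then show ?thesis using F by (auto simp: L2_tendsto_def)
qed

lemma L2_tendsto_lincomb:
  assumes "\<And>i. i \<in> I \<Longrightarrow> L2_tendsto M (F i) (g i)"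
  shows "L2_tendsto M (\<lambda>n x. \<Sum>i\<in>I. c i * F i n x) (\<lambda>x. \<Sum>i\<in>I. c i * g i x)"
  using assms
proof (induction I rule: infinite_finite_induct)
  case (insert i I)
  then show ?case
    using L2_tendsto_add[OF L2_tendsto_cmult[of M "F i" "g i" "c i"], of "\<lambda>n x. \<Sum>i\<in>I. c i * F i n x"]
    by simp
qed (auto simp: L2_tendsto_zero)

lemma L2_tendsto_cong_AE:
  assumes "L2_tendsto M F g" "\<And>n. F' n \<in> L2 M" "g' \<in> L2 M"
    and "\<And>n. AE x in M. F n x = F' n x" "AE x in M. g x = g' x"
  shows "L2_tendsto M F' g'"
proof -
  note F = L2_tendstoD[OF assms(1)]
  have "L2_norm M (\<lambda>x. F' n x - g' x) = L2_norm M (\<lambda>x. F n x - g x)" for n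
  proof (rule L2_norm_cong_AE)
    show "AE x in M. F' n x - g' x = F n x - g x"
      using assms(4)[of n] assms(5) by eventually_elim simp
  qed (use assms(2,3) F(1,2) in \<open>auto intro!: L2_diff\<close>)
  then show ?thesis using assms F(3) by (simp add: L2_tendsto_def)
qed

text \<open>
  Completeness (Riesz--Fischer). On a probability space the \<open>L\<^sup>2\<close> norm dominates the \<open>L\<^sup>1\<close> norm,
  so a Cauchy sequence has an almost everywhere convergent subsequence, and Fatou's lemma
  transfers the Cauchy estimates to its limit.
\<close>

lemma (in prob_space) L2_complete:
  assumes F: "\<And>n. F n \<in> L2 M"
    and Cauchy: "\<And>e. e > 0 \<Longrightarrow> \<exists>K. \<forall>m\<ge>K. \<forall>n\<ge>K. L2_norm M (\<lambda>x. F m x - F n x) < e"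
  shows "\<exists>g. L2_tendsto M F g"
proof -
  note [measurable] = L2_measurable[OF F]
  have one: "(\<lambda>x. 1) \<in> L2 M" "L2_norm M (\<lambda>x. 1) = 1"
    by (auto simp: L2_def L2_norm_def prob_space)
  have L1_le: "(LINT x|M. cmod (h x)) \<le> L2_norm M h" if "h \<in> L2 M" for h
    using L2_Cauchy_Schwarz_abs[OF that one(1)] one(2) by simp
  have int: "integrable M (F n)" for n
    using L2_inner_integrable[OF F one(1), of n] by simp
  obtain r where r: "strict_mono r" "AE x in M. Cauchy (\<lambda>i. F (r i) x)"
  proof (rule cauchy_L1_AE_cauchy_subseq[of M F])
    fix e :: real assume "e > 0"
    then obtain K where "\<forall>m\<ge>K. \<forall>n\<ge>K. L2_norm M (\<lambda>x. F m x - F n x) < e" using Cauchy by blast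
    then show "\<exists>N. \<forall>i\<ge>N. \<forall>j\<ge>N. LINT x|M. norm (F i x - F j x) < e"
      using L1_le[OF L2_diff[OF F F]] by (meson le_less_trans)
  qed (use int in auto)
  define g where "g x = lim (\<lambda>i. F (r i) x)" for x
  have [measurable]: "g \<in> borel_measurable M"
    unfolding g_def by (rule borel_measurable_lim_metric) simp
  have lim: "AE x in M. (\<lambda>i. F (r i) x) \<longlonglongrightarrow> g x"
    using r(2) by eventually_elim (simp add: g_def Cauchy_convergent_iff convergent_LIMSEQ_iff)
  have key: "(\<integral>\<^sup>+x. ennreal ((cmod (F n x - g x))\<^sup>2) \<partial>M) \<le> ennreal (e\<^sup>2)"
    if K: "\<forall>m\<ge>K. \<forall>n\<ge>K. L2_norm M (\<lambda>x. F m x - F n x) < e" "n \<ge> K" for n K e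
  proof -
    have "(\<integral>\<^sup>+x. ennreal ((cmod (F n x - g x))\<^sup>2) \<partial>M)
        = (\<integral>\<^sup>+x. liminf (\<lambda>i. ennreal ((cmod (F n x - F (r i) x))\<^sup>2)) \<partial>M)"
    proof (rule nn_integral_cong_AE, use lim in eventually_elim)
      case (elim x)
      then have "(\<lambda>i. ennreal ((cmod (F n x - F (r i) x))\<^sup>2)) \<longlonglongrightarrow> ennreal ((cmod (F n x - g x))\<^sup>2)"
        by (intro tendsto_intros)
      then show ?case by (rule lim_imp_Liminf[OF trivial_limit_sequentially, symmetric])
    qed
    also have "\<dots> \<le> liminf (\<lambda>i. \<integral>\<^sup>+x. ennreal ((cmod (F n x - F (r i) x))\<^sup>2) \<partial>M)"
      by (rule nn_integral_liminf) simp
    also have "\<dots> \<le> ennreal (e\<^sup>2)"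
    proof (rule Liminf_le)
      show "eventually (\<lambda>i. (\<integral>\<^sup>+x. ennreal ((cmod (F n x - F (r i) x))\<^sup>2) \<partial>M) \<le> ennreal (e\<^sup>2)) sequentially"
        using eventually_ge_at_top[of K]
      proof eventually_elim
        case (elim i)
        then have "L2_norm M (\<lambda>x. F n x - F (r i) x) < e"
          using K seq_suble[OF r(1), of i] by auto
        then have "(L2_norm M (\<lambda>x. F n x - F (r i) x))\<^sup>2 \<le> e\<^sup>2"
          by (intro power_mono) auto
        then show ?case
          using nn_integral_eq_integral[OF L2_square_integrable[OF L2_diff[OF F[of n] F[of "r i"]]]]
          by (simp add: L2_norm_power2 ennreal_leI)
      qed
    qed auto
    finally show ?thesis .
  qed
  have diff: "(\<lambda>x. F n x - g x) \<in> L2 M \<and> L2_norm M (\<lambda>x. F n x - g x) \<le> e"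
    if K: "\<forall>m\<ge>K. \<forall>n\<ge>K. L2_norm M (\<lambda>x. F m x - F n x) < e" "n \<ge> K" for n K e
  proof -
    have fin: "integrable M (\<lambda>x. (cmod (F n x - g x))\<^sup>2)"
      using key[OF K] by (intro integrableI_nonneg) (auto simp: top_unique less_top[symmetric])
    have "ennreal ((L2_norm M (\<lambda>x. F n x - g x))\<^sup>2) \<le> ennreal (e\<^sup>2)"
      using key[OF K] nn_integral_eq_integral[OF fin] by (simp add: L2_norm_power2)
    then have "(L2_norm M (\<lambda>x. F n x - g x))\<^sup>2 \<le> e\<^sup>2" by (subst (asm) ennreal_le_iff) auto
    moreover have "e \<ge> 0" using K by (meson L2_norm_nonneg le_less_trans less_imp_le)
    ultimately have "L2_norm M (\<lambda>x. F n x - g x) \<le> e" using power2_le_imp_le by blast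
    then show ?thesis using fin by (auto simp: L2_def)
  qed
  obtain K where "\<forall>m\<ge>K. \<forall>n\<ge>K. L2_norm M (\<lambda>x. F m x - F n x) < 1"
    using Cauchy[of 1] by auto
  then have "(\<lambda>x. F K x - g x) \<in> L2 M" using diff[of K 1 K] by blast
  then have g: "g \<in> L2 M" using L2_diff[OF F[of K]] by fastforce
  have "(\<lambda>n. L2_norm M (\<lambda>x. F n x - g x)) \<longlonglongrightarrow> 0"
  proof (rule LIMSEQ_I)
    fix e :: real assume "e > 0"
    then obtain K where "\<forall>m\<ge>K. \<forall>n\<ge>K. L2_norm M (\<lambda>x. F m x - F n x) < e / 2"
      using Cauchy[of "e/2"] by auto
    then show "\<exists>N. \<forall>n\<ge>N. norm (L2_norm M (\<lambda>x. F n x - g x) - 0) < e"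
      using diff[of K "e/2"] \<open>e > 0\<close> by (intro exI[of _ K]) force
  qed
  then show ?thesis using F g by (auto simp: L2_tendsto_def)
qed

lemma L2_norm_tendsto_0I:
  assumes "\<And>n. L2_norm M (F n) \<le> g n" "g \<longlonglongrightarrow> 0"
  shows "(\<lambda>n. L2_norm M (F n)) \<longlonglongrightarrow> 0"
  by (rule Lim_null_comparison[OF _ assms(2)]) (simp add: assms(1))

section \<open>Lattice cubes and characters\<close>

text \<open>
  Lattice cubes and the torsion points of the torus are both boxes with equal sides, so that
  counting and the factorization of sums need to be done only once.
\<close>

definition vec_box :: "'b set \<Rightarrow> ('b ^ 'd::finite) set" where
  "vec_box X = {v. \<forall>i. v $ i \<in> X}"

lemma lattice_cube_eq: "lattice_cube N = vec_box {- int N..int N}"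
  by (simp add: lattice_cube_def vec_box_def)

lemma vec_box_mono: "X \<subseteq> Y \<Longrightarrow> vec_box X \<subseteq> vec_box Y"
  by (auto simp: vec_box_def)

lemma vec_box_bij: "bij_betw vec_lambda (PiE UNIV (\<lambda>i. X)) (vec_box X :: ('b ^ 'd::finite) set)"
  by (rule bij_betwI[where g = vec_nth]) (auto simp: vec_box_def)

text \<open>
  Expanding the product chooses one summand for every coordinate, that is, a point of the box.
\<close>

lemma sum_prod_vec_box:
  fixes f :: "'d::finite \<Rightarrow> 'b \<Rightarrow> 'c::comm_semiring_1"
  assumes "finite X"
  shows "(\<Sum>v\<in>vec_box X. \<Prod>i\<in>UNIV. f i (v $ i)) = (\<Prod>i\<in>UNIV. \<Sum>x\<in>X. f i x)"
  using prod_sum_PiE[of "UNIV :: 'd set" "\<lambda>i. X" f] assms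
    sum.reindex_bij_betw[OF vec_box_bij, of "\<lambda>v. \<Prod>i\<in>UNIV. f i (v $ i)" X]
  by simp

lemma finite_vec_box [simp]: "finite X \<Longrightarrow> finite (vec_box X)"
  using bij_betw_finite[OF vec_box_bij, of X] by (simp add: finite_PiE)

lemma card_vec_box: "card (vec_box X :: ('b ^ 'd::finite) set) = card X ^ CARD('d)"
  using bij_betw_same_card[OF vec_box_bij[where ?'d = 'd], of X] by (simp add: card_PiE)

lemma finite_lattice_cube [simp]: "finite (lattice_cube N)"
  by (simp add: lattice_cube_eq)

lemma card_lattice_cube: "card (lattice_cube N :: (int ^ 'd::finite) set) = (2 * N + 1) ^ CARD('d)"
  by (simp add: lattice_cube_eq card_vec_box nat_add_distrib nat_mult_distrib)

lemma card_lattice_cube_pos [simp]: "card (lattice_cube N :: (int ^ 'd::finite) set) > 0"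
  by (simp add: card_lattice_cube)

lemma lattice_cube_nonempty [simp]: "lattice_cube N \<noteq> {}"
proof -
  have "0 \<in> lattice_cube N" by (simp add: lattice_cube_def)
  then show ?thesis by blast
qed

lemma lattice_cube_mono: "M \<le> N \<Longrightarrow> lattice_cube M \<subseteq> (lattice_cube N :: (int ^ 'd::finite) set)"
  unfolding lattice_cube_eq by (rule vec_box_mono) auto

lemma lattice_cube_translate:
  fixes w :: "int ^ 'd::finite"
  obtains m where "\<And>K. (\<lambda>v. v + w) ` lattice_cube K \<subseteq> lattice_cube (K + m)"
proof
  define m where "m = (\<Sum>i\<in>UNIV. nat \<bar>w $ i\<bar>)"
  have m: "\<bar>w $ i\<bar> \<le> int m" for i
    using member_le_sum[of i UNIV "\<lambda>i. nat \<bar>w $ i\<bar>"] by (simp add: m_def nat_le_iff)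
  have "- int (K + m) \<le> v $ i + w $ i \<and> v $ i + w $ i \<le> int (K + m)"
    if "- int K \<le> v $ i \<and> v $ i \<le> int K" for K and v :: "int ^ 'd" and i
    using m[of i] that by auto
  then show "(\<lambda>v. v + w) ` lattice_cube K \<subseteq> lattice_cube (K + m)" for K
    by (auto simp: lattice_cube_def)
qed

lemma card_lattice_cube_ratio:
  "(\<lambda>K. real (card (lattice_cube (K + m) :: (int ^ 'd::finite) set))
      / real (card (lattice_cube K :: (int ^ 'd) set))) \<longlonglongrightarrow> 1"
proof -
  have "(\<lambda>K. (2 * (real K + real m) + 1) / (2 * real K + 1)) \<longlonglongrightarrow> 1"
    by real_asymp
  from tendsto_power[OF this, of "CARD('d)"] show ?thesis
    by (simp add: card_lattice_cube power_divide add.commute)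
qed

lemma lattice_character_add: "lattice_character \<alpha> (u + v) = lattice_character \<alpha> u * lattice_character \<alpha> v"
  by (simp add: lattice_character_def sum.distrib distrib_left distrib_right exp_add)

lemma lattice_character_zero [simp]: "lattice_character 0 v = 1"
  by (simp add: lattice_character_def)

lemma lattice_character_alt:
  "lattice_character \<alpha> v = cis (2 * pi * (\<Sum>i\<in>UNIV. of_int (v $ i) * \<alpha> $ i))"
  by (simp add: lattice_character_def cis_conv_exp mult_ac)

lemma norm_lattice_character [simp]: "cmod (lattice_character \<alpha> v) = 1"
  by (simp add: lattice_character_alt)

lemma lattice_character_cnj [simp]:
  "cnj (lattice_character \<alpha> v) * lattice_character \<alpha> v = 1"
  "lattice_character \<alpha> v * cnj (lattice_character \<alpha> v) = 1"
  using complex_norm_square[of "lattice_character \<alpha> v"] by (simp_all add: mult.commute)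

section \<open>The mean ergodic theorem with a character\<close>

lemma koopman_lincomb:
  "koopman T v (\<lambda>x. \<Sum>i\<in>I. c i * F i x) = (\<lambda>x. \<Sum>i\<in>I. c i * koopman T v (F i) x)"
  by (simp add: koopman_def)

definition cube_avg ::
  "(int ^ 'd \<Rightarrow> 'a \<Rightarrow> 'a) \<Rightarrow> real ^ 'd \<Rightarrow> nat \<Rightarrow> ('a \<Rightarrow> complex) \<Rightarrow> 'a \<Rightarrow> complex" where
  "cube_avg T \<alpha> N f = (\<lambda>x.
     (\<Sum>v\<in>lattice_cube N. cnj (lattice_character \<alpha> v) * koopman T v f x)
       / of_nat (card (lattice_cube N :: (int ^ 'd) set)))"

text \<open>
  Multiplication by the conjugate character turns \<open>\<alpha>\<close>-eigenfunctions into invariant functions, so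
  that a single mean ergodic theorem yields the projections for all \<open>\<alpha>\<close>.
\<close>

definition twisted_koopman ::
  "(int ^ 'd \<Rightarrow> 'a \<Rightarrow> 'a) \<Rightarrow> real ^ 'd \<Rightarrow> int ^ 'd \<Rightarrow> ('a \<Rightarrow> complex) \<Rightarrow> 'a \<Rightarrow> complex" where
  "twisted_koopman T \<alpha> v f = (\<lambda>x. cnj (lattice_character \<alpha> v) * koopman T v f x)"

lemma cube_avg_twisted: "cube_avg T \<alpha> N f =
  (\<lambda>x. \<Sum>v\<in>lattice_cube N. (1 / of_nat (card (lattice_cube N :: (int ^ 'd) set)))
        * twisted_koopman T \<alpha> v f x)" for T :: "int ^ 'd \<Rightarrow> 'a \<Rightarrow> 'a"
  by (simp add: cube_avg_def twisted_koopman_def sum_divide_distrib)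

lemma cube_avg_lincomb:
  "cube_avg T \<alpha> N (\<lambda>x. \<Sum>i\<in>I. c i * F i x) = (\<lambda>x. \<Sum>i\<in>I. c i * cube_avg T \<alpha> N (F i) x)"
proof
  fix x
  have "cube_avg T \<alpha> N (\<lambda>x. \<Sum>i\<in>I. c i * F i x) x =
    (\<Sum>v\<in>lattice_cube N. \<Sum>i\<in>I. c i * (cnj (lattice_character \<alpha> v) * koopman T v (F i) x))
      / of_nat (card (lattice_cube N :: (int ^ 'b) set))"
    by (simp add: cube_avg_def koopman_lincomb sum_distrib_left mult_ac)
  also have "\<dots> = (\<Sum>i\<in>I. c i * cube_avg T \<alpha> N (F i) x)"
    by (subst sum.swap) (simp add: cube_avg_def sum_distrib_left sum_divide_distrib)
  finally show "cube_avg T \<alpha> N (\<lambda>x. \<Sum>i\<in>I. c i * F i x) x = (\<Sum>i\<in>I. c i * cube_avg T \<alpha> N (F i) x)" .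
qed

context prob_preserving_action
begin

lemma integral_action: "integrable M g \<Longrightarrow> (LINT x|M. g (T v x)) = (LINT x|M. g x)"
  for g :: "'a \<Rightarrow> 'c::{banach, second_countable_topology}"
  using integral_distr[OF action_measurable[of v], of g] by (simp add: action_preserving)

lemma integrable_action: "integrable M g \<Longrightarrow> integrable M (\<lambda>x. g (T v x))"
  for g :: "'a \<Rightarrow> 'c::{banach, second_countable_topology}"
  using integrable_distr[OF action_measurable[of v], of g] by (simp add: action_preserving)

lemma koopman_L2 [intro]: "f \<in> L2 M \<Longrightarrow> koopman T v f \<in> L2 M"
  using integrable_action[of "\<lambda>x. (cmod (f x))\<^sup>2" "- v"] measurable_compose[OF action_measurable[of "-v"]]
  by (auto simp: L2_def koopman_def)

lemma koopman_inner:
  assumes "f \<in> L2 M" "g \<in> L2 M"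
  shows "L2_inner M (koopman T v f) (koopman T v g) = L2_inner M f g"
  using integral_action[OF L2_inner_integrable[OF assms], of "- v"]
  by (simp add: L2_inner_def koopman_def)

lemma koopman_norm: "f \<in> L2 M \<Longrightarrow> L2_norm M (koopman T v f) = L2_norm M f"
  using integral_action[OF L2_square_integrable, of f "- v"]
  by (simp add: L2_norm_def koopman_def)

lemma koopman_koopman:
  assumes "x \<in> space M"
  shows "koopman T u (koopman T v f) x = koopman T (u + v) f x"
  using action_add[OF assms, of "- v" "- u"] by (simp add: koopman_def add.commute)

lemma koopman_sum_norm_le:
  assumes "f \<in> L2 M"
  shows "L2_norm M (\<lambda>x. \<Sum>v\<in>A. c v * koopman T v f x) \<le> (\<Sum>v\<in>A. cmod (c v)) * L2_norm M f"
proof -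
  have "L2_norm M (\<lambda>x. \<Sum>v\<in>A. c v * koopman T v f x) \<le> (\<Sum>v\<in>A. L2_norm M (\<lambda>x. c v * koopman T v f x))"
    by (intro L2_norm_sum_le L2_cmult koopman_L2 assms)
  also have "\<dots> = (\<Sum>v\<in>A. cmod (c v)) * L2_norm M f"
    by (simp add: L2_norm_cmult koopman_norm assms sum_distrib_right)
  finally show ?thesis .
qed

lemma twisted_koopman_L2 [intro]: "f \<in> L2 M \<Longrightarrow> twisted_koopman T \<alpha> v f \<in> L2 M"
  unfolding twisted_koopman_def by (intro L2_cmult koopman_L2)

lemma twisted_koopman_norm: "f \<in> L2 M \<Longrightarrow> L2_norm M (twisted_koopman T \<alpha> v f) = L2_norm M f"
  unfolding twisted_koopman_def by (simp add: L2_norm_cmult koopman_norm)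

lemma twisted_koopman_twisted_koopman:
  assumes "x \<in> space M"
  shows "twisted_koopman T \<alpha> u (twisted_koopman T \<alpha> v f) x = twisted_koopman T \<alpha> (u + v) f x"
  using koopman_koopman[OF assms, of u v f]
  by (simp add: twisted_koopman_def lattice_character_add koopman_def)

lemma twisted_koopman_sum_norm_le:
  assumes "f \<in> L2 M"
  shows "L2_norm M (\<lambda>x. \<Sum>v\<in>A. c v * twisted_koopman T \<alpha> v f x) \<le> (\<Sum>v\<in>A. cmod (c v)) * L2_norm M f"
  using koopman_sum_norm_le[OF assms, where A = A and c = "\<lambda>v. c v * cnj (lattice_character \<alpha> v)"]
  by (simp add: twisted_koopman_def norm_mult mult.assoc)

lemma cube_avg_L2 [intro]: "f \<in> L2 M \<Longrightarrow> cube_avg T \<alpha> N f \<in> L2 M"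
  unfolding cube_avg_twisted by (intro L2_lincomb twisted_koopman_L2)

lemma cube_avg_norm_le:
  assumes "f \<in> L2 M" shows "L2_norm M (cube_avg T \<alpha> N f) \<le> L2_norm M f"
  using twisted_koopman_sum_norm_le[OF assms, where A = "lattice_cube N" and \<alpha> = \<alpha>
      and c = "\<lambda>v. 1 / of_nat (card (lattice_cube N :: (int ^ 'd) set))"]
    card_lattice_cube_pos[of N, where ?'d = 'd]
  unfolding cube_avg_twisted by (simp add: norm_divide)

text \<open>
  Cubes form a Folner sequence: a cube and its translate by \<open>w\<close> differ only in a boundary layer.
\<close>

lemma cube_avg_asymptotically_invariant:
  assumes f: "f \<in> L2 M"
  shows "(\<lambda>K. L2_norm M (\<lambda>x. cube_avg T \<alpha> K (twisted_koopman T \<alpha> w f) x - cube_avg T \<alpha> K f x)) \<longlonglongrightarrow> 0"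
proof -
  obtain m where m: "\<And>K. (\<lambda>v. v + w) ` lattice_cube K \<subseteq> lattice_cube (K + m)"
    using lattice_cube_translate by blast
  let ?q = "\<lambda>K. real (card (lattice_cube K :: (int ^ 'd) set))"
  let ?B = "\<lambda>K. 2 * (?q (K + m) / ?q K - 1) * L2_norm M f"
  have "L2_norm M (\<lambda>x. cube_avg T \<alpha> K (twisted_koopman T \<alpha> w f) x - cube_avg T \<alpha> K f x) \<le> ?B K" for K
  proof -
    define Y where "Y = (lattice_cube K :: (int ^ 'd) set)"
    define X where "X = (\<lambda>v. v + w) ` Y"
    \<comment> \<open>The weight with which a translate occurs in the difference of the two averages;
      translates by vectors in both \<open>X\<close> and \<open>Y\<close> cancel.\<close>
    define c :: "int ^ 'd \<Rightarrow> complex" where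
      "c v = (if v \<in> X then 1 / of_real (?q K) else - 1 / of_real (?q K))" for v
    have fin: "finite X" "finite Y" and inj: "inj_on (\<lambda>v. v + w) Y"
      by (auto simp: X_def Y_def)
    have cardX: "card X = card Y" unfolding X_def by (rule card_image[OF inj])
    have "card (X - Y) \<le> card (lattice_cube (K + m) - Y)"
      using m[of K] by (intro card_mono) (auto simp: X_def Y_def)
    also have "real \<dots> = ?q (K + m) - ?q K"
    proof -
      have "Y \<subseteq> lattice_cube (K + m)" unfolding Y_def by (rule lattice_cube_mono) simp
      then show ?thesis
        using card_mono[of "lattice_cube (K + m)" Y] by (simp add: card_Diff_subset Y_def of_nat_diff)
    qed
    finally have le: "real (card (X - Y)) \<le> ?q (K + m) - ?q K" by simp
    have eq: "card (Y - X) = card (X - Y)"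
      using cardX fin by (metis card_Diff_subset_Int finite_Int inf_commute)
    have pt: "cube_avg T \<alpha> K (twisted_koopman T \<alpha> w f) x - cube_avg T \<alpha> K f x
        = (\<Sum>v\<in>(X - Y) \<union> (Y - X). c v * twisted_koopman T \<alpha> v f x)" if x: "x \<in> space M" for x
    proof -
      let ?g = "\<lambda>v. (1 / of_nat (card Y)) * twisted_koopman T \<alpha> v f x"
      have "cube_avg T \<alpha> K (twisted_koopman T \<alpha> w f) x = (\<Sum>v\<in>Y. ?g (v + w))"
        by (simp add: cube_avg_twisted twisted_koopman_twisted_koopman[OF x] Y_def)
      also have "\<dots> = sum ?g X" unfolding X_def by (simp add: sum.reindex inj)
      finally have "cube_avg T \<alpha> K (twisted_koopman T \<alpha> w f) x - cube_avg T \<alpha> K f x = sum ?g X - sum ?g Y"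
        by (simp add: cube_avg_twisted Y_def)
      also have "\<dots> = sum ?g (X - Y) - sum ?g (Y - X)"
        using sum.Int_Diff[OF fin(1), of ?g Y] sum.Int_Diff[OF fin(2), of ?g X]
        by (simp add: Int_commute)
      also have "\<dots> = (\<Sum>v\<in>X - Y. c v * twisted_koopman T \<alpha> v f x) + (\<Sum>v\<in>Y - X. c v * twisted_koopman T \<alpha> v f x)"
        unfolding sum_negf[symmetric] diff_conv_add_uminus
        by (intro arg_cong2[of _ _ _ _ "(+)"] sum.cong refl) (auto simp: c_def Y_def)
      also have "\<dots> = (\<Sum>v\<in>(X - Y) \<union> (Y - X). c v * twisted_koopman T \<alpha> v f x)"
        using fin by (intro sum.union_disjoint[symmetric]) auto
      finally show ?thesis .
    qed
    have "L2_norm M (\<lambda>x. cube_avg T \<alpha> K (twisted_koopman T \<alpha> w f) x - cube_avg T \<alpha> K f x)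
        = L2_norm M (\<lambda>x. \<Sum>v\<in>(X - Y) \<union> (Y - X). c v * twisted_koopman T \<alpha> v f x)"
      by (rule L2_norm_cong[OF pt])
    also have "\<dots> \<le> (\<Sum>v\<in>(X - Y) \<union> (Y - X). cmod (c v)) * L2_norm M f"
      by (rule twisted_koopman_sum_norm_le[OF f])
    also have "(\<Sum>v\<in>(X - Y) \<union> (Y - X). cmod (c v)) = (\<Sum>v\<in>(X - Y) \<union> (Y - X). 1 / ?q K)"
      by (intro sum.cong refl) (auto simp: c_def norm_divide)
    also have "\<dots> = 2 * real (card (X - Y)) / ?q K"
      using fin eq by (subst sum_constant, subst card_Un_disjoint) auto
    also have "\<dots> \<le> 2 * (?q (K + m) - ?q K) / ?q K"
      using le by (intro divide_right_mono mult_left_mono) auto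
    also have "\<dots> = 2 * (?q (K + m) / ?q K - 1)"
      using card_lattice_cube_pos[of K, where ?'d = 'd] by (simp add: diff_divide_distrib)
    finally show ?thesis by (simp add: mult_right_mono)
  qed
  moreover have "?B \<longlonglongrightarrow> 0"
  proof -
    have "?B \<longlonglongrightarrow> 2 * (1 - 1) * L2_norm M f"
      by (intro tendsto_intros card_lattice_cube_ratio)
    then show ?thesis by simp
  qed
  ultimately show ?thesis by (rule L2_norm_tendsto_0I)
qed

text \<open>
  The inner average is a convex combination of translates of \<open>f\<close>, and the outer average
  asymptotically does not see these translations.
\<close>

lemma cube_avg_cube_avg:
  assumes f: "f \<in> L2 M"
  shows "(\<lambda>K. L2_norm M (\<lambda>x. cube_avg T \<alpha> K (cube_avg T \<alpha> N f) x - cube_avg T \<alpha> K f x)) \<longlonglongrightarrow> 0"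
proof -
  define c :: complex where "c = 1 / of_nat (card (lattice_cube N :: (int ^ 'd) set))"
  let ?D = "\<lambda>K w. L2_norm M (\<lambda>x. cube_avg T \<alpha> K (twisted_koopman T \<alpha> w f) x - cube_avg T \<alpha> K f x)"
  have c: "(\<Sum>w\<in>(lattice_cube N :: (int ^ 'd) set). c) = 1"
    using card_lattice_cube_pos[of N, where ?'d = 'd] by (simp add: c_def)
  have "L2_norm M (\<lambda>x. cube_avg T \<alpha> K (cube_avg T \<alpha> N f) x - cube_avg T \<alpha> K f x)
      \<le> (\<Sum>w\<in>lattice_cube N. cmod c * ?D K w)" for K
  proof -
    have "cube_avg T \<alpha> K (cube_avg T \<alpha> N f) x - cube_avg T \<alpha> K f x
      = (\<Sum>w\<in>lattice_cube N. c * (cube_avg T \<alpha> K (twisted_koopman T \<alpha> w f) x - cube_avg T \<alpha> K f x))" for x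
      unfolding cube_avg_twisted[of T \<alpha> N f] cube_avg_lincomb c_def[symmetric]
      using c by (simp only: right_diff_distrib sum_subtractf sum_distrib_right[symmetric]) simp
    then have "L2_norm M (\<lambda>x. cube_avg T \<alpha> K (cube_avg T \<alpha> N f) x - cube_avg T \<alpha> K f x)
      = L2_norm M (\<lambda>x. \<Sum>w\<in>lattice_cube N. c * (cube_avg T \<alpha> K (twisted_koopman T \<alpha> w f) x - cube_avg T \<alpha> K f x))"
      by simp
    also have "\<dots> \<le> (\<Sum>w\<in>lattice_cube N. L2_norm M (\<lambda>x. c * (cube_avg T \<alpha> K (twisted_koopman T \<alpha> w f) x - cube_avg T \<alpha> K f x)))"
      by (intro L2_norm_sum_le L2_cmult L2_diff cube_avg_L2 twisted_koopman_L2 f)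
    finally show ?thesis by (simp add: L2_norm_cmult)
  qed
  moreover have "(\<lambda>K. \<Sum>w\<in>lattice_cube N. cmod c * ?D K w) \<longlonglongrightarrow> 0"
    by (intro tendsto_null_sum tendsto_mult_right_zero cube_avg_asymptotically_invariant f)
  ultimately show ?thesis by (rule L2_norm_tendsto_0I)
qed

text \<open>
  Let \<open>\<delta>\<close> be the infimum of the norms of the averages. Averaging contracts norms, and the averages
  over large cubes hardly change if \<open>f\<close> is first replaced by a fixed average or by the midpoint of two
  of them. Hence the norms of the averages tend to \<open>\<delta>\<close>, and every such midpoint has norm at least \<open>\<delta>\<close>.
  By the parallelogram law the averages form a Cauchy sequence. Their limit provides the orthogonal
  projection of \<open>f\<close> onto the eigenspace.
\<close>

theorem mean_ergodic:
  assumes f: "f \<in> L2 M"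
  shows "\<exists>g. L2_tendsto M (\<lambda>N. cube_avg T \<alpha> N f) g"
proof (rule L2_complete)
  show "cube_avg T \<alpha> N f \<in> L2 M" for N using f by (rule cube_avg_L2)
  note B = this
  define a where "a N = L2_norm M (cube_avg T \<alpha> N f)" for N
  define \<delta> where "\<delta> = (INF N. a N)"
  have bdd: "bdd_below (range a)" by (intro bdd_belowI[of _ 0]) (auto simp: a_def)
  have \<delta>_le: "\<delta> \<le> a N" for N unfolding \<delta>_def by (rule cINF_lower[OF bdd]) simp
  have \<delta>_nonneg: "0 \<le> \<delta>" unfolding \<delta>_def by (rule cINF_greatest) (auto simp: a_def)
  have a_le: "a K \<le> L2_norm M h + L2_norm M (\<lambda>x. cube_avg T \<alpha> K h x - cube_avg T \<alpha> K f x)"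
    if h: "h \<in> L2 M" for h K
    using L2_norm_le_diff[OF B cube_avg_L2[OF h], of K \<alpha> K] cube_avg_norm_le[OF h, of \<alpha> K]
      L2_norm_minus_commute[of M "cube_avg T \<alpha> K h" "cube_avg T \<alpha> K f"]
    by (simp add: a_def)
  have a_lim: "a \<longlonglongrightarrow> \<delta>"
  proof (rule LIMSEQ_I)
    fix e :: real assume e: "e > 0"
    obtain N where N: "a N < \<delta> + e / 2"
      using cINF_less_iff[OF _ bdd, of "\<delta> + e / 2"] e unfolding \<delta>_def[symmetric] by auto
    obtain K0 where K0: "\<And>K. K \<ge> K0 \<Longrightarrow>
        L2_norm M (\<lambda>x. cube_avg T \<alpha> K (cube_avg T \<alpha> N f) x - cube_avg T \<alpha> K f x) < e / 2"
      using LIMSEQ_D[OF cube_avg_cube_avg[OF f, of \<alpha> N], of "e / 2"] e by auto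
    have "a K < \<delta> + e" if "K \<ge> K0" for K
      using a_le[OF B[of N], of K] K0[OF that] N by (simp add: a_def)
    then have "norm (a K - \<delta>) < e" if "K \<ge> K0" for K
      using that \<delta>_le[of K] by fastforce
    then show "\<exists>K0. \<forall>K\<ge>K0. norm (a K - \<delta>) < e" by blast
  qed
  have mid: "2 * \<delta> \<le> L2_norm M (\<lambda>x. cube_avg T \<alpha> N f x + cube_avg T \<alpha> N' f x)" for N N'
  proof -
    define h where "h = (\<lambda>x. 1/2 * (cube_avg T \<alpha> N f x + cube_avg T \<alpha> N' f x))"
    have h: "h \<in> L2 M" unfolding h_def by (intro L2_cmult L2_add B)
    let ?D = "\<lambda>N K. L2_norm M (\<lambda>x. cube_avg T \<alpha> K (cube_avg T \<alpha> N f) x - cube_avg T \<alpha> K f x)"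
    have "L2_norm M (\<lambda>x. cube_avg T \<alpha> K h x - cube_avg T \<alpha> K f x) \<le> 1/2 * (?D N K + ?D N' K)" for K
    proof -
      have "cube_avg T \<alpha> K h x - cube_avg T \<alpha> K f x =
        1/2 * ((cube_avg T \<alpha> K (cube_avg T \<alpha> N f) x - cube_avg T \<alpha> K f x)
          + (cube_avg T \<alpha> K (cube_avg T \<alpha> N' f) x - cube_avg T \<alpha> K f x))" for x
        unfolding h_def
        using cube_avg_lincomb[of T \<alpha> K "\<lambda>_. 1/2" "\<lambda>b. if b then cube_avg T \<alpha> N f else cube_avg T \<alpha> N' f" UNIV]
        by (simp add: UNIV_bool algebra_simps fun_eq_iff)
      then have "L2_norm M (\<lambda>x. cube_avg T \<alpha> K h x - cube_avg T \<alpha> K f x) = 1/2 *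
          L2_norm M (\<lambda>x. (cube_avg T \<alpha> K (cube_avg T \<alpha> N f) x - cube_avg T \<alpha> K f x)
          + (cube_avg T \<alpha> K (cube_avg T \<alpha> N' f) x - cube_avg T \<alpha> K f x))"
        by (simp only: L2_norm_cmult) simp
      also have "\<dots> \<le> 1/2 * (?D N K + ?D N' K)"
        by (intro mult_left_mono L2_norm_triangle L2_diff cube_avg_L2 B f) auto
      finally show ?thesis .
    qed
    then have "\<delta> \<le> L2_norm M h + 1/2 * (?D N K + ?D N' K)" for K
      by (rule order_trans[OF order_trans[OF \<delta>_le a_le[OF h]] add_left_mono])
    moreover have "(\<lambda>K. L2_norm M h + 1/2 * (?D N K + ?D N' K)) \<longlonglongrightarrow> L2_norm M h + 1/2 * (0 + 0)"
      by (intro tendsto_intros cube_avg_cube_avg f)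
    ultimately have "\<delta> \<le> L2_norm M h + 1/2 * (0 + 0)" by (intro LIMSEQ_le_const) auto
    then show ?thesis unfolding h_def L2_norm_cmult by simp
  qed
  fix e :: real assume e: "e > 0"
  have "(\<lambda>N. (a N)\<^sup>2) \<longlonglongrightarrow> \<delta>\<^sup>2" by (intro tendsto_intros a_lim)
  then obtain K where K: "\<And>N. N \<ge> K \<Longrightarrow> \<bar>(a N)\<^sup>2 - \<delta>\<^sup>2\<bar> < e\<^sup>2 / 4"
    using LIMSEQ_D[of "\<lambda>N. (a N)\<^sup>2" "\<delta>\<^sup>2" "e\<^sup>2 / 4"] e by auto
  have "L2_norm M (\<lambda>x. cube_avg T \<alpha> N f x - cube_avg T \<alpha> N' f x) < e" if N: "N \<ge> K" "N' \<ge> K" for N N'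
  proof (rule power2_less_imp_less)
    have "(2 * \<delta>)\<^sup>2 \<le> (L2_norm M (\<lambda>x. cube_avg T \<alpha> N f x + cube_avg T \<alpha> N' f x))\<^sup>2"
      using mid \<delta>_nonneg by (intro power_mono) auto
    then show "(L2_norm M (\<lambda>x. cube_avg T \<alpha> N f x - cube_avg T \<alpha> N' f x))\<^sup>2 < e\<^sup>2"
      using L2_parallelogram[OF B[of N] B[of N']] abs_ge_self[THEN le_less_trans, OF K[OF N(1)]]
        abs_ge_self[THEN le_less_trans, OF K[OF N(2)]]
      unfolding a_def power_mult_distrib by simp
  qed (use e in simp)
  then show "\<exists>K. \<forall>N\<ge>K. \<forall>N'\<ge>K. L2_norm M (\<lambda>x. cube_avg T \<alpha> N f x - cube_avg T \<alpha> N' f x) < e"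
    by blast
qed

end

section \<open>Projections onto eigenspaces\<close>

text \<open>Unlike \<open>eigenfunctions\<close>, this set contains the functions that vanish almost everywhere.\<close>

definition eigenspace ::
  "'a measure \<Rightarrow> (int ^ 'd \<Rightarrow> 'a \<Rightarrow> 'a) \<Rightarrow> real ^ 'd \<Rightarrow> ('a \<Rightarrow> complex) set" where
  "eigenspace M T \<alpha> =
     {f \<in> L2 M. \<forall>v. AE x in M. koopman T v f x = lattice_character \<alpha> v * f x}"

text \<open>
  The limit is determined only up to almost everywhere equality.
\<close>

definition eigen_part ::
  "'a measure \<Rightarrow> (int ^ 'd \<Rightarrow> 'a \<Rightarrow> 'a) \<Rightarrow> real ^ 'd \<Rightarrow> ('a \<Rightarrow> complex) \<Rightarrow> 'a \<Rightarrow> complex" where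
  "eigen_part M T \<alpha> f = (SOME g. L2_tendsto M (\<lambda>N. cube_avg T \<alpha> N f) g)"

lemma eigenspace_L2: "h \<in> eigenspace M T \<alpha> \<Longrightarrow> h \<in> L2 M"
  by (simp add: eigenspace_def)

lemma eigenfunctions_subset_eigenspace: "eigenfunctions M T \<alpha> \<subseteq> eigenspace M T \<alpha>"
  by (auto simp: eigenspace_def eigenfunctions_def)

lemma invariant_functions_eq: "invariant_functions M T = eigenspace M T 0"
  by (simp add: eigenspace_def invariant_functions_def)

lemma twisted_koopman_lincomb:
  "twisted_koopman T \<alpha> v (\<lambda>x. \<Sum>i\<in>I. c i * F i x) = (\<lambda>x. \<Sum>i\<in>I. c i * twisted_koopman T \<alpha> v (F i) x)"
  by (simp add: twisted_koopman_def koopman_lincomb sum_distrib_left mult_ac)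

context prob_preserving_action
begin

lemma twisted_koopman_inner:
  assumes "f \<in> L2 M" "g \<in> L2 M"
  shows "L2_inner M (twisted_koopman T \<alpha> v f) (twisted_koopman T \<alpha> v g) = L2_inner M f g"
proof -
  have "L2_inner M (twisted_koopman T \<alpha> v f) (twisted_koopman T \<alpha> v g)
      = (cnj (lattice_character \<alpha> v) * lattice_character \<alpha> v) * L2_inner M (koopman T v f) (koopman T v g)"
    unfolding twisted_koopman_def L2_inner_cmult_left L2_inner_cmult_right by simp
  then show ?thesis by (simp add: koopman_inner assms)
qed

lemma eigenspace_iff_twisted:
  "h \<in> eigenspace M T \<alpha> \<longleftrightarrow> h \<in> L2 M \<and> (\<forall>v. AE x in M. twisted_koopman T \<alpha> v h x = h x)"
proof -
  have "koopman T v h x = lattice_character \<alpha> v * h x \<longleftrightarrow> twisted_koopman T \<alpha> v h x = h x" for v x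
    unfolding twisted_koopman_def
    using lattice_character_cnj[of \<alpha> v] by (metis mult.assoc mult_1)
  then show ?thesis by (simp add: eigenspace_def)
qed

lemma eigen_part_tendsto:
  "f \<in> L2 M \<Longrightarrow> L2_tendsto M (\<lambda>N. cube_avg T \<alpha> N f) (eigen_part M T \<alpha> f)"
  unfolding eigen_part_def by (rule someI_ex[OF mean_ergodic])

lemma eigen_part_L2 [intro]: "f \<in> L2 M \<Longrightarrow> eigen_part M T \<alpha> f \<in> L2 M"
  using eigen_part_tendsto L2_tendstoD(2) by blast

text \<open>
  The twisted translates of the averages approach the averages themselves, so their limit is
  invariant under the twisted action.
\<close>

lemma eigen_part_in_eigenspace:
  assumes f: "f \<in> L2 M"
  shows "eigen_part M T \<alpha> f \<in> eigenspace M T \<alpha>"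
  unfolding eigenspace_iff_twisted
proof (intro conjI allI)
  define E where "E = eigen_part M T \<alpha> f"
  show E: "eigen_part M T \<alpha> f \<in> L2 M" using f by (rule eigen_part_L2)
  fix w
  let ?V = "twisted_koopman T \<alpha> w" and ?B = "\<lambda>N. cube_avg T \<alpha> N f"
  note E = E[folded E_def]
  have "L2_norm M (\<lambda>x. ?V E x - E x) \<le> 2 * L2_norm M (\<lambda>x. ?B N x - E x)
      + L2_norm M (\<lambda>x. cube_avg T \<alpha> N (?V f) x - ?B N x)" for N
  proof -
    have "L2_norm M (\<lambda>x. ?V E x - cube_avg T \<alpha> N (?V f) x) = L2_norm M (?V (\<lambda>x. E x - ?B N x))"
    proof (rule L2_norm_cong)
      fix x assume x: "x \<in> space M"
      have "?V (?B N) x = cube_avg T \<alpha> N (?V f) x"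
        by (simp only: cube_avg_twisted twisted_koopman_lincomb
            twisted_koopman_twisted_koopman[OF x] add.commute[of w])
      then show "?V E x - cube_avg T \<alpha> N (?V f) x = ?V (\<lambda>x. E x - ?B N x) x"
        by (simp add: twisted_koopman_def koopman_def right_diff_distrib)
    qed
    also have "\<dots> = L2_norm M (\<lambda>x. ?B N x - E x)"
      using E f by (subst twisted_koopman_norm) (auto simp: L2_norm_minus_commute)
    finally have 1: "L2_norm M (\<lambda>x. ?V E x - cube_avg T \<alpha> N (?V f) x) = L2_norm M (\<lambda>x. ?B N x - E x)" .
    have "L2_norm M (\<lambda>x. ?V E x - E x) \<le> L2_norm M (\<lambda>x. ?V E x - ?B N x) + L2_norm M (\<lambda>x. ?B N x - E x)"
      by (intro L2_norm_triangle_diff twisted_koopman_L2 cube_avg_L2 E f)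
    also have "L2_norm M (\<lambda>x. ?V E x - ?B N x) \<le> L2_norm M (\<lambda>x. ?V E x - cube_avg T \<alpha> N (?V f) x)
        + L2_norm M (\<lambda>x. cube_avg T \<alpha> N (?V f) x - ?B N x)"
      by (intro L2_norm_triangle_diff twisted_koopman_L2 cube_avg_L2 E f)
    finally show ?thesis using 1 by simp
  qed
  moreover have "(\<lambda>N. 2 * L2_norm M (\<lambda>x. ?B N x - E x)
      + L2_norm M (\<lambda>x. cube_avg T \<alpha> N (?V f) x - ?B N x)) \<longlonglongrightarrow> 2 * 0 + 0"
    using L2_tendstoD(3)[OF eigen_part_tendsto[OF f]] unfolding E_def
    by (intro tendsto_intros cube_avg_asymptotically_invariant f)
  ultimately have "L2_norm M (\<lambda>x. ?V E x - E x) \<le> 2 * 0 + 0"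
    by (intro LIMSEQ_le_const) auto
  then have "L2_norm M (\<lambda>x. ?V E x - E x) = 0" by (simp add: order_antisym)
  then have "AE x in M. ?V E x - E x = 0"
    using L2_norm_eq_0_iff[OF L2_diff[OF twisted_koopman_L2[OF E] E]] by simp
  then show "AE x in M. twisted_koopman T \<alpha> w (eigen_part M T \<alpha> f) x = eigen_part M T \<alpha> f x"
    by (simp add: E_def)
qed

text \<open>
  Twisted translations of \<open>f\<close> do not change its inner product with an eigenfunction, so neither does
  averaging. Together with the previous lemma this identifies \<open>eigen_part\<close> as the orthogonal projection
  onto the eigenspace.
\<close>

lemma eigen_part_inner:
  assumes f: "f \<in> L2 M" and h: "h \<in> eigenspace M T \<alpha>"
  shows "L2_inner M (eigen_part M T \<alpha> f) h = L2_inner M f h"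
proof -
  have hL2: "h \<in> L2 M" using h by (rule eigenspace_L2)
  have V: "L2_inner M (twisted_koopman T \<alpha> v f) h = L2_inner M f h" for v
  proof -
    have "AE x in M. h x = twisted_koopman T \<alpha> v h x"
      using h unfolding eigenspace_iff_twisted by (auto simp: eq_commute)
    then have "L2_inner M (twisted_koopman T \<alpha> v f) h
        = L2_inner M (twisted_koopman T \<alpha> v f) (twisted_koopman T \<alpha> v h)"
      by (intro L2_inner_cong_AE twisted_koopman_L2 f hL2) auto
    then show ?thesis by (simp add: twisted_koopman_inner f hL2)
  qed
  have "L2_inner M (cube_avg T \<alpha> N f) h = L2_inner M f h" for N
  proof -
    let ?c = "1 / of_nat (card (lattice_cube N :: (int ^ 'd) set)) :: complex"
    have "L2_inner M (cube_avg T \<alpha> N f) h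
        = (\<Sum>v\<in>lattice_cube N. L2_inner M (\<lambda>x. ?c * twisted_koopman T \<alpha> v f x) h)"
      unfolding cube_avg_twisted by (intro L2_inner_sum_left L2_cmult twisted_koopman_L2 f hL2)
    then show ?thesis by (simp only: L2_inner_cmult_left V) simp
  qed
  then show ?thesis
    using L2_tendsto_inner[OF eigen_part_tendsto[OF f] hL2, of \<alpha>] by (simp add: LIMSEQ_const_iff)
qed

text \<open>
  Translation by \<open>v\<close> preserves the inner product but multiplies it by a quotient of two distinct
  character values.
\<close>

lemma eigenspace_orthogonal:
  assumes g: "g \<in> eigenspace M T \<alpha>" and h: "h \<in> eigenspace M T \<beta>"
    and ne: "lattice_character \<alpha> v \<noteq> lattice_character \<beta> v"
  shows "L2_inner M g h = 0"
proof -
  have L2: "g \<in> L2 M" "h \<in> L2 M" using g h by (auto dest: eigenspace_L2)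
  have "L2_inner M g h = L2_inner M (koopman T v g) (koopman T v h)"
    by (simp add: koopman_inner L2)
  also have "\<dots> = L2_inner M (\<lambda>x. lattice_character \<alpha> v * g x) (\<lambda>x. lattice_character \<beta> v * h x)"
    using g h by (intro L2_inner_cong_AE koopman_L2 L2_cmult L2) (auto simp: eigenspace_def)
  also have "\<dots> = lattice_character \<alpha> v * cnj (lattice_character \<beta> v) * L2_inner M g h"
    by (simp add: L2_inner_cmult_left L2_inner_cmult_right)
  finally have "L2_inner M g h = lattice_character \<alpha> v * cnj (lattice_character \<beta> v) * L2_inner M g h" .
  moreover have "lattice_character \<alpha> v * cnj (lattice_character \<beta> v) \<noteq> 1"
    using ne lattice_character_cnj(1)[of \<beta> v] by (metis mult.assoc mult_1 mult.right_neutral)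
  ultimately show ?thesis by auto
qed

end

section \<open>Torsion points of the torus\<close>

lemma cis_2pi_eq_1_iff: "cis (2 * pi * x) = 1 \<longleftrightarrow> x \<in> \<int>"
proof
  assume "cis (2 * pi * x) = 1"
  then have "exp (\<i> * complex_of_real (2 * pi * x)) = 1" by (simp add: cis_conv_exp)
  then obtain n :: int where "2 * pi * x = of_int (2 * n) * pi" unfolding exp_eq_1 by auto
  then have "x = of_int n" by simp
  then show "x \<in> \<int>" by simp
qed (auto simp: cis_multiple_2pi)

lemma lattice_character_axis: "lattice_character \<alpha> (axis i 1) = cis (2 * pi * \<alpha> $ i)"
proof -
  have "(\<Sum>j\<in>UNIV. of_int (axis i 1 $ j) * \<alpha> $ j) = (\<Sum>j\<in>UNIV. if j = i then \<alpha> $ j else 0)"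
    by (intro sum.cong) (auto simp: axis_def)
  then show ?thesis by (simp add: lattice_character_alt)
qed

lemma lattice_character_cong:
  assumes "\<And>i. \<alpha> $ i - \<beta> $ i \<in> \<int>"
  shows "lattice_character \<alpha> v = lattice_character \<beta> v"
proof -
  let ?s = "\<lambda>\<gamma>. \<Sum>i\<in>UNIV. of_int (v $ i) * \<gamma> $ i :: real"
  have "?s \<alpha> - ?s \<beta> = (\<Sum>i\<in>UNIV. of_int (v $ i) * (\<alpha> $ i - \<beta> $ i))"
    by (simp add: sum_subtractf right_diff_distrib)
  also have "\<dots> \<in> \<int>" using assms by (intro Ints_sum Ints_mult) auto
  finally have "cis (2 * pi * (?s \<alpha> - ?s \<beta>)) = 1" by (simp add: cis_2pi_eq_1_iff)
  then have "cis (2 * pi * ?s \<alpha>) = cis (2 * pi * ?s \<beta>)"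
    by (simp add: right_diff_distrib cis_divide[symmetric])
  then show ?thesis by (simp add: lattice_character_alt)
qed

lemma lattice_character_distinct:
  assumes "\<alpha> \<in> vec_box {0..<1}" "\<beta> \<in> vec_box {0..<1}" "\<alpha> \<noteq> \<beta>"
  shows "\<exists>v. lattice_character \<alpha> v \<noteq> lattice_character \<beta> v"
proof -
  obtain i where i: "\<alpha> $ i \<noteq> \<beta> $ i" using assms(3) by (auto simp: vec_eq_iff)
  have "\<alpha> $ i - \<beta> $ i \<notin> \<int>"
  proof
    assume "\<alpha> $ i - \<beta> $ i \<in> \<int>"
    then obtain n :: int where n: "\<alpha> $ i - \<beta> $ i = of_int n" by (auto elim: Ints_cases)
    have "0 \<le> \<alpha> $ i \<and> \<alpha> $ i < 1 \<and> 0 \<le> \<beta> $ i \<and> \<beta> $ i < 1"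
      using assms(1,2) by (auto simp: vec_box_def)
    then have "\<bar>of_int n :: real\<bar> < 1" unfolding n[symmetric] by linarith
    then have "n = 0" by linarith
    then show False using n i by simp
  qed
  then have "cis (2 * pi * (\<alpha> $ i - \<beta> $ i)) \<noteq> 1" by (simp add: cis_2pi_eq_1_iff)
  then have "cis (2 * pi * \<alpha> $ i) \<noteq> cis (2 * pi * \<beta> $ i)"
    by (simp add: right_diff_distrib cis_divide[symmetric])
  then show ?thesis by (metis lattice_character_axis)
qed

text \<open>
  Each point of order \<open>q\<close> of the torus is listed once, by its representative in the unit cube.
\<close>

definition torus_points_of_order :: "nat \<Rightarrow> (real ^ 'd::finite) set" where
  "torus_points_of_order q = {\<alpha> \<in> vec_box {0..<1}. torus_ord \<alpha> = enat q}"

text \<open>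
  The \<open>k\<close>-torsion points of the circle.
\<close>

definition unit_fractions :: "nat \<Rightarrow> real set" where
  "unit_fractions k = {x. 0 \<le> x \<and> x < 1 \<and> of_nat k * x \<in> \<int>}"

lemma unit_fractions_eq:
  assumes "k > 0"
  shows "unit_fractions k = (\<lambda>a. of_nat a / of_nat k) ` {..<k}"
proof (intro equalityI subsetI)
  fix x assume x: "x \<in> unit_fractions k"
  then have "real k * x \<in> \<int>" "0 \<le> x" "x < 1" by (auto simp: unit_fractions_def)
  then obtain n :: int where n: "real k * x = of_int n" by (auto elim: Ints_cases)
  have "0 \<le> real k * x" "real k * x < real k" using assms \<open>0 \<le> x\<close> \<open>x < 1\<close> by auto
  then have "0 \<le> n" "n < int k" unfolding n by linarith+
  then have "nat n < k" "x = of_nat (nat n) / of_nat k" using n assms by (auto simp: field_simps)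
  then show "x \<in> (\<lambda>a. of_nat a / of_nat k) ` {..<k}" by blast
qed (use assms in \<open>auto simp: unit_fractions_def\<close>)

lemma finite_unit_fractions: "k > 0 \<Longrightarrow> finite (unit_fractions k)"
  by (simp add: unit_fractions_eq)

lemma torus_ord_pos: "torus_ord \<alpha> = enat q \<Longrightarrow> q > 0"
proof -
  assume q: "torus_ord \<alpha> = enat q"
  let ?P = "\<lambda>n. n > 0 \<and> (\<forall>i. of_nat n * \<alpha> $ i \<in> \<int>)"
  have "Ex ?P" "q = (LEAST n. ?P n)" using q by (auto simp: torus_ord_def split: if_splits)
  then show ?thesis using LeastI_ex[of ?P] by simp
qed

text \<open>
  The order is the least period, and the remainder of \<open>k\<close> modulo the order is again a period
  if \<open>k\<close> is one.
\<close>

lemma torus_ord_dvd_iff: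
  assumes "k > 0"
  shows "(\<forall>i. of_nat k * \<alpha> $ i \<in> \<int>) \<longleftrightarrow> (\<exists>q. torus_ord \<alpha> = enat q \<and> q dvd k)"
proof -
  define P where "P n \<longleftrightarrow> (\<forall>i. of_nat n * \<alpha> $ i \<in> \<int>)" for n :: nat
  have ord: "torus_ord \<alpha> = (if \<exists>n>0. P n then enat (LEAST n. n > 0 \<and> P n) else \<infinity>)"
    unfolding P_def torus_ord_def by simp
  have "\<exists>q. torus_ord \<alpha> = enat q \<and> q dvd k" if "P k"
  proof -
    define q where "q = (LEAST n. n > 0 \<and> P n)"
    have q: "torus_ord \<alpha> = enat q" using that assms by (auto simp: ord q_def)
    have "q > 0 \<and> P q" unfolding q_def by (rule LeastI[of _ k]) (use that assms in auto)
    moreover have "P (k mod q)"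
      unfolding P_def
    proof
      fix i
      have "real (k mod q) * \<alpha> $ i = of_nat k * \<alpha> $ i - of_nat (k div q) * (of_nat q * \<alpha> $ i)"
      proof -
        have k: "real k = real (k div q) * real q + real (k mod q)"
          by (metis div_mult_mod_eq of_nat_add of_nat_mult)
        show ?thesis unfolding k by (simp add: algebra_simps)
      qed
      then show "real (k mod q) * \<alpha> $ i \<in> \<int>"
        using that \<open>q > 0 \<and> P q\<close> by (auto simp: P_def)
    qed
    then have "\<not> 0 < k mod q"
      using not_less_Least[of "k mod q" "\<lambda>n. n > 0 \<and> P n"] \<open>q > 0 \<and> P q\<close> unfolding q_def[symmetric]
      by auto
    ultimately show ?thesis using q by auto
  qed
  moreover have "P k" if q: "torus_ord \<alpha> = enat q" "q dvd k" for q
  proof -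
    have "P q" using q(1) LeastI_ex[of "\<lambda>n. n > 0 \<and> P n"] by (auto simp: ord split: if_splits)
    moreover obtain m where "k = q * m" using q(2) by blast
    then have "real k * \<alpha> $ i = of_nat m * (of_nat q * \<alpha> $ i)" for i by simp
    ultimately show ?thesis unfolding P_def by (metis Ints_mult Ints_of_nat)
  qed
  ultimately show ?thesis unfolding P_def by blast
qed

text \<open>
  The frequencies in the Fourier expansion of a sieve are torsion points. The projections \<open>P\<^sub>q\<close>
  require them to be sorted by their order.
\<close>

lemma vec_box_unit_fractions:
  assumes "k > 0"
  shows "vec_box (unit_fractions k) = (\<Union>q\<in>{q. q dvd k}. torus_points_of_order q :: (real ^ 'd::finite) set)"
proof -
  have "\<alpha> \<in> vec_box (unit_fractions k) \<longleftrightarrow> \<alpha> \<in> vec_box {0..<1} \<and> (\<forall>i. of_nat k * \<alpha> $ i \<in> \<int>)" for \<alpha> :: "real ^ 'd"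
    by (auto simp: vec_box_def unit_fractions_def)
  then show ?thesis using torus_ord_dvd_iff[OF assms] by (auto simp: torus_points_of_order_def)
qed

lemma torus_points_of_order_0: "torus_points_of_order 0 = {}"
  using torus_ord_pos by (fastforce simp: torus_points_of_order_def)

lemma finite_torus_points_of_order [simp]: "finite (torus_points_of_order q)"
proof (cases "q = 0")
  case False
  then have "torus_points_of_order q \<subseteq> vec_box (unit_fractions q)"
    using vec_box_unit_fractions[of q] by auto
  then show ?thesis using False by (auto intro: finite_subset simp: finite_unit_fractions)
qed (simp add: torus_points_of_order_0)

lemma torus_points_of_order_1: "torus_points_of_order 1 = {0 :: real ^ 'd::finite}"
proof -
  have *: "{..<1::nat} = {0}" by (intro equalityI subsetI) (simp_all add: less_Suc_eq)
  have 0: "unit_fractions 1 = {0}"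
    unfolding unit_fractions_eq[OF zero_less_one] * image_insert image_empty of_nat_0 div_0 ..
  have "vec_box (unit_fractions 1) = (\<Union>q\<in>{1}. torus_points_of_order q :: (real ^ 'd) set)"
    unfolding vec_box_unit_fractions[OF zero_less_one] by (simp only: nat_dvd_1_iff_1 singleton_conv)
  moreover have "v \<in> vec_box (unit_fractions 1) \<longleftrightarrow> v = 0" for v :: "real ^ 'd"
    unfolding 0 vec_box_def vec_eq_iff mem_Collect_eq singleton_iff zero_index ..
  ultimately show ?thesis by blast
qed

lemma torus_representative:
  obtains \<beta> :: "real ^ 'd::finite" where "\<beta> \<in> vec_box {0..<1}" "torus_ord \<beta> = torus_ord \<alpha>"
    "\<And>v. lattice_character \<beta> v = lattice_character \<alpha> v"
proof
  define \<beta> :: "real ^ 'd" where "\<beta> = (\<chi> i. frac (\<alpha> $ i))"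
  show "\<beta> \<in> vec_box {0..<1}" by (simp add: \<beta>_def vec_box_def frac_lt_1)
  have d: "\<beta> $ i - \<alpha> $ i \<in> \<int>" for i by (simp add: \<beta>_def frac_def)
  show "lattice_character \<beta> v = lattice_character \<alpha> v" for v
    by (rule lattice_character_cong[OF d])
  have "real n * \<beta> $ i \<in> \<int> \<longleftrightarrow> real n * \<alpha> $ i \<in> \<int>" for n i
  proof -
    have "real n * \<beta> $ i - real n * \<alpha> $ i \<in> \<int>"
      using Ints_mult[OF Ints_of_nat[of n] d[of i]] by (simp add: right_diff_distrib)
    then show ?thesis using Ints_add Ints_diff by (metis add.commute diff_add_cancel diff_diff_eq2)
  qed
  then show "torus_ord \<beta> = torus_ord \<alpha>" by (simp add: torus_ord_def)
qed

section \<open>Projections onto the eigenfunctions of a given order\<close>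

lemma complex_span_base: "h \<in> S \<Longrightarrow> h \<in> complex_span S"
  unfolding complex_span_def by (intro CollectI exI[of _ "{h}"] exI[of _ "\<lambda>_. 1"]) auto

lemma complex_span_zero: "(\<lambda>x. 0) \<in> complex_span S"
  unfolding complex_span_def by (intro CollectI exI[of _ "{}"] exI[of _ "\<lambda>_. 1"]) auto

lemma complex_span_add:
  assumes "g \<in> complex_span S" "h \<in> complex_span S"
  shows "(\<lambda>x. g x + h x) \<in> complex_span S"
proof -
  obtain H c where H: "finite H" "H \<subseteq> S" "g = (\<lambda>x. \<Sum>h\<in>H. c h * h x)"
    using assms(1) by (auto simp: complex_span_def)
  obtain K b where K: "finite K" "K \<subseteq> S" "h = (\<lambda>x. \<Sum>h\<in>K. b h * h x)"
    using assms(2) by (auto simp: complex_span_def)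
  let ?c = "\<lambda>h. (if h \<in> H then c h else 0) + (if h \<in> K then b h else 0)"
  have "g x + h x = (\<Sum>h\<in>H \<union> K. ?c h * h x)" for x
  proof -
    have "(\<Sum>h\<in>H. c h * h x) = (\<Sum>h\<in>H \<union> K. (if h \<in> H then c h else 0) * h x)"
      "(\<Sum>h\<in>K. b h * h x) = (\<Sum>h\<in>H \<union> K. (if h \<in> K then b h else 0) * h x)"
      using H(1) K(1) by (auto intro!: sum.mono_neutral_cong_left)
    then show ?thesis by (simp add: H(3) K(3) sum.distrib distrib_right)
  qed
  then show ?thesis unfolding complex_span_def using H K
    by (intro CollectI exI[of _ "H \<union> K"] exI[of _ ?c]) auto
qed

lemma complex_span_L2: "S \<subseteq> L2 M \<Longrightarrow> complex_span S \<subseteq> L2 M"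
  by (auto simp: complex_span_def intro!: L2_lincomb)

lemma L2_closed_span_L2: "h \<in> L2_closed_span M S \<Longrightarrow> h \<in> L2 M"
  by (simp add: L2_closed_span_def)

lemma L2_closed_span_base: "h \<in> S \<Longrightarrow> h \<in> L2 M \<Longrightarrow> h \<in> L2_closed_span M S"
  unfolding L2_closed_span_def using complex_span_base[of h S] by force

lemma L2_closed_span_null:
  assumes "h \<in> L2 M" "AE x in M. h x = 0" shows "h \<in> L2_closed_span M S"
proof -
  have "L2_norm M (\<lambda>x. h x - 0) = 0" using L2_norm_eq_0_iff[OF assms(1)] assms(2) by simp
  then show ?thesis unfolding L2_closed_span_def using complex_span_zero[of S] assms(1) by force
qed

lemma L2_closed_span_add:
  assumes S: "S \<subseteq> L2 M" and g: "g \<in> L2_closed_span M S" and h: "h \<in> L2_closed_span M S"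
  shows "(\<lambda>x. g x + h x) \<in> L2_closed_span M S"
  unfolding L2_closed_span_def
proof (intro CollectI conjI allI impI)
  note L2 = L2_closed_span_L2[OF g] L2_closed_span_L2[OF h]
  show "(\<lambda>x. g x + h x) \<in> L2 M" using L2 by (rule L2_add)
  fix e :: real assume "e > 0"
  then have "e / 2 > 0" by simp
  obtain g' where g': "g' \<in> complex_span S" "L2_norm M (\<lambda>x. g x - g' x) < e / 2"
    using g \<open>e / 2 > 0\<close> unfolding L2_closed_span_def by blast
  obtain h' where h': "h' \<in> complex_span S" "L2_norm M (\<lambda>x. h x - h' x) < e / 2"
    using h \<open>e / 2 > 0\<close> unfolding L2_closed_span_def by blast
  have L2': "g' \<in> L2 M" "h' \<in> L2 M" using g'(1) h'(1) complex_span_L2[OF S] by auto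
  have "L2_norm M (\<lambda>x. g x + h x - (g' x + h' x)) < e"
    using L2_norm_triangle[OF L2_diff[OF L2(1) L2'(1)] L2_diff[OF L2(2) L2'(2)]] g'(2) h'(2)
    by (simp add: algebra_simps)
  then show "\<exists>k\<in>complex_span S. L2_norm M (\<lambda>x. g x + h x - k x) < e"
    using complex_span_add[OF g'(1) h'(1)] by (intro bexI[of _ "\<lambda>x. g' x + h' x"])
qed

lemma L2_closed_span_sum:
  assumes "S \<subseteq> L2 M" "\<And>i. i \<in> I \<Longrightarrow> F i \<in> L2_closed_span M S"
  shows "(\<lambda>x. \<Sum>i\<in>I. F i x) \<in> L2_closed_span M S"
  using assms(2)
proof (induction I rule: infinite_finite_induct)
  case (insert i I)
  then show ?case using L2_closed_span_add[OF assms(1), of "F i"] by simp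
qed (simp_all add: L2_closed_span_null)

lemma L2_closed_span_orthogonal:
  assumes S: "S \<subseteq> L2 M" and h: "h \<in> L2_closed_span M S" and g: "g \<in> L2 M"
    and orth: "\<And>s. s \<in> S \<Longrightarrow> L2_inner M g s = 0"
  shows "L2_inner M g h = 0"
proof -
  have hL2: "h \<in> L2 M" using h by (rule L2_closed_span_L2)
  have "cmod (L2_inner M g h) \<le> L2_norm M g * e" if e: "e > 0" for e
  proof -
    obtain s where s: "s \<in> complex_span S" "L2_norm M (\<lambda>x. h x - s x) < e"
      using h e unfolding L2_closed_span_def by blast
    have sL2: "s \<in> L2 M" using s complex_span_L2[OF S] by auto
    obtain H c where H: "finite H" "H \<subseteq> S" "s = (\<lambda>x. \<Sum>h\<in>H. c h * h x)"
      using s(1) by (auto simp: complex_span_def)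
    have "L2_inner M g s = (\<Sum>k\<in>H. L2_inner M g (\<lambda>x. c k * k x))"
      unfolding H(3) using H(2) S by (intro L2_inner_sum_right g L2_cmult) auto
    also have "\<dots> = 0" using H(2) orth by (intro sum.neutral) (auto simp: L2_inner_cmult_right)
    finally have "L2_inner M g h = L2_inner M g (\<lambda>x. h x - s x)"
      by (simp add: L2_inner_diff_right[OF hL2 sL2 g])
    then have "cmod (L2_inner M g h) \<le> L2_norm M g * L2_norm M (\<lambda>x. h x - s x)"
      using L2_Cauchy_Schwarz[OF g L2_diff[OF hL2 sL2]] by simp
    also have "\<dots> \<le> L2_norm M g * e" using s(2) by (intro mult_left_mono) auto
    finally show ?thesis .
  qed
  then have "cmod (L2_inner M g h) \<le> L2_norm M g * inverse (real (Suc n))" for n by simp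
  moreover have "(\<lambda>n. L2_norm M g * inverse (real (Suc n))) \<longlonglongrightarrow> L2_norm M g * 0"
    by (intro tendsto_intros LIMSEQ_inverse_real_of_nat)
  ultimately have "cmod (L2_inner M g h) \<le> L2_norm M g * 0"
    by (intro LIMSEQ_le_const) auto
  then show ?thesis by simp
qed

text \<open>
  Two projections of \<open>f\<close> onto \<open>K\<close> lie in \<open>K\<close> and their difference is orthogonal to \<open>K\<close>, hence to
  itself.
\<close>

lemma L2_proj_eq:
  assumes g: "is_L2_proj M K f g" and K: "K \<subseteq> L2 M" and f: "f \<in> L2 M"
  shows "L2_proj M K f \<in> L2 M" "AE x in M. L2_proj M K f x = g x"
proof -
  define h where "h = L2_proj M K f"
  have h: "is_L2_proj M K f h" unfolding h_def L2_proj_def by (rule someI[of "is_L2_proj M K f", OF g])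
  have L2: "g \<in> L2 M" "h \<in> L2 M" using g h K by (auto simp: is_L2_proj_def)
  have "L2_inner M (\<lambda>x. h x - g x) k = 0" if "k \<in> K" for k
  proof -
    have "k \<in> L2 M" using that K by auto
    moreover have "L2_inner M (\<lambda>x. f x - h x) k = 0" "L2_inner M (\<lambda>x. f x - g x) k = 0"
      using g h that by (auto simp: is_L2_proj_def)
    ultimately show ?thesis using f L2 by (simp add: L2_inner_diff_left)
  qed
  then have "L2_inner M (\<lambda>x. h x - g x) h = 0" "L2_inner M (\<lambda>x. h x - g x) g = 0"
    using g h by (auto simp: is_L2_proj_def)
  then have "L2_inner M (\<lambda>x. h x - g x) (\<lambda>x. h x - g x) = 0"
    using L2_inner_diff_right[OF L2(2) L2(1) L2_diff[OF L2(2) L2(1)]] by simp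
  then have "L2_norm M (\<lambda>x. h x - g x) = 0" by (simp add: L2_inner_self)
  then have "AE x in M. h x - g x = 0" using L2_norm_eq_0_iff[OF L2_diff[OF L2(2) L2(1)]] by simp
  then show "AE x in M. L2_proj M K f x = g x" by (simp add: h_def)
  show "L2_proj M K f \<in> L2 M" using L2(2) by (simp add: h_def)
qed

definition order_part ::
  "'a measure \<Rightarrow> (int ^ 'd \<Rightarrow> 'a \<Rightarrow> 'a) \<Rightarrow> nat \<Rightarrow> ('a \<Rightarrow> complex) \<Rightarrow> 'a \<Rightarrow> complex" where
  "order_part M T q f = (\<lambda>x. \<Sum>\<alpha>\<in>torus_points_of_order q. eigen_part M T \<alpha> f x)"

context prob_preserving_action
begin

lemma order_part_L2 [intro]: "f \<in> L2 M \<Longrightarrow> order_part M T q f \<in> L2 M"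
  unfolding order_part_def by (intro L2_sum eigen_part_L2)

lemma order_part_1: "order_part M T 1 f = eigen_part M T 0 f"
  unfolding order_part_def torus_points_of_order_1 by simp

lemma Eig_subset_L2: "Eig M T \<alpha> \<subseteq> L2 M"
  by (auto simp: Eig_def L2_closed_span_def)

lemma Eig_order_subset_L2: "Eig_order M T q \<subseteq> L2 M"
  by (auto simp: Eig_order_def L2_closed_span_def)

lemma order_part_in_Eig_order:
  assumes f: "f \<in> L2 M" shows "order_part M T q f \<in> Eig_order M T q"
  unfolding order_part_def Eig_order_def
proof (intro L2_closed_span_sum L2_closed_span_base eigen_part_L2 f)
  fix \<alpha> :: "real ^ 'd" assume "\<alpha> \<in> torus_points_of_order q"
  moreover have "eigen_part M T \<alpha> f \<in> Eig M T \<alpha>"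
  \<comment> \<open>Eigenfunctions are non-zero, whereas the eigenspace part of \<open>f\<close> may vanish.\<close>
  proof (cases "AE x in M. eigen_part M T \<alpha> f x = 0")
    case True
    then show ?thesis unfolding Eig_def by (intro L2_closed_span_null eigen_part_L2 f)
  next
    case False
    then have "eigen_part M T \<alpha> f \<in> eigenfunctions M T \<alpha>"
      using eigen_part_in_eigenspace[OF f, of \<alpha>] by (simp add: eigenfunctions_def eigenspace_def)
    then show ?thesis unfolding Eig_def by (intro L2_closed_span_base eigen_part_L2 f)
  qed
  ultimately show "eigen_part M T \<alpha> f \<in> \<Union> (Eig M T ` {\<alpha>. torus_ord \<alpha> = enat q})"
    by (auto simp: torus_points_of_order_def)
qed (use Eig_subset_L2 in auto)

text \<open>
  The frequency of \<open>h\<close> agrees modulo the integer lattice with exactly one of the listed points of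
  order \<open>q\<close>. The part of \<open>f\<close> at that point accounts for the whole inner product with \<open>h\<close>, and the other
  parts are orthogonal to \<open>h\<close>.
\<close>

lemma order_part_residual_orthogonal:
  assumes f: "f \<in> L2 M" and h: "h \<in> eigenspace M T \<alpha>" and q: "torus_ord \<alpha> = enat q"
  shows "L2_inner M (\<lambda>x. f x - order_part M T q f x) h = 0"
proof -
  have hL2: "h \<in> L2 M" using h by (rule eigenspace_L2)
  obtain \<beta> where \<beta>: "\<beta> \<in> vec_box {0..<1}" "torus_ord \<beta> = torus_ord \<alpha>"
    "\<And>v. lattice_character \<beta> v = lattice_character \<alpha> v"
    using torus_representative[of \<alpha>] by blast
  have h\<beta>: "h \<in> eigenspace M T \<beta>" using h by (simp add: eigenspace_def \<beta>(3))
  have \<beta>q: "\<beta> \<in> torus_points_of_order q" using \<beta> q by (simp add: torus_points_of_order_def)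
  have "L2_inner M (order_part M T q f) h
      = (\<Sum>\<gamma>\<in>torus_points_of_order q. L2_inner M (eigen_part M T \<gamma> f) h)"
    unfolding order_part_def by (intro L2_inner_sum_left eigen_part_L2 f hL2)
  also have "\<dots> = (\<Sum>\<gamma>\<in>torus_points_of_order q. if \<gamma> = \<beta> then L2_inner M f h else 0)"
  proof (intro sum.cong refl)
    fix \<gamma> :: "real ^ 'd" assume \<gamma>: "\<gamma> \<in> torus_points_of_order q"
    show "L2_inner M (eigen_part M T \<gamma> f) h = (if \<gamma> = \<beta> then L2_inner M f h else 0)"
    proof (cases "\<gamma> = \<beta>")
      case False
      then obtain v where "lattice_character \<gamma> v \<noteq> lattice_character \<beta> v"
        using lattice_character_distinct[of \<gamma> \<beta>] \<gamma> \<beta>(1) by (auto simp: torus_points_of_order_def)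
      then show ?thesis
        using eigenspace_orthogonal[OF eigen_part_in_eigenspace[OF f] h\<beta>] False by simp
    qed (simp add: eigen_part_inner f h\<beta>)
  qed
  also have "\<dots> = L2_inner M f h" using \<beta>q by simp
  finally show ?thesis by (simp add: L2_inner_diff_left f order_part_L2 hL2)
qed

lemma order_part_is_L2_proj:
  assumes f: "f \<in> L2 M"
  shows "is_L2_proj M (Eig_order M T q) f (order_part M T q f)"
  unfolding is_L2_proj_def
proof (intro conjI ballI order_part_in_Eig_order[OF f])
  let ?r = "\<lambda>x. f x - order_part M T q f x"
  have r: "?r \<in> L2 M" by (intro L2_diff order_part_L2 f)
  fix h assume h: "h \<in> Eig_order M T q"
  have Eig: "L2_inner M ?r s = 0" if "torus_ord \<alpha> = enat q" "s \<in> Eig M T \<alpha>" for \<alpha> s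
  proof (rule L2_closed_span_orthogonal[OF _ that(2)[unfolded Eig_def] r])
    show "eigenfunctions M T \<alpha> \<subseteq> L2 M" by (auto simp: eigenfunctions_def)
    show "L2_inner M ?r k = 0" if "k \<in> eigenfunctions M T \<alpha>" for k
      using that eigenfunctions_subset_eigenspace \<open>torus_ord \<alpha> = enat q\<close>
      by (intro order_part_residual_orthogonal[OF f, of _ \<alpha>]) auto
  qed
  show "L2_inner M ?r h = 0"
    by (rule L2_closed_span_orthogonal[OF _ h[unfolded Eig_order_def] r])
      (use Eig_subset_L2 Eig in auto)
qed

lemma order_part_1_is_L2_proj:
  assumes f: "f \<in> L2 M"
  shows "is_L2_proj M (invariant_functions M T) f (order_part M T 1 f)"
  unfolding is_L2_proj_def invariant_functions_eq order_part_1
proof (intro conjI ballI eigen_part_in_eigenspace[OF f])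
  fix h assume h: "h \<in> eigenspace M T 0"
  then show "L2_inner M (\<lambda>x. f x - eigen_part M T 0 f x) h = 0"
    using eigen_part_inner[OF f h] by (simp add: L2_inner_diff_left f eigen_part_L2 eigenspace_L2)
qed

lemma order_part_orthogonal:
  assumes f: "f \<in> L2 M" and "q \<noteq> q'"
  shows "L2_inner M (order_part M T q f) (order_part M T q' f) = 0"
proof -
  have "L2_inner M (eigen_part M T \<alpha> f) (eigen_part M T \<beta> f) = 0"
    if "\<alpha> \<in> torus_points_of_order q" "\<beta> \<in> torus_points_of_order q'" for \<alpha> \<beta>
  proof -
    have "\<exists>v. lattice_character \<alpha> v \<noteq> lattice_character \<beta> v"
      using that assms(2) by (intro lattice_character_distinct) (auto simp: torus_points_of_order_def)
    then show ?thesis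
      using eigenspace_orthogonal[OF eigen_part_in_eigenspace[OF f] eigen_part_in_eigenspace[OF f]]
      by blast
  qed
  then show ?thesis
    unfolding order_part_def using f
    by (subst L2_inner_sum_left) (auto intro!: L2_sum sum.neutral simp: L2_inner_sum_right eigen_part_L2)
qed

lemma order_part_lincomb_norm:
  assumes f: "f \<in> L2 M" and "finite F"
  shows "(L2_norm M (\<lambda>x. \<Sum>q\<in>F. c q * order_part M T q f x))\<^sup>2
    = (\<Sum>q\<in>F. (cmod (c q))\<^sup>2 * (L2_norm M (order_part M T q f))\<^sup>2)"
  using assms by (subst L2_pythagoras)
    (auto simp: L2_norm_cmult power_mult_distrib L2_inner_cmult_left L2_inner_cmult_right order_part_orthogonal)

lemma order_part_Bessel:
  assumes f: "f \<in> L2 M" and F: "finite F"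
  shows "(\<Sum>q\<in>F. (L2_norm M (order_part M T q f))\<^sup>2) \<le> (L2_norm M f)\<^sup>2"
proof -
  define s where "s = (\<lambda>x. \<Sum>q\<in>F. order_part M T q f x)"
  have s: "s \<in> L2 M" unfolding s_def by (intro L2_sum order_part_L2 f)
  have norm_s: "(L2_norm M s)\<^sup>2 = (\<Sum>q\<in>F. (L2_norm M (order_part M T q f))\<^sup>2)"
    using order_part_lincomb_norm[OF f F, of "\<lambda>_. 1"] by (simp add: s_def)
  have "L2_inner M f (order_part M T q f) = of_real ((L2_norm M (order_part M T q f))\<^sup>2)" for q
    unfolding L2_inner_self[symmetric] using order_part_is_L2_proj[OF f, of q] f
    by (auto simp: is_L2_proj_def L2_inner_diff_left order_part_L2)
  then have "L2_inner M f s = of_real ((L2_norm M s)\<^sup>2)"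
    unfolding norm_s unfolding s_def using f by (subst L2_inner_sum_right) auto
  then have "L2_norm M s * L2_norm M s \<le> L2_norm M f * L2_norm M s"
    using L2_Cauchy_Schwarz[OF f s] by (simp add: norm_power power2_eq_square norm_mult)
  then have "L2_norm M s \<le> L2_norm M f"
    by (cases "L2_norm M s = 0") (auto simp: mult_le_cancel_right order_less_le)
  then show ?thesis unfolding norm_s[symmetric] by (intro power_mono) auto
qed

text \<open>
  By Bessel's inequality the squared norms of the order parts form a convergent series, and bounded
  coefficients preserve the smallness of its tails. The set \<open>F\<close> is arbitrary because the sieve produces
  sums over divisors rather than over intervals.
\<close>

lemma order_part_tail:
  assumes f: "f \<in> L2 M" and c: "\<And>q. cmod (c q) \<le> 1" and e: "e > 0"
  obtains n where "\<And>F. finite F \<Longrightarrow> F \<subseteq> {n..} \<Longrightarrow>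
    L2_norm M (\<lambda>x. \<Sum>q\<in>F. c q * order_part M T q f x) < e"
proof -
  define p where "p q = (L2_norm M (order_part M T q f))\<^sup>2" for q
  have "summable p"
    using order_part_Bessel[OF f] by (intro summableI_nonneg_bounded[where x = "(L2_norm M f)\<^sup>2"]) (auto simp: p_def)
  then obtain n where n: "\<And>m m'. m \<ge> n \<Longrightarrow> norm (sum p {m..<m'}) < e\<^sup>2"
    unfolding summable_Cauchy using e by (meson zero_less_power)
  show thesis
  proof (rule that[of n], rule power2_less_imp_less)
    fix F assume F: "finite F" "F \<subseteq> {n..}"
    obtain m where m: "F \<subseteq> {..<m}" using F(1) finite_nat_bounded by blast
    have "(L2_norm M (\<lambda>x. \<Sum>q\<in>F. c q * order_part M T q f x))\<^sup>2 \<le> sum p F"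
      unfolding order_part_lincomb_norm[OF f F(1)] p_def
      using c by (intro sum_mono mult_left_le_one_le) (auto intro: power_le_one)
    also have "\<dots> \<le> sum p {n..<m}" using F(2) m by (intro sum_mono2) (auto simp: p_def)
    also have "\<dots> < e\<^sup>2" using n[of n m] by simp
    finally show "(L2_norm M (\<lambda>x. \<Sum>q\<in>F. c q * order_part M T q f x))\<^sup>2 < e\<^sup>2" .
  qed (use e in simp)
qed

lemma order_part_series_converges:
  assumes f: "f \<in> L2 M" and c: "\<And>q. cmod (c q) \<le> 1"
  shows "\<exists>S. L2_tendsto M (\<lambda>n x. \<Sum>q=2..n. c q * order_part M T q f x) S"
proof (rule L2_complete)
  show "(\<lambda>x. \<Sum>q=2..n. c q * order_part M T q f x) \<in> L2 M" for n
    by (intro L2_lincomb order_part_L2 f)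
  fix e :: real assume "e > 0"
  obtain n where n: "\<And>F. finite F \<Longrightarrow> F \<subseteq> {n..} \<Longrightarrow>
    L2_norm M (\<lambda>x. \<Sum>q\<in>F. c q * order_part M T q f x) < e"
    using order_part_tail[OF f, of c, OF c \<open>e > 0\<close>] by blast
  let ?s = "\<lambda>m x. \<Sum>q=2..m. c q * order_part M T q f x"
  have *: "L2_norm M (\<lambda>x. ?s m x - ?s m' x) < e" if "m' \<ge> n" "m \<ge> m'" for m m'
  proof -
    have "?s m x - ?s m' x = (\<Sum>q\<in>{2..m} - {2..m'}. c q * order_part M T q f x)" for x
      using that by (subst sum_diff) auto
    moreover have "{2..m} - {2..m'} \<subseteq> {n..}" using that by auto
    ultimately show ?thesis using n[of "{2..m} - {2..m'}"] by simp
  qed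
  have "L2_norm M (\<lambda>x. ?s m x - ?s m' x) < e" if "m' \<ge> n" "m \<ge> n" for m m'
    using *[of m' m] *[of m m'] that L2_norm_minus_commute[of M "?s m" "?s m'"]
    by (cases "m \<ge> m'") auto
  then show "\<exists>K. \<forall>m\<ge>K. \<forall>m'\<ge>K. L2_norm M (\<lambda>x. ?s m x - ?s m' x) < e" by blast
qed

end

section \<open>Products of distinct primes\<close>

text \<open>
  Only squarefree numbers contribute to the limit. They are handled as finite sets of primes: as \<open>B\<close>
  runs through the subsets of \<open>A\<close>, the product of \<open>B\<close> runs once through the divisors of the product
  of \<open>A\<close>.
\<close>

lemma prod_primes_pos:
  fixes A :: "nat set"
  assumes "\<forall>p\<in>A. prime p" shows "\<Prod>A > 0"
  using assms by (intro prod_pos) (auto simp: prime_gt_0_nat)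

lemma prod_primes_dvd_iff:
  fixes A :: "nat set"
  assumes "finite A" "\<forall>p\<in>A. prime p"
  shows "\<Prod>A dvd n \<longleftrightarrow> (\<forall>p\<in>A. p dvd n)"
  using assms
proof (induction A rule: finite_induct)
  case (insert p A)
  have "coprime p (\<Prod>A)"
    using insert by (intro prod_coprime_right primes_coprime) auto
  then have "p * \<Prod>A dvd n \<longleftrightarrow> p dvd n \<and> \<Prod>A dvd n"
    by (auto intro: divides_mult dest: dvd_mult_left dvd_mult_right)
  then show ?case using insert by simp
qed simp

lemma prime_dvd_prod_primes_iff:
  fixes A :: "nat set"
  assumes "finite A" "\<forall>p\<in>A. prime p" "prime p"
  shows "p dvd \<Prod>A \<longleftrightarrow> p \<in> A"
  using assms prime_dvd_prod_iff[of A p "\<lambda>x. x"] by (metis dvd_refl primes_dvd_imp_eq)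

lemma prime_factors_prod_primes:
  fixes A :: "nat set"
  assumes "finite A" "\<forall>p\<in>A. prime p"
  shows "prime_factors (\<Prod>A) = A"
proof -
  have "p \<in> prime_factors (\<Prod>A) \<longleftrightarrow> p \<in> A" for p
    using prod_primes_pos[OF assms(2)] prime_dvd_prod_primes_iff[OF assms, of p] assms(2)
    by (metis in_prime_factors_iff less_irrefl)
  then show ?thesis by blast
qed

lemma squarefree_prod_primes:
  fixes A :: "nat set"
  assumes "\<forall>p\<in>A. prime p"
  shows "squarefree (\<Prod>A)"
  using assms by (intro squarefree_prod_coprime) (auto intro: primes_coprime squarefree_prime)

lemma squarefree_eq_prod_primes:
  fixes n :: nat
  assumes "squarefree n" shows "\<Prod>(prime_factors n) = n"
proof -
  have "n \<noteq> 0" using assms by (metis not_squarefree_0)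
  then have "(\<Prod>p\<in>prime_factors n. p ^ multiplicity p n) = n"
    using prod_prime_factors[of n] by simp
  moreover have "p ^ multiplicity p n = p" if "p \<in> prime_factors n" for p
    using assms that \<open>n \<noteq> 0\<close> by (simp add: squarefree_factorial_semiring')
  ultimately show ?thesis by simp
qed

lemma inj_on_prod_primes:
  assumes "\<forall>p\<in>A. prime (p::nat)" "finite A"
  shows "inj_on (\<lambda>B. \<Prod>B) (Pow A)"
proof (rule inj_on_inverseI[where g = prime_factors])
  fix B assume "B \<in> Pow A"
  then show "prime_factors (\<Prod>B) = B"
    using assms by (intro prime_factors_prod_primes) (auto intro: finite_subset)
qed

lemma divisors_prod_primes:
  fixes A :: "nat set"
  assumes "finite A" "\<forall>p\<in>A. prime p"
  shows "{q. q dvd \<Prod>A} = (\<lambda>B. \<Prod>B) ` Pow A"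
proof (intro equalityI subsetI)
  fix q assume "q \<in> {q. q dvd \<Prod>A}"
  then have q: "q dvd \<Prod>A" by simp
  then have "squarefree q" using squarefree_mono squarefree_prod_primes[OF assms(2)] by blast
  then have "q = \<Prod>(prime_factors q)" by (simp add: squarefree_eq_prod_primes)
  moreover have "prime_factors q \<subseteq> A"
    using q prime_dvd_prod_primes_iff[OF assms] by (meson dvd_trans in_prime_factors_iff subsetI)
  ultimately show "q \<in> (\<lambda>B. \<Prod>B) ` Pow A" by blast
next
  fix q assume "q \<in> (\<lambda>B. \<Prod>B) ` Pow A"
  then show "q \<in> {q. q dvd \<Prod>A}" using assms(1) by (auto intro: prod_dvd_prod_subset)
qed

lemma moebius_mu_prod_primes:
  fixes A :: "nat set"
  assumes "finite A" "\<forall>p\<in>A. prime p"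
  shows "moebius_mu (\<Prod>A) = (-1) ^ card A"
  using squarefree_prod_primes[OF assms(2)] prime_factors_prod_primes[OF assms]
  by (simp add: moebius_mu_def)

text \<open>
  A set between \<open>C\<close> and \<open>A\<close> is \<open>C \<union> E\<close> with \<open>E \<subseteq> A - C\<close>, and the sum over \<open>E\<close> factors over the
  elements of \<open>A - C\<close>.
\<close>

lemma sum_supersets_prod:
  fixes w :: "'b \<Rightarrow> 'c::comm_ring_1"
  assumes "finite A" "C \<subseteq> A"
  shows "(\<Sum>B | C \<subseteq> B \<and> B \<subseteq> A. \<Prod>p\<in>B. w p) = (\<Prod>p\<in>C. w p) * (\<Prod>p\<in>A - C. w p + 1)"
proof -
  have "(\<Prod>p\<in>C. w p) * (\<Prod>p\<in>A - C. w p + 1) = (\<Sum>E\<in>Pow (A - C). (\<Prod>p\<in>C. w p) * (\<Prod>p\<in>E. w p))"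
    using assms by (simp add: prod_add sum_distrib_left)
  also have "\<dots> = (\<Sum>E\<in>Pow (A - C). \<Prod>p\<in>C \<union> E. w p)"
    using assms by (intro sum.cong refl prod.union_disjoint[symmetric]) (auto intro: finite_subset)
  also have "\<dots> = (\<Sum>B | C \<subseteq> B \<and> B \<subseteq> A. \<Prod>p\<in>B. w p)"
    using assms(2) by (intro sum.reindex_bij_witness[where i = "\<lambda>B. B - C" and j = "\<lambda>E. C \<union> E"])
      (auto simp: Un_absorb1)
  finally show ?thesis by simp
qed

section \<open>The Jordan totient of a product of distinct primes\<close>

text \<open>
  Inclusion and exclusion, obtained by expanding a product of factors \<open>1 - [P p]\<close>.
\<close>

lemma sieve_indicator:
  fixes A :: "nat set"
  assumes "finite A"
  shows "(if \<forall>p\<in>A. \<not> P p then 1 else 0 :: 'c::comm_ring_1)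
    = (\<Sum>B\<in>Pow A. (-1) ^ card B * (if \<forall>p\<in>B. P p then 1 else 0))"
proof -
  have "(if \<forall>p\<in>A. \<not> P p then 1 else 0 :: 'c) = (\<Prod>p\<in>A. 1 - (if P p then 1 else 0))"
  proof (cases "\<forall>p\<in>A. \<not> P p")
    case False
    then have "(\<Prod>p\<in>A. 1 - (if P p then 1 else 0)) = (0 :: 'c)"
      by (intro prod_zero[OF assms]) auto
    then show ?thesis using False by simp
  qed simp
  also have "\<dots> = (\<Sum>B\<in>Pow A. (-1) ^ card B * (\<Prod>p\<in>B. if P p then 1 else 0))"
    using assms by (subst prod_diff_conv_sum) auto
  also have "\<dots> = (\<Sum>B\<in>Pow A. (-1) ^ card B * (if \<forall>p\<in>B. P p then 1 else 0))"
  proof (intro sum.cong refl arg_cong2[of _ _ _ _ "(*)"])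
    fix B assume "B \<in> Pow A"
    then have "finite B" using assms by (auto intro: finite_subset)
    then show "(\<Prod>p\<in>B. if P p then 1 else 0 :: 'c) = (if \<forall>p\<in>B. P p then 1 else 0)"
      by (induction B rule: finite_induct) auto
  qed
  finally show ?thesis .
qed

lemma card_multiples_lessThan:
  assumes "k dvd n" "k > 0"
  shows "card {a. a < n \<and> k dvd a} = n div k"
proof -
  have "{a. a < n \<and> k dvd a} = (\<lambda>b. k * b) ` {..<n div k}"
    using assms by (auto simp: dvd_def image_iff)
  moreover have "inj_on (\<lambda>b. k * b) {..<n div k}" using assms(2) by (auto intro: inj_onI)
  ultimately show ?thesis by (simp add: card_image)
qed

text \<open>
  Inclusion and exclusion over the primes that divide all entries: the tuples modulo \<open>\<Prod>A\<close> whose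
  entries are multiples of \<open>\<Prod>B\<close> number \<open>(\<Prod>(A - B))\<close> to the power \<open>d\<close>, and the alternating sum of
  these numbers is the expansion of the product on the right.
\<close>

lemma jordan_totient_prod_primes:
  fixes A :: "nat set"
  assumes A: "finite A" "\<forall>p\<in>A. prime p"
  shows "int (jordan_totient d (\<Prod>A)) = (\<Prod>p\<in>A. int p ^ d - 1)"
proof -
  let ?X = "{..<d} \<rightarrow>\<^sub>E {..<\<Prod>A}"
  let ?P = "\<lambda>a p. \<forall>i<d. p dvd a i"
  have coprime: "Gcd (insert (\<Prod>A) (a ` {..<d})) = 1 \<longleftrightarrow> (\<forall>p\<in>A. \<not> ?P a p)" for a :: "nat \<Rightarrow> nat"
  proof -
    let ?G = "Gcd (insert (\<Prod>A) (a ` {..<d}))"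
    have "p dvd ?G \<longleftrightarrow> p \<in> A \<and> ?P a p" if "prime p" for p
      using prime_dvd_prod_primes_iff[OF A that] by (auto simp: dvd_Gcd_iff)
    moreover have "?G = 1 \<longleftrightarrow> (\<forall>p. prime p \<longrightarrow> \<not> p dvd ?G)"
      using prime_factor_nat[of ?G] by (metis not_prime_unit)
    ultimately show ?thesis using A(2) by blast
  qed
  have "int (jordan_totient d (\<Prod>A)) = (\<Sum>a\<in>?X. if \<forall>p\<in>A. \<not> ?P a p then 1 else 0)"
    unfolding jordan_totient_def coprime by (simp add: sum.If_cases finite_PiE Int_def)
  also have "\<dots> = (\<Sum>a\<in>?X. \<Sum>B\<in>Pow A. (-1) ^ card B * (if \<forall>p\<in>B. ?P a p then 1 else 0))"
    by (subst sieve_indicator[OF A(1)]) simp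
  also have "\<dots> = (\<Sum>B\<in>Pow A. (-1) ^ card B * int (card {a \<in> ?X. \<forall>p\<in>B. ?P a p}))"
    by (subst sum.swap) (simp add: sum_distrib_left[symmetric] sum.If_cases finite_PiE Int_def)
  also have "\<dots> = (\<Sum>B\<in>Pow A. (-1) ^ card B * (\<Prod>p\<in>B. 1) * (\<Prod>p\<in>A - B. int p ^ d))"
  proof (intro sum.cong refl)
    fix B assume B: "B \<in> Pow A"
    have fin: "finite B" and prime: "\<forall>p\<in>B. prime p" using A B by (auto intro: finite_subset)
    have "{a \<in> ?X. \<forall>p\<in>B. ?P a p} = {..<d} \<rightarrow>\<^sub>E {x. x < \<Prod>A \<and> \<Prod>B dvd x}"
      unfolding prod_primes_dvd_iff[OF fin prime] by (auto simp: PiE_def Pi_def)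
    then have "card {a \<in> ?X. \<forall>p\<in>B. ?P a p} = (\<Prod>A div \<Prod>B) ^ d"
      using B A prod_primes_pos[OF prime]
      by (simp add: card_PiE card_multiples_lessThan prod_dvd_prod_subset)
    also have "\<Prod>A div \<Prod>B = \<Prod>(A - B)"
      using B A(1) prod_primes_pos[OF prime] by (subst prod.subset_diff[of B A]) auto
    finally have "card {a \<in> ?X. \<forall>p\<in>B. ?P a p} = (\<Prod>(A - B)) ^ d" .
    then show "(-1) ^ card B * int (card {a \<in> ?X. \<forall>p\<in>B. ?P a p})
        = (-1) ^ card B * (\<Prod>p\<in>B. 1) * (\<Prod>p\<in>A - B. int p ^ d)"
      by (simp add: prod_power_distrib)
  qed
  also have "\<dots> = (\<Prod>p\<in>A. int p ^ d - 1)" by (rule prod_diff_conv_sum[OF A(1), symmetric])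
  finally show ?thesis .
qed

section \<open>Counting lattice points in residue classes\<close>

definition divides_vec :: "nat \<Rightarrow> int ^ 'd \<Rightarrow> bool" where
  "divides_vec m v \<longleftrightarrow> (\<forall>i. int m dvd v $ i)"

definition sieved_cube :: "nat set \<Rightarrow> nat \<Rightarrow> (int ^ 'd) set" where
  "sieved_cube A N = {v \<in> lattice_cube N. \<forall>p\<in>A. \<not> divides_vec p v}"

lemma divides_vec_prod_primes:
  fixes A :: "nat set"
  assumes "finite A" "\<forall>p\<in>A. prime p"
  shows "divides_vec (\<Prod>A) v \<longleftrightarrow> (\<forall>p\<in>A. divides_vec p v)"
proof -
  have *: "int m dvd x \<longleftrightarrow> m dvd nat \<bar>x\<bar>" for m x by simp
  show ?thesis unfolding divides_vec_def * prod_primes_dvd_iff[OF assms] by blast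
qed

lemma sieved_cube_indicator:
  fixes A :: "nat set"
  assumes "finite A" "\<forall>p\<in>A. prime p"
  shows "(if \<forall>p\<in>A. \<not> divides_vec p v then 1 else 0 :: 'c::comm_ring_1)
    = (\<Sum>B\<in>Pow A. (-1) ^ card B * (if divides_vec (\<Prod>B) v then 1 else 0))"
  unfolding sieve_indicator[OF assms(1)]
proof (intro sum.cong refl arg_cong2[of _ _ _ _ "(*)"])
  fix B assume "B \<in> Pow A"
  then have "divides_vec (\<Prod>B) v \<longleftrightarrow> (\<forall>p\<in>B. divides_vec p v)"
    using assms by (intro divides_vec_prod_primes) (auto intro: finite_subset)
  then show "(if \<forall>p\<in>B. divides_vec p v then 1 else 0 :: 'c) = (if divides_vec (\<Prod>B) v then 1 else 0)"
    by simp
qed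

lemma card_multiples_symmetric:
  assumes "m > 0"
  shows "card {x \<in> {- int N..int N}. int m dvd x} = 2 * (N div m) + 1"
proof -
  have "{x \<in> {- int N..int N}. int m dvd x} = (\<lambda>y. int m * y) ` {- int (N div m)..int (N div m)}"
  proof (intro equalityI subsetI)
    fix x assume x: "x \<in> {x \<in> {- int N..int N}. int m dvd x}"
    then obtain y where y: "x = int m * y" by auto
    have "int m * \<bar>y\<bar> \<le> int N" using x y assms by (auto simp: abs_if)
    then have "int (nat \<bar>y\<bar> * m) \<le> int N" by (simp add: mult.commute)
    then have "nat \<bar>y\<bar> * m \<le> N" by (simp only: of_nat_le_iff)
    then have "nat \<bar>y\<bar> \<le> N div m" using assms by (simp add: less_eq_div_iff_mult_less_eq)
    then have "\<bar>y\<bar> \<le> int (N div m)" by linarith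
    then show "x \<in> (\<lambda>y. int m * y) ` {- int (N div m)..int (N div m)}"
      unfolding y by (intro imageI) (auto simp: abs_le_iff)
  next
    fix x assume "x \<in> (\<lambda>y. int m * y) ` {- int (N div m)..int (N div m)}"
    then obtain y where y: "x = int m * y" "y \<in> {- int (N div m)..int (N div m)}" by (rule imageE)
    then have "\<bar>y\<bar> \<le> int (N div m)" by (auto simp: abs_le_iff)
    have "\<bar>x\<bar> = int m * \<bar>y\<bar>" using y(1) by (simp add: abs_mult)
    also have "\<dots> \<le> int m * int (N div m)" using \<open>\<bar>y\<bar> \<le> int (N div m)\<close> by (intro mult_left_mono) auto
    also have "\<dots> \<le> int N" by (metis of_nat_mult of_nat_mono times_div_less_eq_dividend)
    finally show "x \<in> {x \<in> {- int N..int N}. int m dvd x}" using y(1) by auto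
  qed
  moreover have "inj_on (\<lambda>y. int m * y) {- int (N div m)..int (N div m)}"
    using assms by (auto intro: inj_onI)
  ultimately show ?thesis by (simp add: card_image)
qed

lemma card_cube_multiples:
  assumes "m > 0"
  shows "card {v \<in> lattice_cube N. divides_vec m (v :: int ^ 'd::finite)} = (2 * (N div m) + 1) ^ CARD('d)"
proof -
  have "{v \<in> lattice_cube N. divides_vec m (v :: int ^ 'd)} = vec_box {x \<in> {- int N..int N}. int m dvd x}"
    by (auto simp: lattice_cube_def vec_box_def divides_vec_def)
  then show ?thesis using card_multiples_symmetric[OF assms, of N] by (simp add: card_vec_box)
qed

lemma density_multiples:
  assumes "m > 0"
  shows "(\<lambda>N. real (card {v \<in> lattice_cube N. divides_vec m (v :: int ^ 'd::finite)})
      / real (card (lattice_cube N :: (int ^ 'd) set))) \<longlonglongrightarrow> 1 / real m ^ CARD('d)"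
proof -
  have "(\<lambda>N. (2 * real (N div m) + 1) / (2 * real N + 1)) \<longlonglongrightarrow> 1 / real m"
  proof (rule real_tendsto_sandwich)
    have le: "real N / real m - 1 \<le> real (N div m)" "real (N div m) \<le> real N / real m" for N
      using floor_divide_of_nat_eq[of N m, where ?'a = real] of_nat_div_le_of_nat[of N m, where ?'a = real]
        of_int_floor_le[of "real N / real m"] real_of_int_floor_gt_diff_one[of "real N / real m"]
      by (simp_all add: algebra_simps)
    show "\<forall>\<^sub>F N in sequentially. (2 * (real N / real m) - 1) / (2 * real N + 1) \<le> (2 * real (N div m) + 1) / (2 * real N + 1)"
    proof (intro always_eventually allI divide_right_mono)
      show "2 * (real N / real m) - 1 \<le> 2 * real (N div m) + 1" for N using le(1)[of N] by linarith
    qed simp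
    show "\<forall>\<^sub>F N in sequentially. (2 * real (N div m) + 1) / (2 * real N + 1) \<le> (2 * (real N / real m) + 1) / (2 * real N + 1)"
    proof (intro always_eventually allI divide_right_mono)
      show "2 * real (N div m) + 1 \<le> 2 * (real N / real m) + 1" for N using le(2)[of N] by linarith
    qed simp
    show "(\<lambda>N. (2 * (real N / real m) - 1) / (2 * real N + 1)) \<longlonglongrightarrow> 1 / real m"
      using assms by real_asymp (simp add: inverse_eq_divide)
    show "(\<lambda>N. (2 * (real N / real m) + 1) / (2 * real N + 1)) \<longlonglongrightarrow> 1 / real m"
      using assms by real_asymp (simp add: inverse_eq_divide)
  qed
  from tendsto_power[OF this, of "CARD('d)"] show ?thesis
    by (simp add: card_cube_multiples[OF assms] card_lattice_cube power_divide add.commute)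
qed

lemma density_sieved_cube:
  fixes A :: "nat set"
  assumes A: "finite A" "\<forall>p\<in>A. prime p"
  shows "(\<lambda>N. real (card (sieved_cube A N :: (int ^ 'd::finite) set))
      / real (card (lattice_cube N :: (int ^ 'd) set))) \<longlonglongrightarrow> (\<Prod>p\<in>A. 1 - 1 / real p ^ CARD('d))"
proof -
  let ?q = "\<lambda>N. real (card (lattice_cube N :: (int ^ 'd) set))"
  let ?m = "\<lambda>B N. real (card {v \<in> lattice_cube N. divides_vec (\<Prod>B) (v :: int ^ 'd)})"
  have "real (card (sieved_cube A N :: (int ^ 'd) set)) = (\<Sum>B\<in>Pow A. (-1) ^ card B * ?m B N)" for N
  proof -
    have "real (card (sieved_cube A N :: (int ^ 'd) set))
        = (\<Sum>v\<in>(lattice_cube N :: (int ^ 'd) set). if \<forall>p\<in>A. \<not> divides_vec p v then 1 else 0)"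
      by (simp add: sieved_cube_def sum.If_cases Int_def)
    also have "\<dots> = (\<Sum>B\<in>Pow A. (-1) ^ card B * ?m B N)"
      unfolding sieved_cube_indicator[OF A]
      by (subst sum.swap) (simp add: sum_distrib_left[symmetric] sum.If_cases Int_def)
    finally show ?thesis .
  qed
  then have "real (card (sieved_cube A N :: (int ^ 'd) set)) / ?q N
      = (\<Sum>B\<in>Pow A. (-1) ^ card B * (?m B N / ?q N))" for N
    by (simp add: sum_divide_distrib)
  moreover have "(\<lambda>N. \<Sum>B\<in>Pow A. (-1) ^ card B * (?m B N / ?q N))
      \<longlonglongrightarrow> (\<Sum>B\<in>Pow A. (-1) ^ card B * (1 / real (\<Prod>B) ^ CARD('d)))"
  proof (intro tendsto_sum tendsto_mult tendsto_const density_multiples)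
    fix B assume "B \<in> Pow A"
    then show "\<Prod>B > 0" using A(2) by (intro prod_primes_pos) auto
  qed
  moreover have "(\<Sum>B\<in>Pow A. (-1) ^ card B * (1 / real (\<Prod>B) ^ CARD('d)))
      = (\<Prod>p\<in>A. 1 - 1 / real p ^ CARD('d))"
    unfolding prod_diff_conv_sum[OF A(1)]
    by (simp add: prod_power_distrib prod_dividef)
  ultimately show ?thesis by simp
qed

text \<open>
  Enlarging \<open>A\<close> to an interval of integers starting at \<open>2\<close> and lowering the exponent to \<open>2\<close> can only
  decrease the product, which then telescopes. The bound does not depend on \<open>A\<close>; this makes it possible to
  divide by the density of primitive vectors.
\<close>

lemma sieve_density_ge_half:
  fixes A :: "nat set"
  assumes A: "finite A" "\<forall>p\<in>A. prime p" and d: "d \<ge> 2"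
  shows "(\<Prod>p\<in>A. 1 - 1 / real p ^ d) \<ge> 1 / 2"
proof -
  have tel: "(\<Prod>m=2..n+1. 1 - 1 / (real m)\<^sup>2) = (real n + 2) / (2 * (real n + 1))" for n
  proof (induction n)
    case (Suc n)
    have "(\<Prod>m=2..Suc n+1. 1 - 1 / (real m)\<^sup>2)
        = (real n + 2) / (2 * (real n + 1)) * (1 - 1 / (real n + 2)\<^sup>2)"
      using Suc by (simp add: prod.cl_ivl_Suc add.commute)
    also have "\<dots> = (real (Suc n) + 2) / (2 * (real (Suc n) + 1))"
    proof -
      have "(x + 2) / (2 * (x + 1)) * (1 - 1 / (x + 2)\<^sup>2) = (x + 3) / (2 * (x + 2))" if "x \<ge> 0" for x :: real
      proof -
        have eq: "1 - 1 / (x + 2)\<^sup>2 = ((x + 1) * (x + 3)) / (x + 2)\<^sup>2"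
          using that by (simp add: divide_simps) (simp add: power2_eq_square algebra_simps)
        have cancel: "a / (2 * b) * (b * c / a\<^sup>2) = c / (2 * a)" if "a \<noteq> 0" "b \<noteq> 0" for a b c :: real
          using that by (simp add: field_simps power2_eq_square)
        show ?thesis unfolding eq by (rule cancel) (use that in auto)
      qed
      from this[of "real n"] show ?thesis by (simp add: add_ac)
    qed
    finally show ?case .
  qed simp
  obtain n where n: "A \<subseteq> {2..n+1}"
  proof -
    obtain n where "A \<subseteq> {..<n}" using finite_nat_bounded[OF A(1)] by blast
    then have "2 \<le> p \<and> p \<le> n + 1" if "p \<in> A" for p
      using A(2) that prime_ge_2_nat[of p] by (auto dest: subsetD)
    then have "A \<subseteq> {2..n+1}" by (simp add: subset_iff)
    then show thesis by (rule that)
  qed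
  have "1 / 2 \<le> (real n + 2) / (2 * (real n + 1))" by (simp add: field_simps)
  also have "\<dots> = (\<Prod>m=2..n+1. 1 - 1 / (real m)\<^sup>2)" by (rule tel[symmetric])
  also have "\<dots> \<le> (\<Prod>m=2..n+1. if m \<in> A then 1 - 1 / real m ^ d else 1)"
  proof (intro prod_mono conjI)
    fix m assume m: "m \<in> {2..n+1}"
    then have "(1::real) \<le> (real m)\<^sup>2" "(real m)\<^sup>2 \<le> real m ^ d"
      using d by (auto intro!: power_increasing)
    moreover from this have "1 / real m ^ d \<le> 1 / (real m)\<^sup>2"
      using m by (intro divide_left_mono) simp_all
    moreover have "1 / real m ^ d \<ge> 0" by simp
    ultimately have "1 / real m ^ d \<le> 1 / (real m)\<^sup>2" "1 / (real m)\<^sup>2 \<le> 1" "0 \<le> 1 / real m ^ d"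
      by (auto simp: divide_le_eq_1)
    then show "0 \<le> 1 - 1 / (real m)\<^sup>2" "1 - 1 / (real m)\<^sup>2 \<le> (if m \<in> A then 1 - 1 / real m ^ d else 1)"
      by auto
  qed
  also have "\<dots> = (\<Prod>p\<in>A. 1 - 1 / real p ^ d)"
    using n by (intro prod.mono_neutral_cong_right) auto
  finally show ?thesis .
qed

section \<open>Primitive vectors and the sieve\<close>

lemma primitive_vectors_iff:
  "v \<in> primitive_vectors \<longleftrightarrow> v \<noteq> 0 \<and> (\<forall>p. prime p \<longrightarrow> \<not> divides_vec p v)"
proof (cases "v = 0")
  case False
  define G where "G = Gcd {v $ i | i. v $ i \<noteq> 0}"
  obtain i where i: "v $ i \<noteq> 0" using False by (auto simp: vec_eq_iff)
  have dvd: "int p dvd G \<longleftrightarrow> divides_vec p v" for p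
    unfolding G_def dvd_Gcd_iff divides_vec_def by force
  have "G dvd v $ i" unfolding G_def using i by (intro Gcd_dvd) auto
  then have "G \<noteq> 0" using i by auto
  have "G = int (nat G)" unfolding G_def by simp
  have "G = 1 \<longleftrightarrow> nat G = 1" using \<open>G = int (nat G)\<close> by linarith
  also have "\<dots> \<longleftrightarrow> (\<forall>p. prime p \<longrightarrow> \<not> p dvd nat G)"
    using prime_factor_nat[of "nat G"] by (metis not_prime_unit)
  also have "\<dots> \<longleftrightarrow> (\<forall>p. prime p \<longrightarrow> \<not> divides_vec p v)"
    unfolding dvd[symmetric] using \<open>G = int (nat G)\<close> by (metis int_dvd_int_iff)
  finally show ?thesis using False by (simp add: primitive_vectors_def G_def)
qed (simp add: primitive_vectors_def)

definition primes_upto :: "nat \<Rightarrow> nat set" where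
  "primes_upto K = {p. prime p \<and> p \<le> K}"

lemma finite_primes_upto [simp]: "finite (primes_upto K)"
  by (simp add: primes_upto_def)

lemma primitive_cube_subset_sieved: "primitive_cube N \<subseteq> sieved_cube (primes_upto K) N"
  by (auto simp: primitive_cube_def sieved_cube_def primitive_vectors_iff primes_upto_def)

lemma finite_sieved_cube [simp]: "finite (sieved_cube A N)"
  by (simp add: sieved_cube_def)

text \<open>
  Compare with the telescoping sum of \<open>1 / (m - 1) - 1 / m\<close>.
\<close>

lemma sum_inverse_squares_tail:
  assumes "K > 0"
  shows "(\<Sum>m\<in>{K<..N}. 1 / (real m)\<^sup>2) \<le> 1 / real K"
proof -
  have "(\<Sum>m\<in>{K<..N}. 1 / (real m)\<^sup>2) \<le> 1 / real K - 1 / real N" if "N \<ge> K" for N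
    using that
  proof (induction N rule: dec_induct)
    case (step n)
    have "{K<..Suc n} = insert (Suc n) {K<..n}" using step by auto
    moreover have "1 / (real (Suc n))\<^sup>2 \<le> 1 / real n - 1 / real (Suc n)"
    proof -
      have "1 / real n - 1 / real (Suc n) = 1 / (real n * real (Suc n))"
        using step assms by (simp add: field_simps)
      also have "\<dots> \<ge> 1 / (real (Suc n))\<^sup>2"
        using step assms unfolding power2_eq_square by (intro divide_left_mono mult_right_mono) auto
      finally show ?thesis .
    qed
    ultimately show ?case using step by simp
  qed simp
  note bound = this
  show ?thesis
  proof (cases "N \<ge> K")
    case True
    have "1 / real K - 1 / real N \<le> 1 / real K" by simp
    with bound[OF True] show ?thesis by (rule order_trans)
  qed simp
qed

text \<open>
  A vector that passes the sieve without being primitive is divisible by a prime \<open>p > K\<close>, and \<open>p \<le> N\<close>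
  because the vector is non-zero. The cube contains at most \<open>(3 N / m)\<close> to the power \<open>d\<close> multiples of
  \<open>m \<le> N\<close>, and for \<open>d \<ge> 2\<close> the sum over \<open>m > K\<close> is small by comparison with the inverse squares. The
  condition \<open>K \<ge> 2\<close> makes the sieve exclude the zero vector.
\<close>

lemma card_sieved_minus_primitive:
  assumes d: "CARD('d::finite) \<ge> 2" and K: "K \<ge> 2" and N: "N > 0"
  shows "real (card (sieved_cube (primes_upto K) N - primitive_cube N :: (int ^ 'd) set))
    \<le> (3/2) ^ CARD('d) / real K * real (card (lattice_cube N :: (int ^ 'd) set))"
proof -
  let ?d = "CARD('d)"
  let ?D = "\<lambda>m. {v \<in> lattice_cube N. divides_vec m (v :: int ^ 'd)}"
  have "sieved_cube (primes_upto K) N - primitive_cube N \<subseteq> (\<Union>m\<in>{K<..N}. ?D m)"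
  proof
    fix v :: "int ^ 'd" assume v: "v \<in> sieved_cube (primes_upto K) N - primitive_cube N"
    then have vN: "v \<in> lattice_cube N" and small: "\<And>p. prime p \<Longrightarrow> p \<le> K \<Longrightarrow> \<not> divides_vec p v"
      by (auto simp: sieved_cube_def primes_upto_def)
    have "v \<noteq> 0" using small[of 2] K by (auto simp: divides_vec_def)
    then obtain p where p: "prime p" "divides_vec p v"
      using v vN by (auto simp: primitive_cube_def primitive_vectors_iff)
    obtain i where i: "v $ i \<noteq> 0" using \<open>v \<noteq> 0\<close> by (auto simp: vec_eq_iff)
    have "int p \<le> \<bar>v $ i\<bar>" using p(2) i by (intro zdvd_imp_le) (auto simp: divides_vec_def)
    also have "\<dots> \<le> int N" using vN by (auto simp: lattice_cube_def abs_le_iff minus_le_iff)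
    finally have "p \<in> {K<..N}" using small[OF p(1)] p(2) by force
    then show "v \<in> (\<Union>m\<in>{K<..N}. ?D m)" using vN p(2) by blast
  qed
  then have "card (sieved_cube (primes_upto K) N - primitive_cube N :: (int ^ 'd) set)
      \<le> card (\<Union>m\<in>{K<..N}. ?D m)"
    by (intro card_mono) auto
  also have "\<dots> \<le> (\<Sum>m\<in>{K<..N}. card (?D m))" by (rule card_UN_le) simp
  also have "real \<dots> \<le> (\<Sum>m\<in>{K<..N}. (3 * real N) ^ ?d * (1 / (real m)\<^sup>2))"
    unfolding of_nat_sum
  proof (rule sum_mono)
    fix m assume m: "m \<in> {K<..N}"
    then have m0: "m > 0" "m \<le> N" by auto
    have "1 \<le> N div m" using m0 by (simp add: Suc_le_eq div_greater_zero_iff)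
    then have "2 * real (N div m) + 1 \<le> 3 * real (N div m)" by simp
    also have "\<dots> \<le> 3 * (real N / real m)" using of_nat_div_le_of_nat[of N m, where ?'a = real] by simp
    finally have "(2 * real (N div m) + 1) ^ ?d \<le> (3 * (real N / real m)) ^ ?d"
      by (intro power_mono) auto
    also have "\<dots> = (3 * real N) ^ ?d * (1 / real m ^ ?d)" by (simp add: power_divide power_mult_distrib)
    also have "\<dots> \<le> (3 * real N) ^ ?d * (1 / (real m)\<^sup>2)"
    proof (intro mult_left_mono divide_left_mono)
      show "(real m)\<^sup>2 \<le> real m ^ ?d" using d m0 by (intro power_increasing) auto
    qed (use m0 in auto)
    finally show "real (card (?D m)) \<le> (3 * real N) ^ ?d * (1 / (real m)\<^sup>2)"
      unfolding card_cube_multiples[OF m0(1)] by (simp add: add.commute)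
  qed
  also have "\<dots> \<le> (3 * real N) ^ ?d * (1 / real K)"
    unfolding sum_distrib_left[symmetric] using K
    by (intro mult_left_mono sum_inverse_squares_tail) auto
  also have "\<dots> = (3/2) ^ ?d / real K * (2 * real N) ^ ?d"
  proof -
    have *: "(3/2) ^ ?d * (2 * real N) ^ ?d = (3 * real N) ^ ?d"
      unfolding power_mult_distrib[symmetric] by simp
    show ?thesis unfolding *[symmetric] by simp
  qed
  also have "\<dots> \<le> (3/2) ^ ?d / real K * real (card (lattice_cube N :: (int ^ 'd) set))"
    unfolding card_lattice_cube of_nat_power by (intro mult_left_mono power_mono) auto
  finally show ?thesis by simp
qed

section \<open>Fourier expansion of the sieve\<close>

text \<open>
  A geometric sum of roots of unity.
\<close>

lemma sum_unit_fractions: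
  assumes "k > 0"
  shows "(\<Sum>x\<in>unit_fractions k. cis (- 2 * pi * of_int n * x)) = (if int k dvd n then of_nat k else 0)"
proof -
  define z where "z = cis (2 * pi * (- of_int n / of_nat k))"
  have z_pow: "z ^ a = cis (- 2 * pi * of_int n * (of_nat a / of_nat k))" for a
  proof -
    have "real a * (2 * pi * (- of_int n / of_nat k)) = - 2 * pi * of_int n * (of_nat a / of_nat k)" by simp
    then show ?thesis by (simp only: z_def Complex.DeMoivre)
  qed
  have "(\<Sum>x\<in>unit_fractions k. cis (- 2 * pi * of_int n * x)) = (\<Sum>a<k. z ^ a)"
    unfolding unit_fractions_eq[OF assms] z_pow using assms
    by (subst sum.reindex) (auto intro!: inj_onI)
  also have "\<dots> = (if int k dvd n then of_nat k else 0)"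
  proof (cases "int k dvd n")
    case True
    then obtain l where "n = int k * l" by auto
    then have "- of_int n / of_nat k = real_of_int (- l)" using assms by simp
    then have "z = 1" unfolding z_def cis_2pi_eq_1_iff by (simp only: Ints_of_int)
    then show ?thesis using True by simp
  next
    case False
    have "- real_of_int n / real k \<notin> \<int>"
    proof
      assume "- real_of_int n / real k \<in> \<int>"
      then obtain l :: int where "- real_of_int n / real k = of_int l" by (rule Ints_cases)
      then have "real_of_int n = of_int (int k * (- l))" using assms by (simp add: field_simps)
      then have "n = int k * (- l)" by linarith
      then show False using False by simp
    qed
    then have "z \<noteq> 1" unfolding z_def cis_2pi_eq_1_iff .
    moreover have "z ^ k = 1"
      using assms cis_2pi_eq_1_iff[of "- of_int n"] by (simp add: z_pow)
    ultimately show ?thesis using False by (simp add: geometric_sum)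
  qed
  finally show ?thesis .
qed

lemma sum_characters:
  fixes v :: "int ^ 'd::finite"
  assumes "k > 0"
  shows "(\<Sum>\<alpha>\<in>vec_box (unit_fractions k). cnj (lattice_character \<alpha> v))
    = (if divides_vec k v then of_nat k ^ CARD('d) else 0)"
proof -
  have "cnj (lattice_character \<alpha> v) = (\<Prod>i\<in>UNIV. cis (- 2 * pi * of_int (v $ i) * \<alpha> $ i))" for \<alpha>
  proof -
    have "cnj (lattice_character \<alpha> v) = cis (\<Sum>i\<in>UNIV. - 2 * pi * of_int (v $ i) * \<alpha> $ i)"
      by (simp add: lattice_character_alt cis_cnj sum_distrib_left sum_negf mult.assoc)
    also have "\<dots> = (\<Prod>i\<in>UNIV. cis (- 2 * pi * of_int (v $ i) * \<alpha> $ i))"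
      by (simp add: cis_conv_exp sum_distrib_left exp_sum)
    finally show ?thesis .
  qed
  then have "(\<Sum>\<alpha>\<in>vec_box (unit_fractions k). cnj (lattice_character \<alpha> v))
      = (\<Prod>i\<in>UNIV. if int k dvd v $ i then of_nat k else 0)"
    using sum_prod_vec_box[OF finite_unit_fractions[OF assms], of "\<lambda>i x. cis (- 2 * pi * of_int (v $ i) * x)"]
    by (simp only: sum_unit_fractions[OF assms])
  also have "\<dots> = (if divides_vec k v then of_nat k ^ CARD('d) else 0)"
    by (auto simp: divides_vec_def intro!: prod_zero)
  finally show ?thesis .
qed

text \<open>
  The order of a torsion point of exponent \<open>\<Prod>B\<close> divides \<open>\<Prod>B\<close>, hence is the product of a unique
  subset of \<open>B\<close>.
\<close>

lemma sum_torsion_by_order: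
  fixes B :: "nat set" and E :: "real ^ 'd::finite \<Rightarrow> 'c::comm_monoid_add"
  assumes B: "finite B" "\<forall>p\<in>B. prime p"
  shows "(\<Sum>\<alpha>\<in>vec_box (unit_fractions (\<Prod>B)). E \<alpha>)
    = (\<Sum>C\<in>Pow B. \<Sum>\<alpha>\<in>torus_points_of_order (\<Prod>C). E \<alpha>)"
proof -
  have "vec_box (unit_fractions (\<Prod>B)) = (\<Union>C\<in>Pow B. torus_points_of_order (\<Prod>C) :: (real ^ 'd) set)"
    unfolding vec_box_unit_fractions[OF prod_primes_pos[OF B(2)]] divisors_prod_primes[OF B] by simp
  moreover have "torus_points_of_order (\<Prod>C) \<inter> torus_points_of_order (\<Prod>C') = ({} :: (real ^ 'd) set)"
    if "C \<in> Pow B" "C' \<in> Pow B" "C \<noteq> C'" for C C'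
    using inj_onD[OF inj_on_prod_primes[OF B(2,1)], of C C'] that
    by (auto simp: torus_points_of_order_def)
  ultimately show ?thesis using B(1) by (simp add: sum.UNION_disjoint)
qed

text \<open>
  The left-hand side is the Fourier expansion of the sieve by \<open>A\<close>, with \<open>E \<alpha>\<close> in place of the character
  of frequency \<open>-\<alpha>\<close>. A point of order \<open>\<Prod>C\<close> occurs in the terms with \<open>C \<subseteq> B\<close>. Summing the products of
  \<open>w p = -1 / p^d\<close> over these \<open>B\<close> gives one factor \<open>w p\<close> for every \<open>p \<in> C\<close> and one factor \<open>1 + w p\<close> for
  every other \<open>p \<in> A\<close>. Since \<open>w p = (1 + w p) * (- 1 / (p^d - 1))\<close>, the density of the sieve splits off and
  the remaining factors multiply to \<open>\<mu>(\<Prod>C) / J(\<Prod>C)\<close>.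
\<close>

lemma sieve_coefficients:
  fixes A :: "nat set" and E :: "real ^ 'd::finite \<Rightarrow> complex"
  assumes A: "finite A" "\<forall>p\<in>A. prime p"
  shows "(\<Sum>B\<in>Pow A. (-1) ^ card B / of_nat (\<Prod>B) ^ CARD('d) * (\<Sum>\<alpha>\<in>vec_box (unit_fractions (\<Prod>B)). E \<alpha>))
    = of_real (\<Prod>p\<in>A. 1 - 1 / real p ^ CARD('d)) *
      (\<Sum>C\<in>Pow A. of_int (moebius_mu (\<Prod>C)) / of_nat (jordan_totient CARD('d) (\<Prod>C))
         * (\<Sum>\<alpha>\<in>torus_points_of_order (\<Prod>C). E \<alpha>))"
proof -
  let ?d = "CARD('d)"
  define w :: "nat \<Rightarrow> complex" where "w p = - 1 / of_nat p ^ ?d" for p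
  define F where "F C = (\<Sum>\<alpha>\<in>torus_points_of_order (\<Prod>C). E \<alpha>)" for C :: "nat set"
  have sub: "finite C" "\<forall>p\<in>C. prime p" if "C \<subseteq> A" for C
    using that A by (auto intro: finite_subset)
  have w: "(-1) ^ card B / of_nat (\<Prod>B) ^ ?d = (\<Prod>p\<in>B. w p)" for B
    by (simp add: w_def prod_uminus prod_dividef prod_power_distrib)
  have "(\<Sum>B\<in>Pow A. (-1) ^ card B / of_nat (\<Prod>B) ^ ?d * (\<Sum>\<alpha>\<in>vec_box (unit_fractions (\<Prod>B)). E \<alpha>))
      = (\<Sum>B\<in>Pow A. \<Sum>C\<in>{C \<in> Pow A. C \<subseteq> B}. (\<Prod>p\<in>B. w p) * F C)"
  proof (intro sum.cong refl)
    fix B assume B: "B \<in> Pow A"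
    then have "{C \<in> Pow A. C \<subseteq> B} = Pow B" by auto
    then show "(-1) ^ card B / of_nat (\<Prod>B) ^ ?d * (\<Sum>\<alpha>\<in>vec_box (unit_fractions (\<Prod>B)). E \<alpha>)
        = (\<Sum>C\<in>{C \<in> Pow A. C \<subseteq> B}. (\<Prod>p\<in>B. w p) * F C)"
      using B by (simp only: w sum_torsion_by_order[OF sub] Pow_iff F_def sum_distrib_left)
  qed
  also have "\<dots> = (\<Sum>C\<in>Pow A. \<Sum>B\<in>{B \<in> Pow A. C \<subseteq> B}. (\<Prod>p\<in>B. w p) * F C)"
    using A(1) by (intro sum.swap_restrict) auto
  also have "\<dots> = (\<Sum>C\<in>Pow A. of_real (\<Prod>p\<in>A. 1 - 1 / real p ^ ?d)
      * (of_int (moebius_mu (\<Prod>C)) / of_nat (jordan_totient ?d (\<Prod>C)) * F C))"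
  proof (intro sum.cong refl)
    fix C assume "C \<in> Pow A"
    then have C: "C \<subseteq> A" by simp
    note C' = sub[OF C]
    have J: "of_nat (jordan_totient ?d (\<Prod>C)) = (\<Prod>p\<in>C. of_nat p ^ ?d - 1 :: complex)"
      using arg_cong[OF jordan_totient_prod_primes[OF C', of ?d], of "of_int :: int \<Rightarrow> complex"] by simp
    have "(\<Prod>p\<in>C. w p) = (\<Prod>p\<in>C. (w p + 1) * (- 1 / (of_nat p ^ ?d - 1)))"
    proof (intro prod.cong refl)
      fix p assume "p \<in> C"
      then have "p > 1" using C'(2) prime_gt_1_nat by blast
      then have "p ^ ?d > 1" by (intro one_less_power) auto
      then have "of_nat (p ^ ?d) \<noteq> (1 :: complex)" by (metis less_irrefl of_nat_1 of_nat_eq_iff)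
      then show "w p = (w p + 1) * (- 1 / (of_nat p ^ ?d - 1))"
        using \<open>p > 1\<close> by (simp add: w_def field_simps)
    qed
    also have "\<dots> = (\<Prod>p\<in>C. w p + 1) * (of_int (moebius_mu (\<Prod>C)) / of_nat (jordan_totient ?d (\<Prod>C)))"
      unfolding prod.distrib J moebius_mu_prod_primes[OF C']
      by (simp add: prod_uminus prod_dividef)
    finally have "(\<Prod>p\<in>C. w p) * (\<Prod>p\<in>A - C. w p + 1)
        = ((\<Prod>p\<in>C. w p + 1) * (\<Prod>p\<in>A - C. w p + 1))
          * (of_int (moebius_mu (\<Prod>C)) / of_nat (jordan_totient ?d (\<Prod>C)))" by simp
    also have "(\<Prod>p\<in>C. w p + 1) * (\<Prod>p\<in>A - C. w p + 1) = (\<Prod>p\<in>A. w p + 1)"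
      using C A(1) by (simp add: prod.subset_diff[of C A] mult.commute)
    also have "\<dots> = of_real (\<Prod>p\<in>A. 1 - 1 / real p ^ ?d)" by (simp add: w_def)
    finally have "(\<Prod>p\<in>C. w p) * (\<Prod>p\<in>A - C. w p + 1) = of_real (\<Prod>p\<in>A. 1 - 1 / real p ^ ?d)
        * (of_int (moebius_mu (\<Prod>C)) / of_nat (jordan_totient ?d (\<Prod>C)))" .
    moreover have "{B \<in> Pow A. C \<subseteq> B} = {B. C \<subseteq> B \<and> B \<subseteq> A}" by auto
    ultimately show "(\<Sum>B\<in>{B \<in> Pow A. C \<subseteq> B}. (\<Prod>p\<in>B. w p) * F C) = of_real (\<Prod>p\<in>A. 1 - 1 / real p ^ ?d)
        * (of_int (moebius_mu (\<Prod>C)) / of_nat (jordan_totient ?d (\<Prod>C)) * F C)"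
      using sum_supersets_prod[OF A(1) C, of w] by (simp add: sum_distrib_right[symmetric] mult.assoc)
  qed
  also have "\<dots> = of_real (\<Prod>p\<in>A. 1 - 1 / real p ^ ?d) *
      (\<Sum>C\<in>Pow A. of_int (moebius_mu (\<Prod>C)) / of_nat (jordan_totient ?d (\<Prod>C)) * F C)"
    by (rule sum_distrib_left[symmetric])
  finally show ?thesis unfolding F_def .
qed

section \<open>Averages over primitive vectors\<close>

text \<open>
  This is the normalized Ramanujan sum: the mean of a character of order \<open>q \<ge> 1\<close> over the residue
  classes modulo \<open>q\<close> that are coprime to \<open>q\<close>.
\<close>

definition ramanujan_coeff :: "nat \<Rightarrow> nat \<Rightarrow> complex" where
  "ramanujan_coeff d q = of_int (moebius_mu q) / of_nat (jordan_totient d q)"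

lemma norm_ramanujan_coeff: "cmod (ramanujan_coeff d q) \<le> 1"
proof -
  have "cmod (of_int (moebius_mu q)) \<le> 1" by (simp add: moebius_mu_def norm_power)
  \<comment> \<open>This includes \<open>n = 0\<close>, where the quotient is \<open>0\<close>.\<close>
  moreover have "1 / real n \<le> 1" for n by (cases n) auto
  ultimately have "cmod (of_int (moebius_mu q)) * (1 / real (jordan_totient d q)) \<le> 1 * 1"
    by (intro mult_mono) auto
  then show ?thesis by (simp add: ramanujan_coeff_def norm_divide)
qed

lemma ramanujan_coeff_1: "ramanujan_coeff d 1 = 1"
  using jordan_totient_prod_primes[of "{}" d] moebius_mu_prod_primes[of "{}"]
  by (simp add: ramanujan_coeff_def)

lemma squarefree_if_ramanujan_coeff_nonzero: "ramanujan_coeff d q \<noteq> 0 \<Longrightarrow> squarefree q"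
  by (simp add: ramanujan_coeff_def moebius_mu_def split: if_splits)

context prob_preserving_action
begin

text \<open>
  The normalization is by the cardinality of the whole cube for every \<open>V\<close>, so that the sums over
  different sets can be compared.
\<close>

definition cube_sum_avg :: "(int ^ 'd) set \<Rightarrow> nat \<Rightarrow> ('a \<Rightarrow> complex) \<Rightarrow> 'a \<Rightarrow> complex" where
  "cube_sum_avg V N f = (\<lambda>x. (\<Sum>v\<in>V. koopman T v f x) / of_nat (card (lattice_cube N :: (int ^ 'd) set)))"

definition sieved_part :: "nat set \<Rightarrow> ('a \<Rightarrow> complex) \<Rightarrow> 'a \<Rightarrow> complex" where
  "sieved_part A f = (\<lambda>x. \<Sum>q\<in>(\<lambda>C. \<Prod>C) ` Pow A. ramanujan_coeff CARD('d) q * order_part M T q f x)"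

lemma cube_sum_avg_L2 [intro]: "f \<in> L2 M \<Longrightarrow> cube_sum_avg V N f \<in> L2 M"
  using L2_cmult[OF L2_sum[of V "\<lambda>v. koopman T v f" M], of "1 / of_nat (card (lattice_cube N :: (int ^ 'd) set))"]
  by (auto simp: cube_sum_avg_def)

lemma cube_sum_avg_diff_norm_le:
  assumes f: "f \<in> L2 M" and V: "finite V" "U \<subseteq> V"
  shows "L2_norm M (\<lambda>x. cube_sum_avg V N f x - cube_sum_avg U N f x)
    \<le> real (card (V - U)) / real (card (lattice_cube N :: (int ^ 'd) set)) * L2_norm M f"
proof -
  let ?q = "of_nat (card (lattice_cube N :: (int ^ 'd) set)) :: complex"
  have "cube_sum_avg V N f x - cube_sum_avg U N f x = (\<Sum>v\<in>V - U. (1 / ?q) * koopman T v f x)" for x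
    unfolding cube_sum_avg_def sum_distrib_left[symmetric] sum_diff[OF V]
    by (simp add: diff_divide_distrib)
  then have "L2_norm M (\<lambda>x. cube_sum_avg V N f x - cube_sum_avg U N f x)
      \<le> (\<Sum>v\<in>V - U. cmod (1 / ?q)) * L2_norm M f"
    using koopman_sum_norm_le[OF f, where A = "V - U" and c = "\<lambda>_. 1 / ?q"] by simp
  then show ?thesis by (simp add: norm_divide)
qed

lemma sieved_part_L2 [intro]: "f \<in> L2 M \<Longrightarrow> sieved_part A f \<in> L2 M"
  unfolding sieved_part_def by (intro L2_lincomb order_part_L2)

text \<open>
  The indicator of the sieve is a finite combination of characters, so the sieved average is a finite
  combination of twisted cube averages, each of which converges by the mean ergodic theorem.
\<close>

lemma sieved_average_tendsto:
  assumes f: "f \<in> L2 M" and A: "finite A" "\<forall>p\<in>A. prime p"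
  shows "L2_tendsto M (\<lambda>N. cube_sum_avg (sieved_cube A N) N f)
    (\<lambda>x. of_real (\<Prod>p\<in>A. 1 - 1 / real p ^ CARD('d)) * sieved_part A f x)"
proof -
  let ?c = "\<lambda>B. (-1) ^ card B / of_nat (\<Prod>B) ^ CARD('d) :: complex"
  let ?G = "\<lambda>B. vec_box (unit_fractions (\<Prod>B)) :: (real ^ 'd) set"
  have avg: "cube_sum_avg (sieved_cube A N) N f x = (\<Sum>B\<in>Pow A. ?c B * (\<Sum>\<alpha>\<in>?G B. 1 * cube_avg T \<alpha> N f x))" for N x
  proof -
    let ?q = "of_nat (card (lattice_cube N :: (int ^ 'd) set)) :: complex"
    have indicator: "(if \<forall>p\<in>A. \<not> divides_vec p v then 1 else 0)
        = (\<Sum>B\<in>Pow A. ?c B * (\<Sum>\<alpha>\<in>?G B. cnj (lattice_character \<alpha> v)))" for v :: "int ^ 'd"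
      unfolding sieved_cube_indicator[OF A]
    proof (intro sum.cong refl)
      fix B assume "B \<in> Pow A"
      then have pos: "\<Prod>B > 0" using A(2) by (intro prod_primes_pos) auto
      then have "of_nat (\<Prod>B) \<noteq> (0 :: complex)"
        unfolding of_nat_eq_0_iff by (rule gr_implies_not0)
      then have "of_nat (\<Prod>B) ^ CARD('d) \<noteq> (0 :: complex)" by (rule power_not_zero)
      then show "(-1) ^ card B * (if divides_vec (\<Prod>B) v then 1 else 0)
          = ?c B * (\<Sum>\<alpha>\<in>?G B. cnj (lattice_character \<alpha> v))"
        unfolding sum_characters[OF pos] by (simp del: of_nat_prod)
    qed
    have "(\<Sum>v\<in>sieved_cube A N. koopman T v f x)
        = (\<Sum>v\<in>lattice_cube N. (if \<forall>p\<in>A. \<not> divides_vec p v then 1 else 0) * koopman T v f x)"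
      unfolding sieved_cube_def by (intro sum.mono_neutral_cong_left) auto
    also have "\<dots> = (\<Sum>v\<in>lattice_cube N. \<Sum>B\<in>Pow A. ?c B * (\<Sum>\<alpha>\<in>?G B. cnj (lattice_character \<alpha> v) * koopman T v f x))"
      unfolding indicator sum_distrib_right mult.assoc ..
    also have "\<dots> = (\<Sum>B\<in>Pow A. \<Sum>v\<in>lattice_cube N. ?c B * (\<Sum>\<alpha>\<in>?G B. cnj (lattice_character \<alpha> v) * koopman T v f x))"
      by (rule sum.swap)
    also have "\<dots> = (\<Sum>B\<in>Pow A. ?c B * (\<Sum>\<alpha>\<in>?G B. \<Sum>v\<in>lattice_cube N. cnj (lattice_character \<alpha> v) * koopman T v f x))"
      unfolding sum_distrib_left[symmetric] by (subst sum.swap) (rule refl)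
    finally have "cube_sum_avg (sieved_cube A N) N f x = (\<Sum>B\<in>Pow A. ?c B * (\<Sum>\<alpha>\<in>?G B. \<Sum>v\<in>lattice_cube N. cnj (lattice_character \<alpha> v) * koopman T v f x)) / ?q"
      by (simp add: cube_sum_avg_def)
    then show ?thesis
      by (simp only: cube_avg_def sum_divide_distrib times_divide_eq_right[symmetric] mult_1)
  qed
  have lim: "L2_tendsto M (\<lambda>N x. \<Sum>B\<in>Pow A. ?c B * (\<Sum>\<alpha>\<in>?G B. 1 * cube_avg T \<alpha> N f x))
      (\<lambda>x. \<Sum>B\<in>Pow A. ?c B * (\<Sum>\<alpha>\<in>?G B. 1 * eigen_part M T \<alpha> f x))"
    by (intro L2_tendsto_lincomb eigen_part_tendsto f)
  have "(\<Sum>B\<in>Pow A. ?c B * (\<Sum>\<alpha>\<in>?G B. 1 * eigen_part M T \<alpha> f x))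
      = of_real (\<Prod>p\<in>A. 1 - 1 / real p ^ CARD('d)) * sieved_part A f x" for x
  proof -
    have "sieved_part A f x = (\<Sum>C\<in>Pow A. ramanujan_coeff CARD('d) (\<Prod>C) * order_part M T (\<Prod>C) f x)"
      unfolding sieved_part_def using inj_on_prod_primes[OF A(2,1)] by (simp add: sum.reindex)
    then show ?thesis
      using sieve_coefficients[OF A, of "\<lambda>\<alpha>. eigen_part M T \<alpha> f x"]
      by (simp only: ramanujan_coeff_def order_part_def mult_1)
  qed
  then have "(\<lambda>x. of_real (\<Prod>p\<in>A. 1 - 1 / real p ^ CARD('d)) * sieved_part A f x)
      = (\<lambda>x. \<Sum>B\<in>Pow A. ?c B * (\<Sum>\<alpha>\<in>?G B. 1 * eigen_part M T \<alpha> f x))"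
    by (intro ext) (rule sym)
  moreover have "(\<lambda>N. cube_sum_avg (sieved_cube A N) N f)
      = (\<lambda>N x. \<Sum>B\<in>Pow A. ?c B * (\<Sum>\<alpha>\<in>?G B. 1 * cube_avg T \<alpha> N f x))"
    by (intro ext) (rule avg)
  ultimately show ?thesis using lim by (simp only:)
qed

lemma sieved_part_norm_le:
  assumes f: "f \<in> L2 M" and A: "finite A"
  shows "L2_norm M (sieved_part A f) \<le> L2_norm M f"
proof (rule power2_le_imp_le)
  let ?Q = "(\<lambda>C. \<Prod>C) ` Pow A"
  have "(L2_norm M (sieved_part A f))\<^sup>2
      = (\<Sum>q\<in>?Q. (cmod (ramanujan_coeff CARD('d) q))\<^sup>2 * (L2_norm M (order_part M T q f))\<^sup>2)"
    unfolding sieved_part_def using A by (intro order_part_lincomb_norm f) auto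
  also have "\<dots> \<le> (\<Sum>q\<in>?Q. (L2_norm M (order_part M T q f))\<^sup>2)"
    by (intro sum_mono mult_left_le_one_le) (auto intro: power_le_one norm_ramanujan_coeff)
  also have "\<dots> \<le> (L2_norm M f)\<^sup>2" using A by (intro order_part_Bessel f) auto
  finally show "(L2_norm M (sieved_part A f))\<^sup>2 \<le> (L2_norm M f)\<^sup>2" .
qed simp

text \<open>
  The products of primes up to \<open>K\<close> include all squarefree \<open>q \<le> K\<close>. Hence the sieved part differs from a
  long partial sum of the series only by terms with \<open>q > K\<close>.
\<close>

lemma sieved_part_approximates:
  assumes f: "f \<in> L2 M" and e: "e > 0"
    and S: "L2_tendsto M (\<lambda>n x. \<Sum>q=2..n. ramanujan_coeff CARD('d) q * order_part M T q f x) S"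
  shows "\<exists>K0. \<forall>K\<ge>K0.
    L2_norm M (\<lambda>x. sieved_part (primes_upto K) f x - (order_part M T 1 f x + S x)) \<le> e"
proof -
  let ?t = "\<lambda>q x. ramanujan_coeff CARD('d) q * order_part M T q f x"
  let ?P = "order_part M T 1 f"
  obtain n0 where n0: "\<And>F. finite F \<Longrightarrow> F \<subseteq> {n0..} \<Longrightarrow> L2_norm M (\<lambda>x. \<Sum>q\<in>F. ?t q x) < e"
    using order_part_tail[OF f, of "ramanujan_coeff CARD('d)", OF norm_ramanujan_coeff e] by blast
  have "L2_norm M (\<lambda>x. sieved_part (primes_upto K) f x - (?P x + S x)) \<le> e" if K: "K \<ge> n0" for K
  proof -
    define Q where "Q = (\<lambda>C. \<Prod>C) ` Pow (primes_upto K)"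
    have fin: "finite Q" by (simp add: Q_def)
    have pos: "q \<ge> 1" if "q \<in> Q" for q
    proof -
      obtain C where C: "C \<subseteq> primes_upto K" "q = \<Prod>C" using \<open>q \<in> Q\<close> unfolding Q_def by blast
      then have "\<Prod>C > 0" by (intro prod_primes_pos) (auto simp: primes_upto_def)
      then show ?thesis unfolding C(2) by linarith
    qed
    obtain m where m: "Q \<subseteq> {..<m}" using finite_nat_bounded[OF fin] by blast
    have bound: "L2_norm M (\<lambda>x. sieved_part (primes_upto K) f x - (?P x + (\<Sum>q=2..n. ?t q x))) \<le> e"
      if n: "n \<ge> max m 1" for n
    proof -
      define F where "F = {q \<in> {1..n} - Q. squarefree q}"
      have "1 \<le> q \<and> q \<le> n" if "q \<in> Q" for q
        using pos[OF that] subsetD[OF m that] n by simp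
      then have sub: "Q \<subseteq> {1..n}" by (simp add: subset_iff)
      have "F \<subseteq> {n0..}"
      proof
        fix q assume q: "q \<in> F"
        have "\<not> q \<le> K"
        proof
          assume "q \<le> K"
          have "prime_factors q \<subseteq> primes_upto K"
          proof
            fix p assume p: "p \<in> prime_factors q"
            then have "p \<le> q" using q by (intro dvd_imp_le) (auto simp: F_def)
            then show "p \<in> primes_upto K" using p \<open>q \<le> K\<close> by (auto simp: primes_upto_def)
          qed
          moreover have "\<Prod>(prime_factors q) = q" using q by (intro squarefree_eq_prod_primes) (simp add: F_def)
          ultimately have "q \<in> Q" unfolding Q_def by (intro image_eqI[of _ _ "prime_factors q"]) auto
          then show False using q by (simp add: F_def)
        qed
        then show "q \<in> {n0..}" using K by simp
      qed
      have eq: "sieved_part (primes_upto K) f x - (?P x + (\<Sum>q=2..n. ?t q x)) = - 1 * (\<Sum>q\<in>F. ?t q x)" for x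
      proof -
        have "{1..n} = insert 1 {2..n}" using n by auto
        then have "?P x + (\<Sum>q=2..n. ?t q x) = (\<Sum>q=1..n. ?t q x)"
          by (simp add: ramanujan_coeff_1[unfolded One_nat_def])
        also have "\<dots> = (\<Sum>q\<in>Q. ?t q x) + (\<Sum>q\<in>{1..n} - Q. ?t q x)"
          using sum.subset_diff[OF sub, of "\<lambda>q. ?t q x"] by simp
        also have "(\<Sum>q\<in>{1..n} - Q. ?t q x) = (\<Sum>q\<in>F. ?t q x)"
          by (intro sum.mono_neutral_right) (auto simp: F_def dest: squarefree_if_ramanujan_coeff_nonzero)
        finally show ?thesis by (simp add: sieved_part_def Q_def)
      qed
      have "L2_norm M (\<lambda>x. \<Sum>q\<in>F. ?t q x) < e"
        using \<open>F \<subseteq> {n0..}\<close> by (intro n0) (simp_all add: F_def)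
      then show ?thesis unfolding eq L2_norm_cmult by simp
    qed
    have tends: "L2_tendsto M (\<lambda>n x. - 1 * (?P x + (\<Sum>q=2..n. ?t q x)) + sieved_part (primes_upto K) f x)
        (\<lambda>x. - 1 * (?P x + S x) + sieved_part (primes_upto K) f x)"
      using f by (intro L2_tendsto_add L2_tendsto_cmult S) (auto simp: L2_tendsto_def)
    have "(\<lambda>n. L2_norm M (\<lambda>x. sieved_part (primes_upto K) f x - (?P x + (\<Sum>q=2..n. ?t q x))))
        \<longlonglongrightarrow> L2_norm M (\<lambda>x. sieved_part (primes_upto K) f x - (?P x + S x))"
      using L2_tendsto_norm[OF tends] by (simp add: algebra_simps)
    then show ?thesis
      by (rule LIMSEQ_le_const2) (intro exI[of _ "max m 1"] allI impI bound)
  qed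
  then show ?thesis by blast
qed

lemma primitive_density:
  assumes d: "CARD('d) \<ge> 2" and e: "e > 0"
  shows "\<exists>K0. \<forall>K\<ge>K0. \<forall>N>0.
    real (card (sieved_cube (primes_upto K) N - primitive_cube N :: (int ^ 'd) set))
      / real (card (lattice_cube N :: (int ^ 'd) set)) \<le> e"
proof -
  obtain k :: nat where k: "(3/2) ^ CARD('d) / e < real k" using reals_Archimedean2 by blast
  have "real (card (sieved_cube (primes_upto K) N - primitive_cube N :: (int ^ 'd) set))
      / real (card (lattice_cube N :: (int ^ 'd) set)) \<le> e" if K: "K \<ge> max k 2" and N: "N > 0" for K N
  proof -
    have "(3/2) ^ CARD('d) / e < real K" using k K by linarith
    then have "(3/2) ^ CARD('d) / real K \<le> e" using e K by (simp add: field_simps)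
    then have "(3/2) ^ CARD('d) / real K * real (card (lattice_cube N :: (int ^ 'd) set))
        \<le> e * real (card (lattice_cube N :: (int ^ 'd) set))"
      by (intro mult_right_mono) auto
    then have "real (card (sieved_cube (primes_upto K) N - primitive_cube N :: (int ^ 'd) set))
        \<le> e * real (card (lattice_cube N :: (int ^ 'd) set))"
      using card_sieved_minus_primitive[OF d _ N, of K] K by simp
    then show ?thesis
      using card_lattice_cube_pos[of N, where ?'d = 'd] by (subst pos_divide_le_eq) auto
  qed
  then show ?thesis by blast
qed

text \<open>
  The sums over primitive vectors are compared with the sums over the vectors that pass the sieve by the
  primes up to \<open>K\<close>, first for fixed \<open>K\<close> as \<open>N\<close> grows. All estimates are made after normalization by the
  full cube. The density \<open>R N\<close> of the primitive vectors stays away from \<open>0\<close>, so one can divide by it at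
  the end.
\<close>

theorem primitive_average_tendsto:
  assumes d: "CARD('d) \<ge> 2" and f: "f \<in> L2 M"
    and S: "L2_tendsto M (\<lambda>n x. \<Sum>q=2..n. ramanujan_coeff CARD('d) q * order_part M T q f x) S"
  shows "L2_tendsto M
    (\<lambda>N x. (\<Sum>v\<in>primitive_cube N. koopman T v f x) / of_nat (card (primitive_cube N :: (int ^ 'd) set)))
    (\<lambda>x. order_part M T 1 f x + S x)"
proof -
  define G where "G = (\<lambda>x. order_part M T 1 f x + S x)"
  have GL2: "G \<in> L2 M" unfolding G_def using f L2_tendstoD(2)[OF S] by blast
  let ?q = "\<lambda>N. real (card (lattice_cube N :: (int ^ 'd) set))"
  define R where "R N = real (card (primitive_cube N :: (int ^ 'd) set)) / ?q N" for N
  define X where "X N = cube_sum_avg (primitive_cube N) N f" for N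
  have XL2: "X N \<in> L2 M" for N unfolding X_def using f by (rule cube_sum_avg_L2)
  have prim_sub: "primitive_cube N \<subseteq> sieved_cube (primes_upto K) N" for N K
    by (rule primitive_cube_subset_sieved)
  have fin_prim: "finite (primitive_cube N :: (int ^ 'd) set)" for N
    by (simp add: primitive_cube_def)
  have q_pos: "?q N > 0" for N by simp
  have R01: "0 \<le> R N" "R N \<le> 1" for N
  proof -
    have "card (primitive_cube N :: (int ^ 'd) set) \<le> card (lattice_cube N :: (int ^ 'd) set)"
      by (intro card_mono) (auto simp: primitive_cube_def)
    then show "R N \<le> 1" using q_pos[of N] by (simp add: R_def divide_le_eq_1)
    show "0 \<le> R N" by (simp add: R_def)
  qed
  define D where "D K = (\<Prod>p\<in>primes_upto K. 1 - 1 / real p ^ CARD('d))" for K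
  define s where "s K N = real (card (sieved_cube (primes_upto K) N :: (int ^ 'd) set)) / ?q N" for K N
  define t where "t K N = real (card (sieved_cube (primes_upto K) N - primitive_cube N :: (int ^ 'd) set)) / ?q N" for K N
  have s_lim: "s K \<longlonglongrightarrow> D K" for K
    unfolding s_def D_def by (rule density_sieved_cube) (auto simp: primes_upto_def)
  have D_ge: "1 / 2 \<le> D K" for K
    unfolding D_def by (intro sieve_density_ge_half d) (auto simp: primes_upto_def)
  have st: "s K N - R N = t K N" for K N
  proof -
    have "card (sieved_cube (primes_upto K) N - primitive_cube N :: (int ^ 'd) set)
      = card (sieved_cube (primes_upto K) N :: (int ^ 'd) set) - card (primitive_cube N :: (int ^ 'd) set)"
      using fin_prim prim_sub by (intro card_Diff_subset)
    moreover have "card (primitive_cube N :: (int ^ 'd) set) \<le> card (sieved_cube (primes_upto K) N :: (int ^ 'd) set)"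
      using prim_sub by (intro card_mono) auto
    ultimately show ?thesis by (simp add: s_def R_def t_def of_nat_diff diff_divide_distrib)
  qed
  have t_nonneg: "0 \<le> t K N" for K N by (simp add: t_def)
  have R_ge: "\<forall>\<^sub>F N in sequentially. 1 / 4 \<le> R N"
  proof -
    obtain K where K: "\<And>N. N > 0 \<Longrightarrow> t K N \<le> 1 / 8"
      using primitive_density[OF d, of "1 / 8"] unfolding t_def by auto
    \<comment> \<open>The sieve has density at least \<open>1 / 2\<close>, and the vectors that pass it without being
      primitive have proportion at most \<open>1 / 8\<close> in the cube.\<close>
    have "\<forall>\<^sub>F N in sequentially. 3 / 8 < s K N"
      using s_lim[of K] D_ge[of K] by (intro order_tendstoD(1)) auto
    then show ?thesis using eventually_gt_at_top[of 0]
    proof eventually_elim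
      case (elim N)
      then show ?case using K[of N] st[of K N] by simp
    qed
  qed
  have main: "(\<lambda>N. L2_norm M (\<lambda>x. X N x - of_real (R N) * G x)) \<longlonglongrightarrow> 0"
  proof (rule LIMSEQ_I)
    fix e :: real assume e: "e > 0"
    \<comment> \<open>The four errors below are at most \<open>\<eta> \<parallel>f\<parallel>\<close>, \<open>\<eta>\<close>, \<open>2 \<eta> \<parallel>f\<parallel>\<close> and \<open>\<eta>\<close>.\<close>
    define \<eta> where "\<eta> = e / (3 * L2_norm M f + 3)"
    have den: "3 * L2_norm M f + 3 > 0" using L2_norm_nonneg[of M f] by linarith
    then have \<eta>: "\<eta> > 0" using e by (simp add: \<eta>_def)
    obtain K1 where K1: "\<And>K. K \<ge> K1 \<Longrightarrow> L2_norm M (\<lambda>x. sieved_part (primes_upto K) f x - G x) \<le> \<eta>"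
      using sieved_part_approximates[OF f \<eta> S] unfolding G_def by blast
    obtain K2 where K2: "\<And>K N. K \<ge> K2 \<Longrightarrow> N > 0 \<Longrightarrow> t K N \<le> \<eta>"
      using primitive_density[OF d \<eta>] unfolding t_def by blast
    define K where "K = max K1 K2"
    define H where "H = sieved_part (primes_upto K) f"
    have HL2: "H \<in> L2 M" unfolding H_def using f by (rule sieved_part_L2)
    define Y where "Y N = cube_sum_avg (sieved_cube (primes_upto K) N) N f" for N
    have YL2: "Y N \<in> L2 M" for N unfolding Y_def using f by (rule cube_sum_avg_L2)
    have "L2_tendsto M Y (\<lambda>x. of_real (D K) * H x)"
      unfolding Y_def H_def D_def by (rule sieved_average_tendsto[OF f]) (auto simp: primes_upto_def)
    then have "(\<lambda>N. L2_norm M (\<lambda>x. Y N x - of_real (D K) * H x)) \<longlonglongrightarrow> 0" by (rule L2_tendstoD(3))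
    then have ev1: "\<forall>\<^sub>F N in sequentially. L2_norm M (\<lambda>x. Y N x - of_real (D K) * H x) < \<eta>"
      using \<eta> by (intro order_tendstoD(2)) auto
    have ev2: "\<forall>\<^sub>F N in sequentially. \<bar>s K N - D K\<bar> < \<eta>"
      using tendstoD[OF s_lim \<eta>, of K] by (simp add: dist_real_def)
    have "\<forall>\<^sub>F N in sequentially. L2_norm M (\<lambda>x. X N x - of_real (R N) * G x) < e"
      using ev1 ev2 eventually_gt_at_top[of 0]
    proof eventually_elim
      case (elim N)
      have tK: "t K N \<le> \<eta>" using elim by (intro K2) (simp_all add: K_def)
      have "L2_norm M (\<lambda>x. X N x - of_real (R N) * G x)
          \<le> L2_norm M (\<lambda>x. X N x - Y N x) + L2_norm M (\<lambda>x. Y N x - of_real (R N) * G x)"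
        by (intro L2_norm_triangle_diff XL2 YL2 L2_cmult GL2)
      also have "L2_norm M (\<lambda>x. Y N x - of_real (R N) * G x)
          \<le> L2_norm M (\<lambda>x. Y N x - of_real (D K) * H x) + L2_norm M (\<lambda>x. of_real (D K) * H x - of_real (R N) * G x)"
        by (intro L2_norm_triangle_diff HL2 YL2 L2_cmult GL2)
      also have "L2_norm M (\<lambda>x. of_real (D K) * H x - of_real (R N) * G x)
          \<le> L2_norm M (\<lambda>x. of_real (D K) * H x - of_real (R N) * H x)
            + L2_norm M (\<lambda>x. of_real (R N) * H x - of_real (R N) * G x)"
        by (intro L2_norm_triangle_diff HL2 L2_cmult GL2)
      finally have "L2_norm M (\<lambda>x. X N x - of_real (R N) * G x)
          \<le> L2_norm M (\<lambda>x. X N x - Y N x) + L2_norm M (\<lambda>x. Y N x - of_real (D K) * H x)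
            + L2_norm M (\<lambda>x. of_real (D K) * H x - of_real (R N) * H x)
            + L2_norm M (\<lambda>x. of_real (R N) * H x - of_real (R N) * G x)" by simp
      moreover have "L2_norm M (\<lambda>x. X N x - Y N x) \<le> \<eta> * L2_norm M f"
      proof -
        have "L2_norm M (\<lambda>x. Y N x - X N x) \<le> t K N * L2_norm M f"
          unfolding X_def Y_def t_def by (intro cube_sum_avg_diff_norm_le f prim_sub) simp
        also have "\<dots> \<le> \<eta> * L2_norm M f" using tK by (intro mult_right_mono) auto
        finally show ?thesis unfolding L2_norm_minus_commute[of M "X N" "Y N"] .
      qed
      moreover have "L2_norm M (\<lambda>x. of_real (D K) * H x - of_real (R N) * H x) \<le> 2 * \<eta> * L2_norm M f"
      proof -
        have "L2_norm M (\<lambda>x. of_real (D K) * H x - of_real (R N) * H x)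
            = L2_norm M (\<lambda>x. of_real (D K - R N) * H x)"
          by (simp add: left_diff_distrib)
        also have "\<dots> = \<bar>D K - R N\<bar> * L2_norm M H" by (simp only: L2_norm_cmult norm_of_real)
        also have "\<dots> \<le> (2 * \<eta>) * L2_norm M f"
        proof (rule mult_mono)
          show "\<bar>D K - R N\<bar> \<le> 2 * \<eta>" using elim(2) tK st[of K N] t_nonneg[of K N] by linarith
          show "L2_norm M H \<le> L2_norm M f" unfolding H_def by (intro sieved_part_norm_le f) simp
        qed (use \<eta> in auto)
        finally show ?thesis .
      qed
      moreover have "L2_norm M (\<lambda>x. of_real (R N) * H x - of_real (R N) * G x) \<le> \<eta>"
      proof -
        have "L2_norm M (\<lambda>x. of_real (R N) * H x - of_real (R N) * G x)
            = L2_norm M (\<lambda>x. of_real (R N) * (H x - G x))"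
          by (simp add: right_diff_distrib)
        also have "\<dots> = R N * L2_norm M (\<lambda>x. H x - G x)" using R01[of N] by (simp only: L2_norm_cmult norm_of_real abs_of_nonneg)
        also have "\<dots> \<le> 1 * \<eta>"
          using R01[of N] K1[of K] by (intro mult_mono) (auto simp: K_def H_def)
        finally show ?thesis by simp
      qed
      ultimately have "L2_norm M (\<lambda>x. X N x - of_real (R N) * G x) < \<eta> * (3 * L2_norm M f + 3)"
        using elim(1) \<eta> by (simp add: algebra_simps)
      also have "\<dots> = e" using den by (simp add: \<eta>_def)
      finally show ?case .
    qed
    then show "\<exists>N0. \<forall>N\<ge>N0. norm (L2_norm M (\<lambda>x. X N x - of_real (R N) * G x) - 0) < e"
      unfolding eventually_sequentially by simp
  qed
  define A where "A N = (\<lambda>x. (\<Sum>v\<in>primitive_cube N. koopman T v f x) / of_nat (card (primitive_cube N :: (int ^ 'd) set)))" for N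
  have AL2: "A N \<in> L2 M" for N
    using L2_cmult[OF L2_sum[of "primitive_cube N" "\<lambda>v. koopman T v f" M],
        of "1 / of_nat (card (primitive_cube N :: (int ^ 'd) set))"] f
    by (auto simp: A_def)
  have "\<forall>\<^sub>F N in sequentially. norm (L2_norm M (\<lambda>x. A N x - G x)) \<le> 4 * L2_norm M (\<lambda>x. X N x - of_real (R N) * G x)"
    using R_ge
  proof eventually_elim
    case (elim N)
    have R0: "R N \<noteq> 0" using elim by auto
    then have prim0: "card (primitive_cube N :: (int ^ 'd) set) \<noteq> 0" by (auto simp: R_def)
    have "A N x = of_real (1 / R N) * X N x" for x
      using prim0 q_pos[of N] by (simp add: A_def X_def R_def cube_sum_avg_def)
    then have "A N x - G x = of_real (1 / R N) * (X N x - of_real (R N) * G x)" for x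
      using R0 by (simp add: right_diff_distrib)
    then have "L2_norm M (\<lambda>x. A N x - G x) = \<bar>1 / R N\<bar> * L2_norm M (\<lambda>x. X N x - of_real (R N) * G x)"
      by (simp only: L2_norm_cmult norm_of_real)
    also have "\<dots> \<le> 4 * L2_norm M (\<lambda>x. X N x - of_real (R N) * G x)"
      using elim by (intro mult_right_mono) (auto simp: field_simps)
    finally show ?case by simp
  qed
  then have "(\<lambda>N. L2_norm M (\<lambda>x. A N x - G x)) \<longlonglongrightarrow> 0"
    by (rule Lim_null_comparison) (rule tendsto_mult_right_zero[OF main])
  then show ?thesis using AL2 GL2 unfolding L2_tendsto_def A_def G_def by blast
qed

end

theorem theorem1p1:
  fixes M :: "'a measure" and T :: "int ^ 'd \<Rightarrow> 'a \<Rightarrow> 'a" and f :: "'a \<Rightarrow> complex"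
  assumes "CARD('d) \<ge> 2"
    and "prob_preserving_action M T"
    and "L2_separable M"
    and "f \<in> L2 M"
  shows "\<exists>S.
    L2_tendsto M
      (\<lambda>n x. \<Sum>q=2..n. of_int (moebius_mu q) / of_nat (jordan_totient CARD('d) q)
                         * L2_proj M (Eig_order M T q) f x) S \<and>
    L2_tendsto M
      (\<lambda>N x. (\<Sum>v\<in>primitive_cube N. koopman T v f x)
                / of_nat (card (primitive_cube N :: (int ^ 'd) set)))
      (\<lambda>x. L2_proj M (invariant_functions M T) f x + S x)"
proof -
  interpret prob_preserving_action M T by fact
  note f = \<open>f \<in> L2 M\<close>
  note proj = L2_proj_eq[OF order_part_is_L2_proj[OF f] Eig_order_subset_L2 f]
  have "invariant_functions M T \<subseteq> L2 M" by (auto simp: invariant_functions_def)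
  note proj_inv = L2_proj_eq[OF order_part_1_is_L2_proj[OF f] this f]
  obtain S where S: "L2_tendsto M (\<lambda>n x. \<Sum>q=2..n. ramanujan_coeff CARD('d) q * order_part M T q f x) S"
    using order_part_series_converges[OF f, of "ramanujan_coeff CARD('d)", OF norm_ramanujan_coeff] by blast
  have "L2_tendsto M (\<lambda>n x. \<Sum>q=2..n. ramanujan_coeff CARD('d) q * L2_proj M (Eig_order M T q) f x) S"
  proof (rule L2_tendsto_cong_AE[OF S])
    show "(\<lambda>x. \<Sum>q=2..n. ramanujan_coeff CARD('d) q * L2_proj M (Eig_order M T q) f x) \<in> L2 M" for n
      by (intro L2_lincomb proj(1))
    have "AE x in M. \<forall>q. L2_proj M (Eig_order M T q) f x = order_part M T q f x"
      unfolding AE_all_countable using proj(2) by blast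
    then show "AE x in M. (\<Sum>q=2..n. ramanujan_coeff CARD('d) q * order_part M T q f x)
        = (\<Sum>q=2..n. ramanujan_coeff CARD('d) q * L2_proj M (Eig_order M T q) f x)" for n
      by eventually_elim simp
  qed (use L2_tendstoD(2)[OF S] in auto)
  moreover have "L2_tendsto M
      (\<lambda>N x. (\<Sum>v\<in>primitive_cube N. koopman T v f x)
                / of_nat (card (primitive_cube N :: (int ^ 'd) set)))
      (\<lambda>x. L2_proj M (invariant_functions M T) f x + S x)"
  proof (rule L2_tendsto_cong_AE)
    note lim = primitive_average_tendsto[OF assms(1) f S]
    show "L2_tendsto M
      (\<lambda>N x. (\<Sum>v\<in>primitive_cube N. koopman T v f x)
                / of_nat (card (primitive_cube N :: (int ^ 'd) set)))
      (\<lambda>x. order_part M T 1 f x + S x)" by (rule lim)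
    show "(\<lambda>x. (\<Sum>v\<in>primitive_cube N. koopman T v f x)
                / of_nat (card (primitive_cube N :: (int ^ 'd) set))) \<in> L2 M" for N
      by (rule L2_tendstoD(1)[OF lim])
    show "(\<lambda>x. L2_proj M (invariant_functions M T) f x + S x) \<in> L2 M"
      using proj_inv(1) L2_tendstoD(2)[OF S] by (rule L2_add)
    show "AE x in M. order_part M T 1 f x + S x = L2_proj M (invariant_functions M T) f x + S x"
      using proj_inv(2) by eventually_elim simp
  qed auto
  ultimately show ?thesis unfolding ramanujan_coeff_def by blast
qed

end
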